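(* Let $t_1,t_2\ge 0$ be integers, let $k_i=2$ for all $1\le i\le t_1$ and $p_j=2$ for all $1\le j\le t_2$, and let $t:=t_1+t_2$. There is $n_0$ such that for every $n\ge n_0$: if $G$ is a graph on $n$ vertices with $\lambda(G)\ge\lambda(F_{n,t})$, then $G$ contains $\mathcal{CP}_{2k_1,\ldots,2k_{t_1};2p_1,\ldots,2p_{t_2}}$ as a subgraph unless $G=F_{n,t}$.
   Context: $\lambda(G)$ is the adjacency spectral radius. $\mathcal{CP}_{2k_1,\ldots,2k_{t_1};2p_1,\ldots,2p_{t_2}}$ is the graph obtained by taking $t_1$ cycles of lengths $2k_1,\ldots,2k_{t_1}$ and $t_2$ paths on $2p_1,\ldots,2p_{t_2}$ vertices, all sharing exactly one common vertex and otherwise vertex-disjoint, each path having the common vertex as an endpoint (equivalently: from $t_1+t_2$ even cycles meeting at one vertex, delete from each of the last $t_2$ cycles one edge incident to the common vertex). Here this is $t_1$ four-cycles and $t_2$ paths on four vertices meeting at one vertex. $M_m:=\lfloor m/2\rfloor K_2\cup\gamma K_1$, $\gamma=m\bmod 2$, and $F_{n,k}:=K_k\vee M_{n-k}$. *)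

theory Defs
  imports
    "Graph_Theory.Pair_Digraph"
    "Graph_Theory.Digraph_Isomorphism"
    "Jordan_Normal_Form.Spectral_Radius"
begin

text \<open>
  A finite simple graph is a \<^locale>\<open>pair_graph\<close>: an undirected edge
  $uv$ is the pair of opposite arcs $(u,v)$, $(v,u)$, and there are no loops.
\<close>

definition adjacency_matrix :: "'a list \<Rightarrow> 'a pair_pre_digraph \<Rightarrow> complex mat" where
  "adjacency_matrix vs G =
     mat (length vs) (length vs) (\<lambda>(i, j). if (vs ! i, vs ! j) \<in> parcs G then 1 else 0)"

text \<open>
  The adjacency matrix depends on an enumeration of the vertices, its spectral radius does not;
  see \<open>adjacency_spectral_radius_eq\<close> below.
\<close>

definition adjacency_spectral_radius :: "'a pair_pre_digraph \<Rightarrow> real" where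
  "adjacency_spectral_radius G =
     spectral_radius (adjacency_matrix (SOME vs. distinct vs \<and> set vs = pverts G) G)"

text \<open>
  Not necessarily induced: \<^const>\<open>subgraph\<close> only asks for inclusion of vertices and arcs.
\<close>

definition contains_subgraph :: "'a pair_pre_digraph \<Rightarrow> 'b pair_pre_digraph \<Rightarrow> bool" where
  "contains_subgraph G H \<longleftrightarrow>
     (\<exists>H' :: 'a pair_pre_digraph. subgraph (with_proj H') (with_proj G)
        \<and> digraph_iso (with_proj H') (with_proj H))"

definition complete_graph :: "nat \<Rightarrow> nat pair_pre_digraph" where
  "complete_graph k = \<lparr> pverts = {..<k}, parcs = {(u, v). u < k \<and> v < k \<and> u \<noteq> v} \<rparr>"

text \<open>
  $\lfloor m/2 \rfloor K_2 \cup (m \bmod 2) K_1$: the edges are $\{2i, 2i+1\}$, so the vertex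
  $m - 1$ is isolated when $m$ is odd.
\<close>

definition near_matching_graph :: "nat \<Rightarrow> nat pair_pre_digraph" where
  "near_matching_graph m =
     (let S = {(2 * i, 2 * i + 1) | i. 2 * i + 1 < m}
      in \<lparr> pverts = {..<m}, parcs = S \<union> S\<inverse> \<rparr>)"

definition graph_join ::
    "'a pair_pre_digraph \<Rightarrow> 'b pair_pre_digraph \<Rightarrow> ('a + 'b) pair_pre_digraph" where
  "graph_join G H =
     \<lparr> pverts = pverts G <+> pverts H,
       parcs = {(Inl u, Inl v) | u v. (u, v) \<in> parcs G}
             \<union> {(Inr u, Inr v) | u v. (u, v) \<in> parcs H}
             \<union> {(Inl u, Inr v) | u v. u \<in> pverts G \<and> v \<in> pverts H}
             \<union> {(Inr v, Inl u) | u v. u \<in> pverts G \<and> v \<in> pverts H} \<rparr>"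

definition F_graph :: "nat \<Rightarrow> nat \<Rightarrow> (nat + nat) pair_pre_digraph" where
  "F_graph n k = graph_join (complete_graph k) (near_matching_graph (n - k))"

text \<open>
  \<open>CP_graph cs qs\<close> consists of cycles of lengths \<open>cs\<close> and paths on
  \<open>qs\<close> vertices. The \<open>i\<close>-th piece has the vertices
  \<open>CP_vertex i 0, CP_vertex i 1, \<dots>\<close> in this order (cycles come first); position
  \<open>0\<close> is the common vertex \<open>(0, 0)\<close> of all pieces, and the cycles have an
  additional edge from the last position back to it. With no pieces at all, the graph is a
  single vertex. Cycle lengths below 3 are not meaningful.
\<close>

definition CP_vertex :: "nat \<Rightarrow> nat \<Rightarrow> nat \<times> nat" where
  "CP_vertex i j = (if j = 0 then (0, 0) else (i, j))"

definition CP_graph :: "nat list \<Rightarrow> nat list \<Rightarrow> (nat \<times> nat) pair_pre_digraph" where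
  "CP_graph cs qs =
     (let ms = cs @ qs;
          S = {(CP_vertex i j, CP_vertex i (Suc j)) | i j. i < length ms \<and> Suc j < ms ! i}
            \<union> {(CP_vertex i (cs ! i - 1), CP_vertex i 0) | i. i < length cs}
      in \<lparr> pverts = {(0, 0)} \<union> {CP_vertex i j | i j. i < length ms \<and> j < ms ! i},
           parcs = S \<union> S\<inverse> \<rparr>)"


lemma pair_graph_complete_graph: "pair_graph (complete_graph k)"
  by unfold_locales
    (auto simp: complete_graph_def symmetric_def sym_def
       intro: finite_subset[of _ "{..<k} \<times> {..<k}"])

lemma pair_graph_near_matching_graph: "pair_graph (near_matching_graph m)"
  by unfold_locales
    (auto simp: near_matching_graph_def symmetric_def sym_def Let_def
       intro: finite_subset[of _ "{..<m} \<times> {..<m}"])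

lemma pair_graph_graph_join:
  assumes "pair_graph G" "pair_graph H"
  shows "pair_graph (graph_join G H)"
proof -
  interpret G: pair_graph G by fact
  interpret H: pair_graph H by fact
  have sG: "(v, u) \<in> parcs G" if "(u, v) \<in> parcs G" for u v
    using G.pair_sym_arcs that by (auto simp: symmetric_def sym_def)
  have sH: "(v, u) \<in> parcs H" if "(u, v) \<in> parcs H" for u v
    using H.pair_sym_arcs that by (auto simp: symmetric_def sym_def)
  have sub: "parcs (graph_join G H) \<subseteq> pverts (graph_join G H) \<times> pverts (graph_join G H)"
    by (auto simp: graph_join_def dest: G.wellformed' H.wellformed')
  have fin: "finite (pverts (graph_join G H))"
    using G.pair_finite_verts H.pair_finite_verts by (simp add: graph_join_def)
  show ?thesis
  proof unfold_locales
    show "finite (parcs (graph_join G H))"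
      using sub fin by (meson finite_SigmaI finite_subset)
    show "symmetric (with_proj (graph_join G H))"
      by (auto simp: symmetric_def sym_def graph_join_def dest: sG sH)
    show "fst e \<noteq> snd e" if "e \<in> parcs (graph_join G H)" for e
      using that by (auto simp: graph_join_def dest: G.no_loops' H.no_loops')
  qed (use sub fin in auto)
qed

lemma pair_graph_F_graph: "pair_graph (F_graph n k)"
  unfolding F_graph_def
  by (intro pair_graph_graph_join pair_graph_complete_graph pair_graph_near_matching_graph)

lemma card_F_graph: "k \<le> n \<Longrightarrow> card (pverts (F_graph n k)) = n"
  by (simp add: F_graph_def graph_join_def complete_graph_def near_matching_graph_def Let_def
      card_Plus)

lemma pair_graph_CP_graph:
  assumes "\<forall>c\<in>set cs. c \<ge> 3"
  shows "pair_graph (CP_graph cs qs)"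
proof -
  let ?P = "CP_graph cs qs"
  have c: "3 \<le> cs ! i" if "i < length cs" for i
    using assms that by simp
  have "pverts ?P = {(0, 0)} \<union>
      (\<Union>i<length (cs @ qs). CP_vertex i ` {..<(cs @ qs) ! i})"
    by (auto simp: CP_graph_def Let_def)
  then have fin: "finite (pverts ?P)" by simp
  have 1: "CP_vertex i j \<in> pverts ?P" if "i < length (cs @ qs)" "j < (cs @ qs) ! i" for i j
    using that by (auto simp: CP_graph_def Let_def)
  have 2: "CP_vertex i j \<in> pverts ?P" if "i < length cs" "j < cs ! i" for i j
    using that 1[of i j] by (simp add: nth_append)
  define S where
    "S = {(CP_vertex i j, CP_vertex i (Suc j)) | i j.
            i < length (cs @ qs) \<and> Suc j < (cs @ qs) ! i}
       \<union> {(CP_vertex i (cs ! i - 1), CP_vertex i 0) | i. i < length cs}"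
  have arcs: "parcs ?P = S \<union> S\<inverse>"
    by (simp add: CP_graph_def Let_def S_def)
  have S: "fst e \<in> pverts ?P \<and> snd e \<in> pverts ?P \<and> fst e \<noteq> snd e" if "e \<in> S" for e
  proof -
    from that consider
        (step) i j where "e = (CP_vertex i j, CP_vertex i (Suc j))"
          "i < length (cs @ qs)" "Suc j < (cs @ qs) ! i"
      | (close) i where "e = (CP_vertex i (cs ! i - 1), CP_vertex i 0)" "i < length cs"
      unfolding S_def by blast
    then show ?thesis
    proof cases
      case step
      then show ?thesis
        using 1[of i j] 1[of i "Suc j"] by (simp add: CP_vertex_def)
    next
      case close
      then show ?thesis
        using 2[of i "cs ! i - 1"] 2[of i 0] c[of i] by (auto simp: CP_vertex_def)
    qed
  qed
  have sub: "parcs ?P \<subseteq> pverts ?P \<times> pverts ?P"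
    using S unfolding arcs by force
  show ?thesis
  proof unfold_locales
    show "finite (parcs ?P)"
      using sub fin by (meson finite_SigmaI finite_subset)
    show "symmetric (with_proj ?P)"
      by (auto simp: symmetric_def sym_def arcs)
    show "fst e \<noteq> snd e" if "e \<in> parcs ?P" for e
    proof -
      have "e \<in> S \<or> prod.swap e \<in> S" using that unfolding arcs by (cases e) auto
      then show ?thesis using S[of e] S[of "prod.swap e"] by (cases e) auto
    qed
  qed (use sub fin in auto)
qed

lemma eigenvalue_adjacency_matrix_cong:
  assumes d: "distinct vs" "distinct ws" and s: "set vs = set ws"
    and ev: "eigenvalue (adjacency_matrix vs G) c"
  shows "eigenvalue (adjacency_matrix ws G) c"
proof -
  let ?n = "length vs"
  have n: "length ws = ?n" using d s by (metis distinct_card)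
  have "\<forall>i<?n. \<exists>j<?n. vs ! j = ws ! i"
    using s n by (metis in_set_conv_nth)
  then obtain p where p: "\<And>i. i < ?n \<Longrightarrow> p i < ?n" "\<And>i. i < ?n \<Longrightarrow> vs ! p i = ws ! i"
    by metis
  have inj: "inj_on p {..<?n}"
    by (rule inj_onI) (metis p(2) d(2) n lessThan_iff nth_eq_iff_index_eq)
  have img: "p ` {..<?n} = {..<?n}"
    by (rule endo_inj_surj) (use p inj in auto)
  from ev obtain v where v: "v \<in> carrier_vec ?n" "v \<noteq> 0\<^sub>v ?n"
      and eq: "adjacency_matrix vs G *\<^sub>v v = c \<cdot>\<^sub>v v"
    by (auto simp: eigenvalue_def eigenvector_def adjacency_matrix_def)
  define w where "w = vec ?n (\<lambda>i. v $ p i)"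
  have "w \<noteq> 0\<^sub>v ?n"
  proof
    assume "w = 0\<^sub>v ?n"
    then have "v $ p i = 0" if "i < ?n" for i
      using that by (metis index_vec index_zero_vec(1) w_def)
    then have "v $ j = 0" if "j < ?n" for j
      using that img by (metis imageE lessThan_iff)
    then have "v = 0\<^sub>v ?n" using v(1) by (intro eq_vecI) auto
    with v(2) show False ..
  qed
  moreover have "adjacency_matrix ws G *\<^sub>v w = c \<cdot>\<^sub>v w"
  proof (rule eq_vecI)
    fix i assume "i < dim_vec (c \<cdot>\<^sub>v w)"
    then have i: "i < ?n" by (simp add: w_def)
    let ?a = "\<lambda>x y. if (x, y) \<in> parcs G then 1 else 0 :: complex"
    have "(adjacency_matrix ws G *\<^sub>v w) $ i = (\<Sum>j<?n. ?a (ws ! i) (ws ! j) * v $ p j)"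
      using i n by (simp add: adjacency_matrix_def w_def scalar_prod_def lessThan_atLeast0)
    also have "\<dots> = (\<Sum>j<?n. ?a (vs ! p i) (vs ! p j) * v $ p j)"
      using i by (intro sum.cong) (simp_all add: p)
    also have "\<dots> = (\<Sum>j<?n. ?a (vs ! p i) (vs ! j) * v $ j)"
      using sum.reindex[OF inj, of "\<lambda>j. ?a (vs ! p i) (vs ! j) * v $ j"] img by simp
    also have "\<dots> = (adjacency_matrix vs G *\<^sub>v v) $ p i"
      using p(1)[OF i] v(1) by (simp add: adjacency_matrix_def scalar_prod_def lessThan_atLeast0)
    also have "\<dots> = (c \<cdot>\<^sub>v w) $ i"
      using p(1)[OF i] i v(1) by (simp add: eq w_def)
    finally show "(adjacency_matrix ws G *\<^sub>v w) $ i = (c \<cdot>\<^sub>v w) $ i" .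
  qed (simp add: adjacency_matrix_def w_def n)
  ultimately show ?thesis
    unfolding eigenvalue_def eigenvector_def
    by (intro exI[of _ w]) (simp add: adjacency_matrix_def n, simp add: w_def)
qed

lemma adjacency_spectral_radius_eq:
  assumes "distinct vs" "set vs = pverts G"
  shows "adjacency_spectral_radius G = spectral_radius (adjacency_matrix vs G)"
proof -
  define ws where "ws = (SOME vs. distinct vs \<and> set vs = pverts G)"
  have ws: "distinct ws \<and> set ws = pverts G"
    unfolding ws_def by (rule someI[of _ vs]) (use assms in simp)
  have "spectrum (adjacency_matrix ws G) = spectrum (adjacency_matrix vs G)"
    unfolding spectrum_def
    using eigenvalue_adjacency_matrix_cong[of ws vs G] eigenvalue_adjacency_matrix_cong[of vs ws G]
      ws assms
    by auto
  then show ?thesis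
    by (simp add: adjacency_spectral_radius_def spectral_radius_def flip: ws_def)
qed

end

theory Submission
  imports Defs "HOL-Analysis.Function_Topology" "HOL-Number_Theory.Cong"
begin

text \<open>
  Paths are contained in cycles, so it is enough to find \<open>t\<close> four-cycles that pairwise meet in
  one vertex \<open>v\<close>. If there are none at \<open>v\<close>, a maximal family of such cycles yields a set \<open>S\<close>
  of at most \<open>3t\<close> vertices such that every other vertex has at most one neighbour in
  \<open>N v - S\<close>, and at most \<open>t - 1\<close> vertices have \<open>3t\<close> or more common neighbours with \<open>v\<close>. Hence
  two-walks are few. Let \<open>x\<close> be a Perron vector with maximum \<open>1\<close>.

  For \<open>t \<ge> 2\<close> the bound $\lambda^2 \ge t(n - t)$ and the count of two-walks give
  $\sum_v x_v = O(\sqrt n)$. The equation for $\lambda^2 x_z$ at a maximal entry \<open>z\<close> then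
  produces \<open>t\<close> vertices of weight close to \<open>1\<close> and degree $n - O(\sqrt n)$. Joining all vertices
  to these and keeping only a matching elsewhere turns \<open>G\<close> into a copy of $F_{n,t}$ without
  decreasing the quadratic form at \<open>x\<close>. So \<open>x\<close> is an eigenvector of the copy as well, which
  forces the two graphs to coincide.

  For \<open>t = 1\<close> the graph has no four-cycle, and $\lambda^2 - \lambda$ is \<open>n - 1\<close> minus the
  \<open>x\<close>-average of the number of vertices without a common neighbour with \<open>v\<close>. For odd \<open>n\<close> this number
  vanishes and the friendship theorem applies; for even \<open>n\<close> a parity argument determines where
  it is nonzero.
\<close>

section \<open>Rayleigh quotients\<close>

text \<open>The hardest estimate for \<open>t \<ge> 2\<close> concerns vertices outside the core.
  Such a vertex shares at most one non-core neighbour with each core vertex, but this says nothing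
  about its neighbours in \<open>far\<close>, the O(sqrt n) vertices without a neighbour in the
  core. Entries in \<open>far\<close> are therefore bounded in terms of a bound \<open>mu\<close>
  for all non-core entries, and feeding the result back once brings the sum over non-core neighbours
  below 1/2, while every core entry is at least 1/2. Hence one missing core edge pays for all other
  edges at a vertex. For \<open>t = 1\<close> the square of the spectral radius and the number of
  two-walks from a typical vertex are both about n. No constant factor is left to bound the sum of
  the entries, so exact identities replace estimates. The graph is not assumed connected. A Perron
  vector is at first only nonnegative and nonzero, and its positivity is deduced from the structure
  found in each case. The threshold 3t is what greedy choice needs: t cycles use at most 3t vertices
  besides their common one.\<close>

locale simple_graph =
  fixes V :: "'a set" and N :: "'a \<Rightarrow> 'a set"
  assumes finite_V: "finite V"
    and N_subset: "N v \<subseteq> V"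
    and N_sym: "u \<in> N v \<Longrightarrow> v \<in> N u"
    and N_irrefl: "v \<notin> N v"
begin

lemma finite_N [simp, intro]: "finite (N v)"
  using finite_subset[OF N_subset finite_V] .

lemma N_sym_iff: "u \<in> N v \<longleftrightarrow> v \<in> N u"
  using N_sym by blast

text \<open>The quadratic form of the adjacency matrix; every edge enters once in each
  direction.\<close>

definition quad :: "('a \<Rightarrow> real) \<Rightarrow> real" where
  "quad y = (\<Sum>v\<in>V. \<Sum>u\<in>N v. y v * y u)"

lemma sum_N_swap:
  fixes f :: "'a \<Rightarrow> 'a \<Rightarrow> 'b::comm_monoid_add"
  assumes "X \<subseteq> V" "Y \<subseteq> V"
  shows "(\<Sum>v\<in>X. \<Sum>u\<in>N v \<inter> Y. f v u) = (\<Sum>u\<in>Y. \<Sum>v\<in>N u \<inter> X. f v u)"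
proof -
  have fin: "finite X" "finite Y" using assms finite_V finite_subset by blast+
  have "(\<Sum>v\<in>X. \<Sum>u\<in>N v \<inter> Y. f v u) = (\<Sum>v\<in>X. \<Sum>u\<in>Y. if u \<in> N v then f v u else 0)"
    by (rule sum.cong[OF refl]) (subst Int_commute, rule sum.inter_restrict[OF fin(2)])
  also have "\<dots> = (\<Sum>u\<in>Y. \<Sum>v\<in>X. if u \<in> N v then f v u else 0)"
    by (rule sum.swap)
  also have "\<dots> = (\<Sum>u\<in>Y. \<Sum>v\<in>X. if v \<in> N u then f v u else 0)"
    by (intro sum.cong refl) (simp add: N_sym_iff)
  also have "\<dots> = (\<Sum>u\<in>Y. \<Sum>v\<in>N u \<inter> X. f v u)"
    by (rule sum.cong[OF refl]) (subst Int_commute, rule sum.inter_restrict[OF fin(1), symmetric])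
  finally show ?thesis .
qed

lemma sum_N_swap_V:
  fixes f :: "'a \<Rightarrow> 'a \<Rightarrow> 'b::comm_monoid_add"
  shows "(\<Sum>v\<in>V. \<Sum>u\<in>N v. f v u) = (\<Sum>u\<in>V. \<Sum>v\<in>N u. f v u)"
  using sum_N_swap[of V V f] N_subset by (simp add: Int_absorb2)

text \<open>The form is affine in each single entry because there are no loops, so no term in
  \<open>e\<^sup>2\<close> appears.\<close>

lemma quad_fun_upd:
  assumes v: "v \<in> V"
  shows "quad (x(v := x v + e)) = quad x + 2 * e * (\<Sum>u\<in>N v. x u)"
proof -
  let ?d = "\<lambda>w. if w = v then e else 0"
  have "quad (x(v := x v + e)) = (\<Sum>w\<in>V. \<Sum>u\<in>N w. (x w + ?d w) * (x u + ?d u))"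
    unfolding quad_def by (intro sum.cong refl) auto
  also have "\<dots> = (\<Sum>w\<in>V. \<Sum>u\<in>N w. x w * x u + ?d w * x u + x w * ?d u)"
  proof (intro sum.cong refl)
    fix w u assume "u \<in> N w"
    then have "\<not> (w = v \<and> u = v)" using N_irrefl by auto
    then show "(x w + ?d w) * (x u + ?d u) = x w * x u + ?d w * x u + x w * ?d u"
      by (auto simp: algebra_simps)
  qed
  also have "\<dots> = quad x + (\<Sum>w\<in>V. \<Sum>u\<in>N w. ?d w * x u) + (\<Sum>w\<in>V. \<Sum>u\<in>N w. x w * ?d u)"
    by (simp add: quad_def sum.distrib)
  also have "(\<Sum>w\<in>V. \<Sum>u\<in>N w. x w * ?d u) = (\<Sum>w\<in>V. \<Sum>u\<in>N w. ?d w * x u)"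
    by (subst sum_N_swap_V) (simp add: mult.commute)
  also have "(\<Sum>w\<in>V. \<Sum>u\<in>N w. ?d w * x u) = (\<Sum>w\<in>V. if w = v then e * (\<Sum>u\<in>N v. x u) else 0)"
    by (intro sum.cong refl) (auto simp: sum_distrib_left)
  also have "\<dots> = e * (\<Sum>u\<in>N v. x u)" using v finite_V by simp
  finally have "quad (x(v := x v + e)) = quad x + e * (\<Sum>u\<in>N v. x u) + e * (\<Sum>u\<in>N v. x u)" .
  then show ?thesis by (simp only: mult_2 distrib_right add.assoc)
qed

text \<open>A maximiser of the Rayleigh quotient is an eigenvector: changing the entry at
  \<open>v\<close> by \<open>e\<close> shows that \<open>\<rho> * e\<^sup>2 + 2 * e * g\<close> is
  nonnegative for every real \<open>e\<close>, so the defect \<open>g\<close> of the eigenvalue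
  equation at \<open>v\<close> vanishes. This serves both to find a Perron vector and, later, to
  show that the vector of the given graph is an eigenvector of the comparison graph.\<close>

lemma rayleigh_equality:
  assumes ub: "\<And>y. quad y \<le> \<rho> * (\<Sum>v\<in>V. (y v)\<^sup>2)"
    and eq: "quad x \<ge> \<rho> * (\<Sum>v\<in>V. (x v)\<^sup>2)" and v: "v \<in> V"
  shows "(\<Sum>u\<in>N v. x u) = \<rho> * x v"
proof -
  define g where "g = \<rho> * x v - (\<Sum>u\<in>N v. x u)"
  have key: "0 \<le> \<rho> * e\<^sup>2 + 2 * e * g" for e
  proof -
    have "(\<Sum>w\<in>V. ((x(v := x v + e)) w)\<^sup>2) = (x v + e)\<^sup>2 + (\<Sum>w\<in>V - {v}. (x w)\<^sup>2)"
      using v finite_V by (subst sum.remove[of _ v]) auto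
    also have "\<dots> = (\<Sum>w\<in>V. (x w)\<^sup>2) + 2 * e * x v + e\<^sup>2"
      using v finite_V by (subst (2) sum.remove[of _ v]) (auto simp: power2_eq_square algebra_simps)
    finally have s: "(\<Sum>w\<in>V. ((x(v := x v + e)) w)\<^sup>2) = (\<Sum>w\<in>V. (x w)\<^sup>2) + 2 * e * x v + e\<^sup>2" .
    have "quad x + 2 * e * (\<Sum>u\<in>N v. x u) \<le> \<rho> * ((\<Sum>w\<in>V. (x w)\<^sup>2) + 2 * e * x v + e\<^sup>2)"
      using ub[of "x(v := x v + e)"] unfolding s quad_fun_upd[OF v] .
    then show ?thesis using eq by (simp add: g_def algebra_simps)
  qed
  \<comment> \<open>The sign of \<open>\<rho>\<close> is unknown here, so the minimising step
    \<open>- g / r\<close> is taken with a positive upper bound of \<open>\<rho>\<close>.\<close>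
  define r where "r = \<bar>\<rho>\<bar> + 1"
  have r: "r > 0" "\<rho> \<le> r" by (auto simp: r_def)
  have "0 \<le> \<rho> * (- g / r)\<^sup>2 + 2 * (- g / r) * g" by (rule key)
  also have "\<dots> \<le> r * (- g / r)\<^sup>2 + 2 * (- g / r) * g"
    using r by (intro add_right_mono mult_right_mono) auto
  also have "\<dots> = - (g\<^sup>2 / r)" using r by (simp add: power2_eq_square field_simps)
  finally have "g\<^sup>2 \<le> 0" using r by (simp add: divide_le_0_iff)
  then show ?thesis by (simp add: g_def)
qed

text \<open>Fixing the value \<open>0\<close> outside \<open>V\<close> keeps the domain compact in
  the product topology even if the type is infinite. Absolute values only increase the form, so the
  maximum can be sought among nonnegative vectors.\<close>

lemma rayleigh_max_attained:
  assumes ne: "V \<noteq> {}"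
  obtains x where "\<And>v. 0 \<le> x v" "(\<Sum>v\<in>V. (x v)\<^sup>2) = 1"
    "\<And>y. quad y \<le> quad x * (\<Sum>v\<in>V. (y v)\<^sup>2)"
proof -
  let ?B = "PiE UNIV (\<lambda>v. if v \<in> V then {0..1::real} else {0})"
  let ?q = "\<lambda>x::'a \<Rightarrow> real. \<Sum>v\<in>V. (x v)\<^sup>2"
  let ?S = "?B \<inter> {x. ?q x = 1}"
  have "compactin (product_topology (\<lambda>_. euclidean) UNIV) ?B"
    by (subst compactin_PiE) auto
  then have cB: "compact ?B" by (simp add: euclidean_product_topology)
  have "closed {x. ?q x = 1}"
    by (intro closed_Collect_eq continuous_intros continuous_on_product_coordinates)
  then have cS: "compact ?S" by (rule compact_Int_closed[OF cB])
  have norm: "(\<lambda>v. if v \<in> V then \<bar>y v\<bar> / sqrt (?q y) else 0) \<in> ?S" if "?q y > 0" for y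
  proof -
    have "\<bar>y v\<bar> \<le> sqrt (?q y)" if "v \<in> V" for v
      using member_le_sum[of v V "\<lambda>v. (y v)\<^sup>2"] that finite_V
      by (intro real_le_rsqrt) auto
    moreover have "(\<Sum>v\<in>V. (\<bar>y v\<bar> / sqrt (?q y))\<^sup>2) = 1"
      using that by (simp add: power_divide sum_divide_distrib[symmetric])
    ultimately show ?thesis using that by (auto simp: divide_le_eq)
  qed
  have "?q (\<lambda>_. 1) > 0" using ne finite_V by (simp add: card_gt_0_iff)
  from norm[OF this] have Sne: "?S \<noteq> {}" by (metis empty_iff)
  have cont: "continuous_on ?S quad"
    unfolding quad_def
    by (intro continuous_intros continuous_on_subset[OF continuous_on_product_coordinates]) auto
  from continuous_attains_sup[OF cS Sne cont]
  obtain x where x: "x \<in> ?S" "\<forall>y\<in>?S. quad y \<le> quad x" by (rule bexE)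
  have x0: "0 \<le> x v" for v
    using PiE_mem[OF IntD1[OF x(1)], of v] by (cases "v \<in> V") simp_all
  show ?thesis
  proof (rule that[of x])
    show "0 \<le> x v" for v by fact
    show "?q x = 1" using x(1) by simp
    show "quad y \<le> quad x * ?q y" for y
    proof (cases "?q y = 0")
      case True
      then have "y v = 0" if "v \<in> V" for v
        using that finite_V by (simp add: sum_nonneg_eq_0_iff)
      then show ?thesis using True by (simp add: quad_def)
    next
      case False
      then have pos: "?q y > 0" by (simp add: sum_nonneg order.strict_iff_order)
      have N_V: "u \<in> V" if "u \<in> N v" for u v using that N_subset by blast
      have "quad y \<le> (\<Sum>v\<in>V. \<Sum>u\<in>N v. \<bar>y v\<bar> * \<bar>y u\<bar>)"
        unfolding quad_def by (intro sum_mono) (metis abs_ge_self abs_mult)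
      also have "\<dots> = quad (\<lambda>v. if v \<in> V then \<bar>y v\<bar> / sqrt (?q y) else 0) * ?q y"
        unfolding quad_def sum_distrib_right
        by (intro sum.cong refl) (use pos N_V in \<open>auto simp: sum_nonneg\<close>)
      also have "\<dots> \<le> quad x * ?q y"
        using bspec[OF x(2) norm[OF pos]] pos by (intro mult_right_mono) auto
      finally show ?thesis .
    qed
  qed
qed

lemma perron:
  assumes ne: "V \<noteq> {}"
  obtains \<rho> x where "\<And>v. 0 \<le> x v" "\<exists>v\<in>V. x v > 0"
    "\<And>v. v \<in> V \<Longrightarrow> (\<Sum>u\<in>N v. x u) = \<rho> * x v"
    "\<And>y. quad y \<le> \<rho> * (\<Sum>v\<in>V. (y v)\<^sup>2)"
proof -
  obtain x where x: "\<And>v. 0 \<le> x v" "(\<Sum>v\<in>V. (x v)\<^sup>2) = 1"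
    "\<And>y. quad y \<le> quad x * (\<Sum>v\<in>V. (y v)\<^sup>2)"
    by (rule rayleigh_max_attained[OF ne]) (rule that)
  have "\<exists>v\<in>V. x v > 0"
  proof (rule ccontr)
    assume "\<not> ?thesis"
    then have "x v = 0" if "v \<in> V" for v using that x(1)[of v] by force
    then show False using x(2) by simp
  qed
  moreover have "(\<Sum>u\<in>N v. x u) = quad x * x v" if "v \<in> V" for v
    using rayleigh_equality[OF x(3)] x(2) that by simp
  ultimately show ?thesis by (rule that[of x "quad x", OF x(1) _ _ x(3)])
qed

end

section \<open>Perron vectors for the adjacency spectral radius\<close>

lemma simple_graph_of_pair_graph:
  assumes "pair_graph G"
  shows "simple_graph (pverts G) (\<lambda>v. {u. (v, u) \<in> parcs G})"
proof -
  interpret pair_graph G by fact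
  show ?thesis
  proof
    show "v \<in> {u. (u', u) \<in> parcs G} \<Longrightarrow> u' \<in> {u. (v, u) \<in> parcs G}" for v u'
      using pair_sym_arcs by (auto simp: symmetric_def sym_def)
    show "v \<notin> {u. (v, u) \<in> parcs G}" for v using no_loops'[of v v] by blast
  qed (use pair_finite_verts wellformed' in auto)
qed

text \<open>The spectral radius is the maximal Rayleigh quotient: the moduli of the entries of a
  complex eigenvector are a test vector whose quotient is at least the modulus of the eigenvalue,
  and conversely the maximiser is a real eigenvector.\<close>

lemma spectral_radius_perron:
  fixes G :: "'a pair_pre_digraph"
  defines "N \<equiv> \<lambda>v. {u. (v, u) \<in> parcs G}"
  assumes G: "pair_graph G" and ne: "pverts G \<noteq> {}"
  obtains x where "\<And>v. 0 \<le> x v" "\<exists>v\<in>pverts G. x v > 0"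
    "\<And>v. v \<in> pverts G \<Longrightarrow> (\<Sum>u\<in>N v. x u) = adjacency_spectral_radius G * x v"
    "\<And>y. simple_graph.quad (pverts G) N y \<le> adjacency_spectral_radius G * (\<Sum>v\<in>pverts G. (y v)\<^sup>2)"
proof -
  let ?V = "pverts G"
  interpret simple_graph ?V N
    unfolding N_def by (rule simple_graph_of_pair_graph[OF G])
  obtain \<rho> x where x: "\<And>v. 0 \<le> x v" "\<exists>v\<in>?V. x v > 0"
    "\<And>v. v \<in> ?V \<Longrightarrow> (\<Sum>u\<in>N v. x u) = \<rho> * x v"
    "\<And>y. quad y \<le> \<rho> * (\<Sum>v\<in>?V. (y v)\<^sup>2)"
    by (rule perron[OF ne]) (rule that)
  obtain vs where vs: "distinct vs" "set vs = ?V"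
    using finite_distinct_list[OF finite_V] by blast
  let ?n = "length vs" and ?A = "adjacency_matrix vs G"
  have A: "?A \<in> carrier_mat ?n ?n" by (simp add: adjacency_matrix_def)
  have n0: "0 < ?n" using vs ne by auto
  have reindex: "(\<Sum>j<?n. f (vs ! j)) = (\<Sum>v\<in>?V. f v)" for f :: "'a \<Rightarrow> 'b::comm_monoid_add"
    using vs sum.reindex_bij_betw[OF bij_betw_nth[OF vs(1) refl refl]] by force
  have mult: "(?A *\<^sub>v w) $ i = (\<Sum>u\<in>N (vs ! i). f u)"
    if "w \<in> carrier_vec ?n" "i < ?n" "\<And>j. j < ?n \<Longrightarrow> w $ j = f (vs ! j)" for w i f
  proof -
    have "(?A *\<^sub>v w) $ i = (\<Sum>j<?n. (if vs ! j \<in> N (vs ! i) then f (vs ! j) else 0))"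
      using that by (auto simp: adjacency_matrix_def scalar_prod_def lessThan_atLeast0 N_def
          intro!: sum.cong)
    also have "\<dots> = (\<Sum>u\<in>?V. (if u \<in> N (vs ! i) then f u else 0))" by (rule reindex)
    also have "\<dots> = (\<Sum>u\<in>N (vs ! i). f u)"
      using N_subset[of "vs ! i"] by (simp add: sum.inter_restrict[OF finite_V, symmetric] Int_absorb1)
    finally show ?thesis .
  qed
  have rho0: "0 \<le> \<rho>"
  proof -
    obtain v where v: "v \<in> ?V" "x v > 0" using x(2) by blast
    have "0 \<le> \<rho> * x v" using x(3)[OF v(1)] x(1) by (metis sum_nonneg)
    then show ?thesis using v by (simp add: zero_le_mult_iff)
  qed
  have "adjacency_spectral_radius G = \<rho>"
  proof (rule antisym)
    obtain c where c: "eigenvalue ?A c" "adjacency_spectral_radius G = norm c"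
      using spectral_radius_mem_max(1)[OF A n0] adjacency_spectral_radius_eq[OF vs]
      by (auto simp: spectrum_def)
    obtain w where w: "w \<in> carrier_vec ?n" "w \<noteq> 0\<^sub>v ?n" "?A *\<^sub>v w = c \<cdot>\<^sub>v w"
      using c(1) A by (auto simp: eigenvalue_def eigenvector_def)
    define f where "f v = w $ (THE j. j < ?n \<and> vs ! j = v)" for v
    have f: "w $ j = f (vs ! j)" if "j < ?n" for j
    proof -
      have "(THE i. i < ?n \<and> vs ! i = vs ! j) = j"
        using that vs(1) by (intro the_equality) (auto simp: nth_eq_iff_index_eq)
      then show ?thesis by (simp add: f_def)
    qed
    have eig: "(\<Sum>u\<in>N v. f u) = c * f v" if v: "v \<in> ?V" for v
    proof -
      obtain i where i: "i < ?n" "vs ! i = v" using v vs(2) by (metis in_set_conv_nth)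
      show ?thesis using mult[OF w(1) i(1), of f] f i w by simp
    qed
    have "\<exists>v\<in>?V. f v \<noteq> 0"
    proof (rule ccontr)
      assume "\<not> ?thesis"
      then have "w $ j = 0" if "j < ?n" for j using f[OF that] vs(2) that by auto
      then have "w = 0\<^sub>v ?n" using w(1) by (intro eq_vecI) auto
      then show False using w(2) by blast
    qed
    then have pos: "(\<Sum>v\<in>?V. (norm (f v))\<^sup>2) > 0"
      using finite_V by (auto intro!: sum_pos2)
    have "norm c * (\<Sum>v\<in>?V. (norm (f v))\<^sup>2) = (\<Sum>v\<in>?V. norm (f v) * norm (\<Sum>u\<in>N v. f u))"
      by (simp add: sum_distrib_left eig norm_mult power2_eq_square mult_ac)
    also have "\<dots> \<le> (\<Sum>v\<in>?V. norm (f v) * (\<Sum>u\<in>N v. norm (f u)))"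
      by (intro sum_mono mult_left_mono norm_sum) auto
    also have "\<dots> = quad (\<lambda>v. norm (f v))" by (simp add: quad_def sum_distrib_left)
    also have "\<dots> \<le> \<rho> * (\<Sum>v\<in>?V. (norm (f v))\<^sup>2)" by (rule x(4))
    finally show "adjacency_spectral_radius G \<le> \<rho>" using pos c(2) by simp
  next
    let ?w = "vec ?n (\<lambda>i. complex_of_real (x (vs ! i)))"
    have "eigenvalue ?A (complex_of_real \<rho>)"
      unfolding eigenvalue_def eigenvector_def
    proof (intro exI[of _ ?w] conjI)
      show "?w \<in> carrier_vec (dim_row ?A)" using A by auto
      obtain v where v: "v \<in> ?V" "x v > 0" using x(2) by blast
      then obtain i where i: "i < ?n" "vs ! i = v" using vs(2) by (metis in_set_conv_nth)
      have "?w $ i \<noteq> 0" using i v by simp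
      then show "?w \<noteq> 0\<^sub>v (dim_row ?A)" using i A by (metis carrier_matD(1) index_zero_vec(1))
      show "?A *\<^sub>v ?w = complex_of_real \<rho> \<cdot>\<^sub>v ?w"
      proof (rule eq_vecI)
        fix i assume "i < dim_vec (complex_of_real \<rho> \<cdot>\<^sub>v ?w)"
        then have i: "i < ?n" by simp
        have "(?A *\<^sub>v ?w) $ i = (\<Sum>u\<in>N (vs ! i). complex_of_real (x u))"
          by (rule mult) (use i in auto)
        also have "\<dots> = complex_of_real (\<rho> * x (vs ! i))"
          using x(3)[of "vs ! i"] i vs(2) by (metis nth_mem of_real_sum)
        finally show "(?A *\<^sub>v ?w) $ i = (complex_of_real \<rho> \<cdot>\<^sub>v ?w) $ i" using i by simp
      qed (use A in simp)
    qed
    then have "norm (complex_of_real \<rho>) \<in> norm ` spectrum ?A"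
      unfolding spectrum_def by (intro imageI CollectI)
    then have "norm (complex_of_real \<rho>) \<le> adjacency_spectral_radius G"
      using spectral_radius_mem_max(2)[OF A n0] adjacency_spectral_radius_eq[OF vs] by simp
    then show "\<rho> \<le> adjacency_spectral_radius G" using rho0 by simp
  qed
  note eq = this
  show ?thesis by (rule that[of x, OF x(1,2) x(3)[folded eq] x(4)[folded eq]])
qed

section \<open>Four-cycles through a common vertex\<close>

context simple_graph
begin

text \<open>
  \<open>packing v m S\<close>: there are \<open>m\<close> four-cycles \<open>v, a, b, c\<close> that pairwise meet only in \<open>v\<close>, and
  \<open>S\<close> is the set of their vertices other than \<open>v\<close>.
\<close>

inductive packing :: "'a \<Rightarrow> nat \<Rightarrow> 'a set \<Rightarrow> bool" for v where
  packing_0: "packing v 0 {}"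
| packing_Suc: "\<lbrakk>packing v m S; a \<in> N v; c \<in> N v; a \<noteq> c; b \<in> N a; b \<in> N c; b \<noteq> v; {a, b, c} \<inter> S = {}\<rbrakk>
    \<Longrightarrow> packing v (Suc m) ({a, b, c} \<union> S)"

lemma packing_props:
  assumes "packing v m S"
  shows "finite S" "card S \<le> 3 * m" "S \<subseteq> V" "v \<notin> S"
proof -
  have "finite S \<and> card S \<le> 3 * m \<and> S \<subseteq> V \<and> v \<notin> S"
    using assms
  proof induction
    case (packing_Suc m S a c b)
    have "card ({a, b, c} \<union> S) \<le> card {a, b, c} + card S" by (rule card_Un_le)
    also have "card {a, b, c} \<le> 3" by (simp add: card_insert_if)
    finally show ?case using packing_Suc N_subset N_irrefl by auto
  qed simp
  then show "finite S" "card S \<le> 3 * m" "S \<subseteq> V" "v \<notin> S" by auto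
qed

text \<open>Each \<open>w\<close> in \<open>Q\<close> becomes the vertex opposite to
  \<open>v\<close> in a new cycle, completed by two common neighbours of \<open>v\<close> and
  \<open>w\<close>. Only \<open>S\<close> and the rest of \<open>Q\<close> have to be avoided;
  sparing the rest of \<open>Q\<close> keeps its vertices available for the later cycles.\<close>

lemma packing_greedy:
  assumes "finite Q" "packing v m S" "Q \<inter> S = {}" "v \<notin> Q"
    "\<And>w. w \<in> Q \<Longrightarrow> 3 * (m + card Q) \<le> card (N v \<inter> N w)"
  shows "\<exists>S'. packing v (m + card Q) S'"
  using assms
proof (induction Q arbitrary: m S rule: finite_induct)
  case empty
  then show ?case by auto
next
  case (insert w Q)
  note S = packing_props[OF insert.prems(1)]
  let ?X = "N v \<inter> N w - (S \<union> Q)"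
  have "card (S \<union> Q) \<le> 3 * m + card Q"
    using card_Un_le[of S Q] S(2) by linarith
  moreover have "3 * (m + card Q + 1) \<le> card (N v \<inter> N w)"
    using insert.prems(4)[of w] insert.hyps by simp
  moreover have "card (N v \<inter> N w) - card (S \<union> Q) \<le> card ?X"
    by (rule diff_card_le_card_Diff) (use S insert.hyps in auto)
  ultimately have "\<not> card ?X \<le> Suc 0" by arith
  then obtain a c where ac: "a \<in> ?X" "c \<in> ?X" "a \<noteq> c"
    by (subst (asm) card_le_Suc0_iff_eq) auto
  have w: "w \<notin> S" "w \<noteq> v" using insert.prems by auto
  have "packing v (Suc m) ({a, w, c} \<union> S)"
    using ac w insert.prems(1) N_sym by (intro packing_Suc) auto
  moreover have "Q \<inter> ({a, w, c} \<union> S) = {}" using ac insert.hyps insert.prems by auto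
  moreover have "3 * (Suc m + card Q) \<le> card (N v \<inter> N w')" if "w' \<in> Q" for w'
    using insert.prems(4)[of w'] insert.hyps that by simp
  ultimately have "\<exists>S'. packing v (Suc m + card Q) S'"
    using insert.IH insert.prems(3) by blast
  then show ?case using insert.hyps by simp
qed

text \<open>The pairs \<open>(i, j)\<close> are the vertex names of \<open>CP_graph\<close>:
  position \<open>2\<close> is opposite to \<open>v\<close>, positions \<open>1\<close> and
  \<open>3\<close> are adjacent to \<open>v\<close>.\<close>

lemma packing_extract:
  assumes "packing v m S"
  shows "\<exists>f :: nat \<times> nat \<Rightarrow> 'a. inj_on f ({..<m} \<times> {1, 2, 3}) \<and> f ` ({..<m} \<times> {1, 2, 3}) \<subseteq> S
    \<and> (\<forall>i<m. f (i, 1) \<in> N v \<and> f (i, 3) \<in> N v \<and> f (i, 2) \<in> N (f (i, 1)) \<and> f (i, 3) \<in> N (f (i, 2)))"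
  using assms
proof induction
  case packing_0
  then show ?case by simp
next
  case (packing_Suc m S a c b)
  from packing_Suc.IH obtain f :: "nat \<times> nat \<Rightarrow> 'a" where f: "inj_on f ({..<m} \<times> {1, 2, 3})" "f ` ({..<m} \<times> {1, 2, 3}) \<subseteq> S"
    "\<forall>i<m. f (i, 1) \<in> N v \<and> f (i, 3) \<in> N v \<and> f (i, 2) \<in> N (f (i, 1)) \<and> f (i, 3) \<in> N (f (i, 2))"
    by (elim exE conjE) (rule that)
  define g where "g = (\<lambda>(i, j). if i < m then f (i, j) else if j = (1::nat) then a else if j = 2 then b else c)"
  have dist: "a \<noteq> b" "b \<noteq> c" "a \<noteq> c" using packing_Suc N_irrefl by auto
  have fS: "f (i, j) \<in> S" if "i < m" "j \<in> {1, 2, 3}" for i j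
    using f(2) that by auto
  have notS: "a \<notin> S" "b \<notin> S" "c \<notin> S" using packing_Suc by auto
  have "inj_on g ({..<Suc m} \<times> {1, 2, 3})"
  proof (rule inj_onI)
    fix p q assume pq: "p \<in> {..<Suc m} \<times> {1, 2, 3}" "q \<in> {..<Suc m} \<times> {1, 2, 3}" "g p = g q"
    obtain i j i' j' where p: "p = (i, j)" "q = (i', j')" by (cases p, cases q)
    note h = pq(1,2)[unfolded p] and eq = pq(3)[unfolded p]
    consider "i < m" "i' < m" | "i < m" "i' = m" | "i = m" "i' < m" | "i = m" "i' = m"
      using h by fastforce
    then have "i = i' \<and> j = j'"
    proof cases
      case 1
      then show ?thesis using eq h inj_onD[OF f(1), of "(i, j)" "(i', j')"] by (auto simp: g_def)
    next
      case 2
      then show ?thesis using eq h fS[of i j] notS by (auto simp: g_def split: if_splits)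
    next
      case 3
      then show ?thesis using eq h fS[of i' j'] notS by (auto simp: g_def split: if_splits)
    next
      case 4
      then show ?thesis using eq h dist by (auto simp: g_def split: if_splits)
    qed
    then show "p = q" using p by simp
  qed
  moreover have "g ` ({..<Suc m} \<times> {1, 2, 3}) \<subseteq> {a, b, c} \<union> S"
    using fS by (auto simp: g_def)
  moreover have "\<forall>i<Suc m. g (i, 1) \<in> N v \<and> g (i, 3) \<in> N v \<and> g (i, 2) \<in> N (g (i, 1)) \<and> g (i, 3) \<in> N (g (i, 2))"
    using f(3) packing_Suc.hyps N_sym by (auto simp: g_def less_Suc_eq)
  ultimately show ?case by (intro exI[of _ g] conjI)
qed

text \<open>\<open>S\<close> comes from a family that cannot be extended: two common neighbours of
  \<open>v\<close> and \<open>b\<close> outside \<open>S\<close> would form one more cycle with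
  them.\<close>

lemma hitting_set:
  assumes no: "\<And>S. \<not> packing v t S"
  obtains S where "finite S" "S \<subseteq> V" "card S \<le> 3 * t" "v \<notin> S"
    "\<And>b. b \<notin> S \<Longrightarrow> b \<noteq> v \<Longrightarrow> card (N b \<inter> N v - S) \<le> 1"
proof -
  have "\<exists>m<t. \<exists>S. packing v m S \<and> (\<forall>S'. \<not> packing v (Suc m) S')"
  proof (rule ccontr)
    assume *: "\<not> ?thesis"
    have "\<exists>S. packing v m S" if "m \<le> t" for m
      using that
    proof (induction m)
      case 0
      show ?case using packing_0 by (rule exI)
    next
      case (Suc m)
      then show ?case using * by (meson Suc_le_lessD less_imp_le)
    qed
    then show False using no by blast
  qed
  then obtain m S where m: "m < t" "packing v m S" "\<And>S'. \<not> packing v (Suc m) S'" by blast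
  note S = packing_props[OF m(2)]
  have "card (N b \<inter> N v - S) \<le> 1" if b: "b \<notin> S" "b \<noteq> v" for b
  proof (rule ccontr)
    assume "\<not> ?thesis"
    then obtain a c where ac: "a \<in> N b \<inter> N v - S" "c \<in> N b \<inter> N v - S" "a \<noteq> c"
      by (auto simp: card_le_Suc0_iff_eq)
    have "packing v (Suc m) ({a, b, c} \<union> S)"
      using ac b m(2) N_sym by (intro packing_Suc) auto
    then show False using m(3) by blast
  qed
  then show ?thesis using that[of S] S m(1) by simp
qed

text \<open>\<open>t\<close> such vertices could serve as the opposite vertices of \<open>t\<close>
  greedily chosen cycles.\<close>

lemma card_high_codegree:
  assumes no: "\<And>S. \<not> packing v t S"
  shows "card {w \<in> V - {v}. 3 * t \<le> card (N v \<inter> N w)} < t"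
proof (rule ccontr)
  let ?B = "{w \<in> V - {v}. 3 * t \<le> card (N v \<inter> N w)}"
  assume "\<not> ?thesis"
  then have "t \<le> card ?B" by simp
  then obtain Q where Q: "Q \<subseteq> ?B" "card Q = t" "finite Q"
    by (rule obtain_subset_with_card_n)
  have "\<exists>S'. packing v (0 + card Q) S'"
    by (rule packing_greedy[OF Q(3) packing_0]) (use Q in auto)
  then show False using no Q by simp
qed

text \<open>Two common neighbours outside \<open>Q\<close> give a first cycle through
  \<open>v\<close> and \<open>b\<close>, and the \<open>t - 1\<close> vertices of \<open>Q\<close>
  then supply the remaining ones greedily. With \<open>t = 1\<close> and \<open>Q\<close> empty this
  is the absence of four-cycles.\<close>

lemma core_codegree:
  assumes no: "\<And>S. \<not> packing v t S"
    and Q: "finite Q" "t = Suc (card Q)" "v \<notin> Q" "\<And>w. w \<in> Q \<Longrightarrow> 3 * t \<le> card (N v \<inter> N w)"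
    and b: "b \<notin> Q" "b \<noteq> v"
  shows "card (N b \<inter> N v - Q) \<le> 1"
proof (rule ccontr)
  assume "\<not> ?thesis"
  then obtain a c where ac: "a \<in> N b \<inter> N v - Q" "c \<in> N b \<inter> N v - Q" "a \<noteq> c"
    by (auto simp: card_le_Suc0_iff_eq)
  have "packing v (Suc 0) ({a, b, c} \<union> {})"
    using ac b packing_0 N_sym by (intro packing_Suc) auto
  then have "\<exists>S'. packing v (Suc 0 + card Q) S'"
    by (rule packing_greedy[OF Q(1)]) (use Q ac b in auto)
  then show False using no Q by simp
qed

section \<open>Counting two-walks from a vertex\<close>

lemma two_walks_swap:
  fixes y :: "'a \<Rightarrow> real"
  assumes "X \<subseteq> V"
  shows "(\<Sum>u\<in>N v \<inter> X - S. \<Sum>w\<in>N u \<inter> X. y w) = (\<Sum>w\<in>X. card (N w \<inter> N v \<inter> X - S) * y w)"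
proof -
  have "(\<Sum>u\<in>N v \<inter> X - S. \<Sum>w\<in>N u \<inter> X. y w) = (\<Sum>w\<in>X. \<Sum>u\<in>N w \<inter> (N v \<inter> X - S). y w)"
    by (rule sum_N_swap) (use assms in auto)
  also have "\<dots> = (\<Sum>w\<in>X. card (N w \<inter> N v \<inter> X - S) * y w)"
    by (simp add: Int_Diff Int_assoc)
  finally show ?thesis .
qed

lemma two_walks_split:
  fixes y :: "'a \<Rightarrow> real"
  assumes "X \<subseteq> V"
  shows "(\<Sum>u\<in>N v \<inter> X. \<Sum>w\<in>N u \<inter> X. y w) = (\<Sum>u\<in>N v \<inter> X \<inter> S. \<Sum>w\<in>N u \<inter> X. y w)
    + (\<Sum>w\<in>X. card (N w \<inter> N v \<inter> X - S) * y w)"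
  using sum.Int_Diff[of "N v \<inter> X" "\<lambda>u. \<Sum>w\<in>N u \<inter> X. y w" S] two_walks_swap[OF assms, where v = v and S = S and y = y]
  by simp

text \<open>Walks whose middle vertex lies in \<open>S\<close> are kept as a separate sum. The
  others are sorted by their end \<open>w\<close>, which is reached
  \<open>card (N w \<inter> N v - S)\<close> times: the cases are \<open>v\<close> itself, the few
  vertices of \<open>B\<close>, vertices of \<open>S\<close> with fewer than \<open>3 * t\<close>
  common neighbours, and the remaining vertices, each reached at most once.\<close>

lemma two_walks_bound:
  fixes y :: "'a \<Rightarrow> real" and t :: nat
  assumes y: "\<And>w. 0 \<le> y w" and v: "v \<in> V"
    and S: "finite S" "S \<subseteq> V" "v \<notin> S" "\<And>b. b \<notin> S \<Longrightarrow> b \<noteq> v \<Longrightarrow> card (N b \<inter> N v - S) \<le> 1"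
  defines "B \<equiv> {w \<in> V - {v}. 3 * t \<le> card (N v \<inter> N w)}"
  shows "(\<Sum>u\<in>N v. \<Sum>w\<in>N u. y w) \<le> card (N v) * y v + (\<Sum>u\<in>N v \<inter> S. \<Sum>w\<in>N u. y w)
    + (\<Sum>w\<in>B. card (N v \<inter> N w) * y w) + 3 * t * (\<Sum>w\<in>S. y w) + (\<Sum>w\<in>V. y w)"
proof -
  have NV: "N u \<inter> V = N u" "N u \<inter> N w \<inter> V = N u \<inter> N w" for u w
    using N_subset by blast+
  have "card (N w \<inter> N v - S) * y w \<le> (if w = v then card (N v) * y v else 0)
      + (if w \<in> B then card (N v \<inter> N w) * y w else 0) + (if w \<in> S then 3 * t * y w else 0) + y w"
    (is "_ \<le> ?f w + ?g w + ?h w + y w") if w: "w \<in> V" for w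
  proof -
    have nn: "0 \<le> ?f w" "0 \<le> ?g w" "0 \<le> ?h w" "0 \<le> y w" using y by auto
    have le: "card (N w \<inter> N v - S) \<le> card (N v \<inter> N w)"
      by (intro card_mono) auto
    consider "w = v" | "w \<in> B" | "w \<noteq> v" "w \<notin> B" "w \<in> S" | "w \<noteq> v" "w \<notin> S" by blast
    then show ?thesis
    proof cases
      case 1
      have "card (N w \<inter> N v - S) * y w \<le> ?f w"
        using 1 y by (auto intro!: mult_right_mono card_mono)
      then show ?thesis using nn by linarith
    next
      case 2
      have "card (N w \<inter> N v - S) * y w \<le> ?g w"
        using 2 y le by (auto intro!: mult_right_mono)
      then show ?thesis using nn by linarith
    next
      case 3
      have "card (N v \<inter> N w) < 3 * t" using 3 w by (auto simp: B_def)
      then have "real (card (N w \<inter> N v - S)) \<le> 3 * t" using le by linarith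
      then have "card (N w \<inter> N v - S) * y w \<le> ?h w"
        using 3 y by (auto intro!: mult_right_mono)
      then show ?thesis using nn by linarith
    next
      case 4
      have "card (N w \<inter> N v - S) * y w \<le> 1 * y w"
        using S(4)[of w] 4 y[of w] by (intro mult_right_mono) auto
      then show ?thesis using nn by linarith
    qed
  qed
  then have "(\<Sum>w\<in>V. card (N w \<inter> N v - S) * y w) \<le> (\<Sum>w\<in>V. ?f w + ?g w + ?h w + y w)"
    by (rule sum_mono)
  also have "\<dots> = (\<Sum>w\<in>V. ?f w) + (\<Sum>w\<in>V. ?g w) + (\<Sum>w\<in>V. ?h w) + (\<Sum>w\<in>V. y w)"
    by (simp add: sum.distrib)
  also have "(\<Sum>w\<in>V. ?f w) = card (N v) * y v" using v finite_V by simp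
  also have "(\<Sum>w\<in>V. ?g w) = (\<Sum>w\<in>B. card (N v \<inter> N w) * y w)"
    by (subst sum.inter_restrict[OF finite_V, symmetric]) (auto simp: B_def intro!: sum.cong)
  also have "(\<Sum>w\<in>V. ?h w) = 3 * t * (\<Sum>w\<in>S. y w)"
    by (subst sum.inter_restrict[OF finite_V, symmetric])
      (use S(2) in \<open>auto simp: sum_distrib_left Int_absorb1\<close>)
  finally show ?thesis
    using two_walks_split[where X = V and v = v and S = S and y = y] by (simp add: NV algebra_simps)
qed

text \<open>At most \<open>3 * t * card X\<close> walks pass through \<open>S\<close>. Of the
  others, at most \<open>card X\<close> end at each of the \<open>3 * t + 1\<close> possible
  exceptions in \<open>insert v S\<close>, and at most one at any other vertex;
  \<open>6 * t + 2 \<le> 8 * t\<close> gives the constant. The set \<open>X\<close> makes the bound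
  available inside \<open>far\<close>.\<close>

lemma two_walks_card_bound:
  assumes no: "\<And>S. \<not> packing v t S" and t: "t > 0" and X: "X \<subseteq> V"
  shows "(\<Sum>u\<in>N v \<inter> X. card (N u \<inter> X)) \<le> 8 * t * card X"
proof -
  obtain S where S: "finite S" "S \<subseteq> V" "card S \<le> 3 * t" "v \<notin> S"
    "\<And>b. b \<notin> S \<Longrightarrow> b \<noteq> v \<Longrightarrow> card (N b \<inter> N v - S) \<le> 1"
    by (rule hitting_set[OF no]) (rule that)
  have fX: "finite X" using X finite_V finite_subset by blast
  let ?x = "card X"
  have cX: "card (A \<inter> X) \<le> ?x" for A by (intro card_mono fX) auto
  have 1: "(\<Sum>u\<in>N v \<inter> X \<inter> S. card (N u \<inter> X)) \<le> 3 * t * ?x"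
  proof -
    have "(\<Sum>u\<in>N v \<inter> X \<inter> S. card (N u \<inter> X)) \<le> card (N v \<inter> X \<inter> S) * ?x"
      using sum_bounded_above[of "N v \<inter> X \<inter> S" "\<lambda>u. card (N u \<inter> X)" ?x] cX by simp
    also have "\<dots> \<le> card S * ?x" by (intro mult_right_mono card_mono S) auto
    also have "\<dots> \<le> 3 * t * ?x" by (intro mult_right_mono S) auto
    finally show ?thesis .
  qed
  have 2: "(\<Sum>w\<in>X. card (N w \<inter> N v \<inter> X - S)) \<le> (3 * t + 2) * ?x"
  proof -
    have "(\<Sum>w\<in>X. card (N w \<inter> N v \<inter> X - S)) \<le> (\<Sum>w\<in>X. (if w \<in> insert v S then ?x else 0) + 1)"
    proof (rule sum_mono)
      fix w
      have "card (N w \<inter> N v \<inter> X - S) \<le> ?x" by (intro card_mono fX) auto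
      moreover have "card (N w \<inter> N v \<inter> X - S) \<le> card (N w \<inter> N v - S)" by (intro card_mono) auto
      ultimately show "card (N w \<inter> N v \<inter> X - S) \<le> (if w \<in> insert v S then ?x else 0) + 1"
        using S(5)[of w] by (cases "w = v"; cases "w \<in> S") auto
    qed
    also have "\<dots> = card (X \<inter> insert v S) * ?x + ?x"
      by (simp only: sum.distrib sum.inter_restrict[OF fX, symmetric]) simp
    also have "card (X \<inter> insert v S) \<le> card (insert v S)" by (intro card_mono) (use S in auto)
    also have "\<dots> \<le> 3 * t + 1" using S by (simp add: card_insert_if)
    finally show ?thesis by (simp add: algebra_simps)
  qed
  have "real (\<Sum>u\<in>N v \<inter> X. card (N u \<inter> X)) = real (\<Sum>u\<in>N v \<inter> X \<inter> S. card (N u \<inter> X))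
      + real (\<Sum>w\<in>X. card (N w \<inter> N v \<inter> X - S))"
    using two_walks_split[OF X, where v = v and S = S and y = "\<lambda>_. 1"] by simp
  then have "(\<Sum>u\<in>N v \<inter> X. card (N u \<inter> X)) \<le> 3 * t * ?x + (3 * t + 2) * ?x"
    using 1 2 by linarith
  also have "\<dots> = (6 * t + 2) * ?x" by (simp add: algebra_simps)
  also have "\<dots> \<le> 8 * t * ?x" using t by (intro mult_right_mono) auto
  finally show ?thesis .
qed

end

section \<open>From packings to subgraphs\<close>

lemma digraph_iso_with_projI:
  assumes wf: "wf_digraph (with_proj G)"
    and f: "inj_on f (pverts G)" "pverts H = f ` pverts G" "parcs H = map_prod f f ` parcs G"
  shows "digraph_iso (with_proj G) (with_proj H)"
proof -
  have sub: "parcs G \<subseteq> pverts G \<times> pverts G"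
    using wf_digraph.wellformed[OF wf] by auto
  have "inj_on (map_prod f f) (parcs G)"
    by (rule inj_on_subset[OF map_prod_inj_on[OF f(1) f(1)] sub])
  then have "pre_digraph.digraph_isomorphism (with_proj G)
      \<lparr>iso_verts = f, iso_arcs = map_prod f f, iso_head = snd, iso_tail = fst\<rparr>"
    using wf f by (simp add: pre_digraph.digraph_isomorphism_def)
  moreover have "with_proj H = app_iso \<lparr>iso_verts = f, iso_arcs = map_prod f f, iso_head = snd, iso_tail = fst\<rparr> (with_proj G)"
    using f by (simp add: app_iso_def with_proj_def)
  ultimately show ?thesis unfolding digraph_iso_def by blast
qed

lemma contains_subgraphI:
  assumes G: "wf_digraph (with_proj G)" and H: "wf_digraph (with_proj H)"
    and f: "inj_on f (pverts H)" "f ` pverts H \<subseteq> pverts G"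
    and arcs: "\<And>u v. (u, v) \<in> parcs H \<Longrightarrow> (f u, f v) \<in> parcs G"
  shows "contains_subgraph G H"
proof -
  have sub: "parcs H \<subseteq> pverts H \<times> pverts H"
    using wf_digraph.wellformed[OF H] by auto
  define H' where "H' = \<lparr>pverts = f ` pverts H, parcs = map_prod f f ` parcs H\<rparr>"
  define g where "g = inv_into (pverts H) f"
  have gf: "g (f u) = u" if "u \<in> pverts H" for u using f(1) that by (simp add: g_def)
  have wf': "wf_digraph (with_proj H')"
    using sub by unfold_locales (auto simp: H'_def)
  have sg: "subgraph (with_proj H') (with_proj G)"
    unfolding subgraph_def using G wf' f(2) arcs by (auto simp: H'_def compatible_def)
  have "digraph_iso (with_proj H') (with_proj H)"
  proof (rule digraph_iso_with_projI[OF wf'])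
    show "inj_on g (pverts H')" unfolding H'_def g_def by (simp add: inj_on_inv_into)
    show "pverts H = g ` pverts H'" using gf by (force simp: H'_def image_image)
    have "(\<lambda>e. map_prod g g (map_prod f f e)) ` parcs H = (\<lambda>e. e) ` parcs H"
      by (rule image_cong) (use sub gf in auto)
    then show "parcs H = map_prod g g ` parcs H'" by (simp add: H'_def image_image)
  qed
  then show ?thesis using sg unfolding contains_subgraph_def by blast
qed

text \<open>Every piece is mapped to one cycle of the packing. A path on four vertices uses the same
  three new vertices as a cycle and omits the closing edge.\<close>

lemma packing_contains_CP_graph:
  fixes G :: "'a pair_pre_digraph"
  assumes G: "pair_graph G" and v: "v \<in> pverts G"
    and pack: "simple_graph.packing (\<lambda>v. {u. (v, u) \<in> parcs G}) v (length cs + length qs) S"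
    and cs: "\<forall>c\<in>set cs. c = 4" and qs: "\<forall>q\<in>set qs. q = 4"
  shows "contains_subgraph G (CP_graph cs qs)"
proof -
  interpret G: pair_graph G by fact
  interpret simple_graph "pverts G" "\<lambda>v. {u. (v, u) \<in> parcs G}"
    by (rule simple_graph_of_pair_graph[OF G])
  let ?ms = "cs @ qs" and ?H = "CP_graph cs qs"
  let ?m = "length cs + length qs"
  have "pair_graph ?H" using cs by (intro pair_graph_CP_graph) auto
  then interpret H: pair_graph ?H .
  have ms: "?ms ! i = 4" if "i < ?m" for i
    using that cs qs nth_mem[of i ?ms] by (auto simp del: nth_mem)
  have csn: "cs ! i = 4" if "i < length cs" for i using that cs by simp
  have SV: "S \<subseteq> pverts G" "v \<notin> S" using packing_props[OF pack] by auto
  obtain f :: "nat \<times> nat \<Rightarrow> 'a" where f: "inj_on f ({..<?m} \<times> {1, 2, 3})" "f ` ({..<?m} \<times> {1, 2, 3}) \<subseteq> S"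
    "\<forall>i<?m. (v, f (i, 1)) \<in> parcs G \<and> (v, f (i, 3)) \<in> parcs G
      \<and> (f (i, 1), f (i, 2)) \<in> parcs G \<and> (f (i, 2), f (i, 3)) \<in> parcs G"
    using packing_extract[OF pack] unfolding mem_Collect_eq by (elim exE conjE) (rule that)
  define g where "g p = (if p = (0, 0) then v else f p)" for p
  have verts: "pverts ?H = insert (0, 0) ({..<?m} \<times> {1, 2, 3})"
  proof -
    have "pverts ?H = insert (0, 0) (\<Union>i<?m. CP_vertex i ` {..<4})"
      using ms by (auto simp: CP_graph_def Let_def)
    moreover have "CP_vertex i ` {..<4} = {(0, 0), (i, 1), (i, 2), (i, 3)}" for i
      by (auto simp: CP_vertex_def numeral_eq_Suc lessThan_Suc)
    ultimately show ?thesis by auto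
  qed
  have sym: "(y, x) \<in> parcs G" if "(x, y) \<in> parcs G" for x y
    using that N_sym by auto
  have g0: "g (CP_vertex i 0) = v" "g (CP_vertex i 1) = f (i, 1)" "g (CP_vertex i 2) = f (i, 2)" "g (CP_vertex i 3) = f (i, 3)" for i
    by (auto simp: g_def CP_vertex_def)
  have step: "(g (CP_vertex i j), g (CP_vertex i (Suc j))) \<in> parcs G" if "i < ?m" "Suc j < 4" for i j
  proof -
    have "j = 0 \<or> j = 1 \<or> j = 2" using that by linarith
    then show ?thesis using g0[of i] f(3) that(1) by (auto simp: numeral_eq_Suc)
  qed
  have gS: "g ` ({..<?m} \<times> {1, 2, 3}) \<subseteq> S" using f(2) by (auto simp: g_def)
  have gv: "g (0, 0) = v" by (simp add: g_def)
  show ?thesis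
  proof (rule contains_subgraphI[of _ _ g])
    show "wf_digraph (with_proj G)" "wf_digraph (with_proj ?H)" by unfold_locales
    show "inj_on g (pverts ?H)"
      unfolding verts
    proof (subst inj_on_insert, intro conjI)
      show "inj_on g ({..<?m} \<times> {1, 2, 3})"
        using f(1) by (subst inj_on_cong[of _ _ f]) (auto simp: g_def)
      show "g (0, 0) \<notin> g ` ({..<?m} \<times> {1, 2, 3} - {(0, 0)})"
        unfolding gv using SV(2) by (rule contra_subsetD[rotated]) (use gS in blast)
    qed
    show "g ` pverts ?H \<subseteq> pverts G"
      unfolding verts image_insert gv using gS SV(1) v by blast
    fix a b assume ab: "(a, b) \<in> parcs ?H"
    define T where "T = {(CP_vertex i j, CP_vertex i (Suc j)) | i j. i < length ?ms \<and> Suc j < ?ms ! i}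
        \<union> {(CP_vertex i (cs ! i - 1), CP_vertex i 0) | i. i < length cs}"
    have T: "(g a, g b) \<in> parcs G" if "(a, b) \<in> T" for a b
    proof -
      from that consider (1) i j where "a = CP_vertex i j" "b = CP_vertex i (Suc j)" "i < ?m" "Suc j < ?ms ! i"
        | (2) i where "a = CP_vertex i (cs ! i - 1)" "b = CP_vertex i 0" "i < length cs"
        unfolding T_def by auto
      then show ?thesis
      proof cases
        case 1
        then show ?thesis using step ms by metis
      next
        case 2
        then have "a = CP_vertex i 3" using csn by simp
        then show ?thesis using 2 g0[of i] f(3) sym by simp
      qed
    qed
    have "parcs ?H = T \<union> T\<inverse>" by (simp add: CP_graph_def Let_def T_def)
    then show "(g a, g b) \<in> parcs G" using ab T sym by blast
  qed
qed

section \<open>Copies of the extremal graph\<close>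

text \<open>Partners must sit at positions \<open>2 * i\<close> and \<open>2 * i + 1\<close>, as in
  \<open>near_matching_graph\<close>. The induction puts one matched pair in front, shifting the
  others by two places; unmatched vertices end up last, in any order.\<close>

lemma matching_enumeration:
  fixes M :: "'a \<Rightarrow> 'a set"
  assumes "finite X"
    and "\<And>u v. u \<in> X \<Longrightarrow> v \<in> M u \<Longrightarrow> v \<in> X \<and> u \<in> M v \<and> u \<noteq> v"
    and "\<And>u v w. u \<in> X \<Longrightarrow> v \<in> M u \<Longrightarrow> w \<in> M u \<Longrightarrow> v = w"
  shows "\<exists>g. bij_betw g {..<card X} X \<and>
    (\<forall>u\<in>X. \<forall>v\<in>M u. \<exists>i. 2 * i + 1 < card X \<and> (u = g (2 * i) \<and> v = g (2 * i + 1) \<or> v = g (2 * i) \<and> u = g (2 * i + 1)))"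
  using assms
proof (induction X rule: finite_psubset_induct)
  case (psubset X)
  note M = psubset.prems
  show ?case
  proof (cases "\<exists>u\<in>X. M u \<noteq> {}")
    case False
    obtain g where "bij_betw g {..<card X} X"
      using ex_bij_betw_nat_finite[OF psubset.hyps] by (auto simp: atLeast0LessThan)
    then show ?thesis using False by (intro exI[of _ g]) auto
  next
    case True
    then obtain u v where uv: "u \<in> X" "v \<in> M u" by blast
    then have v: "v \<in> X" "u \<in> M v" "u \<noteq> v" using M(1)[OF uv] by auto
    let ?Y = "X - {u, v}"
    have Y: "?Y \<subset> X" using uv by blast
    have MY: "b \<in> ?Y" if "a \<in> ?Y" "b \<in> M a" for a b
    proof -
      have b: "b \<in> X" "a \<in> M b" using M(1)[of a b] that by auto
      have "b \<noteq> u" using M(2)[OF uv(1) uv(2), of a] b that by auto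
      moreover have "b \<noteq> v" using M(2)[OF v(1) v(2), of a] b that by auto
      ultimately show ?thesis using b by simp
    qed
    have "\<exists>g. bij_betw g {..<card ?Y} ?Y \<and>
      (\<forall>u\<in>?Y. \<forall>v\<in>M u. \<exists>i. 2 * i + 1 < card ?Y \<and> (u = g (2 * i) \<and> v = g (2 * i + 1) \<or> v = g (2 * i) \<and> u = g (2 * i + 1)))"
    proof (rule psubset.IH[OF Y])
      show "b \<in> ?Y \<and> a \<in> M b \<and> a \<noteq> b" if "a \<in> ?Y" "b \<in> M a" for a b
        using MY[OF that] M(1)[of a b] that by simp
      show "b = c" if "a \<in> ?Y" "b \<in> M a" "c \<in> M a" for a b c
        using M(2)[of a b c] that by simp
    qed
    then obtain g where g: "bij_betw g {..<card ?Y} ?Y"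
      "\<forall>a\<in>?Y. \<forall>b\<in>M a. \<exists>i. 2 * i + 1 < card ?Y \<and> (a = g (2 * i) \<and> b = g (2 * i + 1) \<or> b = g (2 * i) \<and> a = g (2 * i + 1))"
      by (elim exE conjE) (rule that)
    have cX: "card X = card ?Y + 2"
    proof -
      have "card ?Y = card X - card {u, v}" by (rule card_Diff_subset) (use uv v in auto)
      moreover have "card {u, v} \<le> card X" by (rule card_mono) (use psubset.hyps uv v in auto)
      ultimately show ?thesis using v(3) by simp
    qed
    define h where "h i = (if i = 0 then u else if i = 1 then v else g (i - 2))" for i :: nat
    have h: "h 0 = u" "h 1 = v" "h (Suc (Suc i)) = g i" for i by (simp_all add: h_def)
    have "{..<card X} = insert 0 (insert 1 ((\<lambda>i. Suc (Suc i)) ` {..<card ?Y}))"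
      unfolding cX by (simp add: numeral_2_eq_2 lessThan_Suc_eq_insert_0 image_image)
    then have "h ` {..<card X} = insert u (insert v (g ` {..<card ?Y}))"
      using h by (simp add: image_image)
    also have "\<dots> = X" using g(1) uv v by (auto simp: bij_betw_def)
    finally have img: "h ` {..<card X} = X" .
    moreover have "inj_on h {..<card X}" by (rule eq_card_imp_inj_on) (simp_all add: img)
    ultimately have bij: "bij_betw h {..<card X} X" by (simp add: bij_betw_def)
    have "\<exists>i. 2 * i + 1 < card X \<and> (a = h (2 * i) \<and> b = h (2 * i + 1) \<or> b = h (2 * i) \<and> a = h (2 * i + 1))"
      if ab: "a \<in> X" "b \<in> M a" for a b
    proof (cases "a \<in> ?Y")
      case True
      from bspec[OF bspec[OF g(2) True] ab(2)] obtain i where "2 * i + 1 < card ?Y"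
        "a = g (2 * i) \<and> b = g (2 * i + 1) \<or> b = g (2 * i) \<and> a = g (2 * i + 1)"
        by (elim exE conjE) (rule that)
      then show ?thesis using cX by (intro exI[of _ "Suc i"]) (simp add: h_def)
    next
      case False
      then have "a = u \<and> b = v \<or> a = v \<and> b = u"
        using ab M(2)[OF uv(1) uv(2), of b] M(2)[OF v(1) v(2), of b] by auto
      then show ?thesis using cX h by (intro exI[of _ 0]) auto
    qed
    then show ?thesis using bij by (intro exI[of _ h] conjI ballI)
  qed
qed

lemma F_graph_arcs:
  "(Inl i, Inl j) \<in> parcs (F_graph n t) \<longleftrightarrow> i < t \<and> j < t \<and> i \<noteq> j"
  "(Inl i, Inr j) \<in> parcs (F_graph n t) \<longleftrightarrow> i < t \<and> j < n - t"
  "(Inr j, Inl i) \<in> parcs (F_graph n t) \<longleftrightarrow> i < t \<and> j < n - t"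
  "(Inr i, Inr j) \<in> parcs (F_graph n t) \<longleftrightarrow>
     (\<exists>k. 2 * k + 1 < n - t \<and> (i = 2 * k \<and> j = 2 * k + 1 \<or> j = 2 * k \<and> i = 2 * k + 1))"
  by (auto simp: F_graph_def graph_join_def complete_graph_def near_matching_graph_def Let_def)

lemma F_graph_verts: "pverts (F_graph n t) = Inl ` {..<t} \<union> Inr ` {..<n - t}"
  by (auto simp: F_graph_def graph_join_def complete_graph_def near_matching_graph_def Let_def)

text \<open>An isomorphic image of \<open>F_graph n t\<close> on the vertex set \<open>V\<close>
  itself, so that its quadratic form can be evaluated at a vector belonging to another graph on
  \<open>V\<close>.\<close>

locale F_copy = simple_graph V N for V :: "'a set" and N +
  fixes n t :: nat and f :: "nat + nat \<Rightarrow> 'a"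
  assumes bij: "bij_betw f (pverts (F_graph n t)) V"
    and arcs: "u \<in> N v \<longleftrightarrow> (v, u) \<in> map_prod f f ` parcs (F_graph n t)"
begin

lemma arcs_eq: "Sigma V N = map_prod f f ` parcs (F_graph n t)"
proof -
  have inV: "v \<in> V" if "u \<in> N v" for u v using that N_sym N_subset by blast
  show ?thesis
  proof (rule Set.set_eqI)
    fix e :: "'a \<times> 'a"
    obtain v u where e: "e = (v, u)" by (cases e)
    show "e \<in> Sigma V N \<longleftrightarrow> e \<in> map_prod f f ` parcs (F_graph n t)"
      unfolding e mem_Sigma_iff arcs[symmetric] using inV by blast
  qed
qed

lemma rayleigh_F:
  assumes "V \<noteq> {}"
  shows "quad y \<le> adjacency_spectral_radius (F_graph n t) * (\<Sum>v\<in>V. (y v)\<^sup>2)"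
proof -
  let ?F = "F_graph n t" and ?NF = "\<lambda>v. {u. (v, u) \<in> parcs (F_graph n t)}"
  have F: "pair_graph ?F" by (rule pair_graph_F_graph)
  interpret F: simple_graph "pverts ?F" ?NF by (rule simple_graph_of_pair_graph[OF F])
  have ne: "pverts ?F \<noteq> {}" using bij assms by (auto simp: bij_betw_def)
  interpret PF: pair_graph ?F by (rule F)
  have sub: "parcs ?F \<subseteq> pverts ?F \<times> pverts ?F"
    using PF.wellformed' by auto
  have inj: "inj_on (map_prod f f) (parcs ?F)"
    by (rule inj_on_subset[OF map_prod_inj_on sub]) (use bij in \<open>auto simp: bij_betw_def\<close>)
  have SF: "Sigma (pverts ?F) ?NF = parcs ?F" using sub by auto
  have "quad y = (\<Sum>(v, u)\<in>Sigma V N. y v * y u)"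
    unfolding quad_def by (rule sum.Sigma) (auto simp: finite_V)
  also have "\<dots> = (\<Sum>(a, b)\<in>parcs ?F. y (f a) * y (f b))"
    unfolding arcs_eq by (subst sum.reindex[OF inj]) (auto intro!: sum.cong)
  also have "\<dots> = F.quad (\<lambda>a. y (f a))"
    unfolding F.quad_def by (subst sum.Sigma) (auto simp: F.finite_V SF)
  also have "\<dots> \<le> adjacency_spectral_radius ?F * (\<Sum>a\<in>pverts ?F. (y (f a))\<^sup>2)"
    by (rule spectral_radius_perron[OF F ne]) blast
  also have "(\<Sum>a\<in>pverts ?F. (y (f a))\<^sup>2) = (\<Sum>v\<in>V. (y v)\<^sup>2)"
    by (rule sum.reindex_bij_betw[OF bij])
  finally show ?thesis .
qed

lemma iso_F_graph:
  assumes G: "pair_graph G" and V: "pverts G = V" and NG: "\<And>v. v \<in> V \<Longrightarrow> {u. (v, u) \<in> parcs G} = N v"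
  shows "digraph_iso (with_proj G) (with_proj (F_graph n t))"
proof -
  interpret G: pair_graph G by fact
  interpret F: pair_graph "F_graph n t" by (rule pair_graph_F_graph)
  define g where "g = inv_into (pverts (F_graph n t)) f"
  have gf: "g (f a) = a" if "a \<in> pverts (F_graph n t)" for a
    using that bij by (simp add: g_def bij_betw_def)
  have pG: "parcs G = map_prod f f ` parcs (F_graph n t)"
  proof (rule Set.set_eqI)
    fix e :: "'a \<times> 'a"
    obtain v u where e: "e = (v, u)" by (cases e)
    show "e \<in> parcs G \<longleftrightarrow> e \<in> map_prod f f ` parcs (F_graph n t)"
      unfolding arcs_eq[symmetric] e mem_Sigma_iff using NG[of v] V G.wellformed'(1)[of v u] by auto
  qed
  have bijg: "bij_betw g V (pverts (F_graph n t))"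
    unfolding g_def by (rule bij_betw_inv_into[OF bij])
  show ?thesis
  proof (rule digraph_iso_with_projI[of _ g])
    show "wf_digraph (with_proj G)" by unfold_locales
    show "inj_on g (pverts G)" "pverts (F_graph n t) = g ` pverts G"
      using bijg V by (auto simp: bij_betw_def)
    have "(\<lambda>e. map_prod g g (map_prod f f e)) ` parcs (F_graph n t) = (\<lambda>e. e) ` parcs (F_graph n t)"
      by (rule image_cong) (use F.wellformed' gf in auto)
    then show "parcs (F_graph n t) = map_prod g g ` parcs G" by (simp add: pG image_image)
  qed
qed

end

text \<open>\<open>M\<close> is a partial matching outside the core \<open>L\<close>. The
  enumeration also pairs the leftover vertices, so the copy contains \<open>M\<close> but may have
  further edges.\<close>

lemma F_copy_exists:
  fixes V L :: "'a set" and M :: "'a \<Rightarrow> 'a set"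
  assumes fin: "finite V" and L: "L \<subseteq> V"
    and M: "\<And>u v. u \<in> V - L \<Longrightarrow> v \<in> M u \<Longrightarrow> v \<in> V - L \<and> u \<in> M v \<and> u \<noteq> v"
      "\<And>u v w. u \<in> V - L \<Longrightarrow> v \<in> M u \<Longrightarrow> w \<in> M u \<Longrightarrow> v = w"
  obtains f N' where "F_copy V N' (card V) (card L) f"
    "\<And>l. l \<in> L \<Longrightarrow> N' l = V - {l}"
    "\<And>u. u \<in> V - L \<Longrightarrow> L \<subseteq> N' u \<and> M u \<subseteq> N' u \<and> card (N' u - L) \<le> 1"
proof -
  let ?t = "card L" and ?n = "card V" and ?X = "V - L"
  have finL: "finite L" using fin L finite_subset by blast
  have cX: "card ?X = ?n - ?t" by (rule card_Diff_subset[OF finL L])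
  obtain g where g: "bij_betw g {..<card ?X} ?X"
      "\<forall>u\<in>?X. \<forall>v\<in>M u. \<exists>i. 2 * i + 1 < card ?X \<and> (u = g (2 * i) \<and> v = g (2 * i + 1) \<or> v = g (2 * i) \<and> u = g (2 * i + 1))"
  proof -
    have "\<exists>g. bij_betw g {..<card ?X} ?X \<and> (\<forall>u\<in>?X. \<forall>v\<in>M u. \<exists>i. 2 * i + 1 < card ?X \<and>
        (u = g (2 * i) \<and> v = g (2 * i + 1) \<or> v = g (2 * i) \<and> u = g (2 * i + 1)))"
      by (rule matching_enumeration; (rule finite_Diff[OF fin] | rule M); assumption)
    then show ?thesis by (elim exE conjE) (rule that)
  qed
  obtain h where h: "bij_betw h {..<?t} L"
    using ex_bij_betw_nat_finite[OF finL] by (auto simp: atLeast0LessThan)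
  define f where "f = case_sum h g"
  have fs: "f (Inl i) = h i" "f (Inr i) = g i" for i by (simp_all add: f_def)
  let ?F = "F_graph ?n ?t"
  have hi: "inj_on h {..<?t}" "h ` {..<?t} = L" and gi: "inj_on g {..<?n - ?t}" "g ` {..<?n - ?t} = ?X"
    using h g(1) by (auto simp: bij_betw_def cX)
  have bij: "bij_betw f (pverts ?F) V"
  proof -
    have "f ` pverts ?F = V"
      unfolding F_graph_verts image_Un image_image fs hi(2) gi(2) using L by blast
    moreover have "card (pverts ?F) = ?n" using L fin by (intro card_F_graph card_mono)
    ultimately show ?thesis
      unfolding bij_betw_def by (intro conjI eq_card_imp_inj_on) (auto simp: F_graph_verts)
  qed
  interpret F: pair_graph ?F by (rule pair_graph_F_graph)
  have Fsym: "(b, a) \<in> parcs ?F" if "(a, b) \<in> parcs ?F" for a b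
    using F.pair_sym_arcs that by (auto simp: symmetric_def sym_def)
  have finj: "f a = f b \<longleftrightarrow> a = b" if "a \<in> pverts ?F" "b \<in> pverts ?F" for a b
    using that bij by (auto simp: bij_betw_def inj_on_eq_iff)
  define N' where "N' v = {u. (v, u) \<in> map_prod f f ` parcs ?F}" for v
  have N'f: "f b \<in> N' (f a) \<longleftrightarrow> (a, b) \<in> parcs ?F" if "a \<in> pverts ?F" "b \<in> pverts ?F" for a b
    using that finj F.wellformed' by (auto simp: N'_def map_prod_def)
  have sg: "simple_graph V N'"
  proof
    show "N' v \<subseteq> V" for v
      using bij F.wellformed' by (auto simp: N'_def bij_betw_def)
    show "v \<in> N' u" if "u \<in> N' v" for u v
      using that Fsym by (auto simp: N'_def image_iff) (metis map_prod_simp)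
    show "v \<notin> N' v" for v
      using finj F.wellformed' F.no_loops' by (auto simp: N'_def)
  qed (rule fin)
  have core: "N' l = V - {l}" if l: "l \<in> L" for l
  proof -
    obtain i where i: "i < ?t" "l = f (Inl i)" using l hi(2) by (auto simp: fs)
    have iF: "Inl i \<in> pverts ?F" using i by (auto simp: F_graph_verts)
    have "f b \<in> N' l \<longleftrightarrow> f b \<noteq> l" if b: "b \<in> pverts ?F" for b
      unfolding i(2) N'f[OF iF b] finj[OF b iF] using b i(1)
      by (cases b) (auto simp: F_graph_verts F_graph_arcs)
    then have "v \<in> N' l \<longleftrightarrow> v \<noteq> l" if "v \<in> V" for v
      using that bij_betw_imp_surj_on[OF bij] by (metis imageE)
    then show ?thesis using simple_graph.N_subset[OF sg, of l] by blast
  qed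
  have other: "L \<subseteq> N' u \<and> M u \<subseteq> N' u \<and> card (N' u - L) \<le> 1" if u: "u \<in> V - L" for u
  proof (intro conjI)
    show "L \<subseteq> N' u" using core u simple_graph.N_sym[OF sg, of u] by blast
    show "M u \<subseteq> N' u"
    proof
      fix v assume v: "v \<in> M u"
      from bspec[OF bspec[OF g(2) u] v] obtain i where i: "2 * i + 1 < ?n - ?t"
        "u = f (Inr (2 * i)) \<and> v = f (Inr (2 * i + 1)) \<or> v = f (Inr (2 * i)) \<and> u = f (Inr (2 * i + 1))"
        unfolding cX by (elim exE conjE) (rule that, assumption, simp only: fs)
      have "(Inr (2 * i), Inr (2 * i + 1)) \<in> parcs ?F" "(Inr (2 * i + 1), Inr (2 * i)) \<in> parcs ?F"
        using i(1) unfolding F_graph_arcs by blast+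
      then show "v \<in> N' u" using i(2) N'f F.wellformed' by metis
    qed
    obtain j where j: "j < ?n - ?t" "u = f (Inr j)" using u gi(2) by (auto simp: fs)
    have jF: "Inr j \<in> pverts ?F" using j by (auto simp: F_graph_verts)
    have pos: "\<exists>k. v = f (Inr k) \<and> (Inr j, Inr k) \<in> parcs ?F" if v: "v \<in> N' u - L" for v
    proof -
      have "v \<in> V - L" using v simple_graph.N_subset[OF sg] by blast
      then obtain k where k: "k < ?n - ?t" "v = f (Inr k)" using gi(2) by (auto simp: fs)
      have "Inr k \<in> pverts ?F" using k by (auto simp: F_graph_verts)
      then show ?thesis using v k N'f[OF jF] j by auto
    qed
    have "v = w" if v: "v \<in> N' u - L" and w: "w \<in> N' u - L" for v w
    proof -
      obtain k k' where k: "v = f (Inr k)" "(Inr j, Inr k) \<in> parcs ?F"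
          "w = f (Inr k')" "(Inr j, Inr k') \<in> parcs ?F"
        using pos[OF v] pos[OF w] by blast
      have "k = k'" using k(2,4) unfolding F_graph_arcs by presburger
      then show ?thesis using k by simp
    qed
    then show "card (N' u - L) \<le> 1"
      using simple_graph.finite_N[OF sg, of u] by (auto simp: card_le_Suc0_iff_eq)
  qed
  have "F_copy V N' ?n ?t f"
    using sg bij by (simp add: F_copy_def F_copy_axioms_def N'_def)
  then show ?thesis using core other by (rule that)
qed

section \<open>Comparing a graph with a copy of the extremal graph\<close>

context simple_graph
begin

lemma quad_eigenvector:
  assumes "\<And>v. v \<in> V \<Longrightarrow> (\<Sum>u\<in>N v. x u) = lam * x v"
  shows "quad x = lam * (\<Sum>v\<in>V. (x v)\<^sup>2)"
proof -
  have "quad x = (\<Sum>v\<in>V. x v * (\<Sum>u\<in>N v. x u))" by (simp add: quad_def sum_distrib_left)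
  also have "\<dots> = (\<Sum>v\<in>V. lam * (x v)\<^sup>2)"
    by (intro sum.cong refl) (simp add: assms power2_eq_square)
  finally show ?thesis by (simp add: sum_distrib_left)
qed

text \<open>
  The vertices of \<open>W\<close> below miss a core vertex: joining them to all of \<open>L\<close> gains at least as
  much as is lost by deleting their other edges, by the hypothesis \<open>small\<close>.
\<close>

lemma F_comparison:
  fixes x :: "'a \<Rightarrow> real"
  assumes x0: "\<And>v. 0 \<le> x v" and eig: "\<And>v. v \<in> V \<Longrightarrow> (\<Sum>u\<in>N v. x u) = lam * x v"
    and lam: "adjacency_spectral_radius (F_graph (card V) (card L)) \<le> lam" "0 < lam"
    and L: "L \<subseteq> V" "L \<noteq> {}" and xL: "\<And>l. l \<in> L \<Longrightarrow> 1 / 2 \<le> x l"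
    and cod: "\<And>b l. b \<in> V - L \<Longrightarrow> l \<in> L \<Longrightarrow> card (N b \<inter> N l - L) \<le> 1"
    and small: "\<And>u. u \<in> V - L \<Longrightarrow> (\<Sum>v\<in>N u - L. x v) \<le> 1 / 2"
  shows "\<exists>f N'. F_copy V N' (card V) (card L) f \<and> (\<forall>v\<in>V. N v = N' v)"
proof -
  define W where "W = {u \<in> V - L. \<not> L \<subseteq> N u}"
  define R where "R = V - L - W"
  define M where "M u = (if u \<in> R then N u \<inter> R else {})" for u
  have finL: "finite L" using L finite_V finite_subset by blast
  have fin: "finite W" "finite R" using finite_V by (auto simp: W_def R_def)
  have RV: "R \<subseteq> V" "W \<subseteq> V" "W \<inter> L = {}" "R \<inter> L = {}" "R \<inter> W = {}" and V_eq: "V = L \<union> (R \<union> W)"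
    using L by (auto simp: R_def W_def)
  have RL: "L \<subseteq> N u" if "u \<in> R" for u using that by (auto simp: R_def W_def)
  have WL: "\<not> L \<subseteq> N u" if "u \<in> W" for u using that by (auto simp: W_def)
  obtain l0 where l0: "l0 \<in> L" using L by blast
  \<comment> \<open>All of \<open>R\<close> is adjacent to \<open>l0\<close>, so two neighbours of
    \<open>u\<close> in \<open>R\<close> would both be common neighbours of \<open>u\<close> and
    \<open>l0\<close>.\<close>
  have M_uniq: "v = w" if u: "u \<in> R" and v: "v \<in> N u \<inter> R" and w: "w \<in> N u \<inter> R" for u v w
  proof -
    have "N u \<inter> R \<subseteq> N u \<inter> N l0 - L"
      using RL l0 N_sym by (fastforce simp: R_def)
    moreover have "card (N u \<inter> N l0 - L) \<le> 1" using cod[OF _ l0] u by (auto simp: R_def)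
    ultimately have "card (N u \<inter> R) \<le> Suc 0"
      using card_mono[of "N u \<inter> N l0 - L" "N u \<inter> R"] by simp
    then show ?thesis using v w by (simp add: card_le_Suc0_iff_eq)
  qed
  obtain f N' where F: "F_copy V N' (card V) (card L) f"
    and core: "\<And>l. l \<in> L \<Longrightarrow> N' l = V - {l}"
    and other: "\<And>u. u \<in> V - L \<Longrightarrow> L \<subseteq> N' u \<and> M u \<subseteq> N' u \<and> card (N' u - L) \<le> 1"
  proof (rule F_copy_exists[OF finite_V L(1), of M])
    show "v \<in> V - L \<and> u \<in> M v \<and> u \<noteq> v" if "u \<in> V - L" "v \<in> M u" for u v
      using that N_sym N_irrefl RV by (auto simp: M_def split: if_splits)
    show "v = w" if "u \<in> V - L" "v \<in> M u" "w \<in> M u" for u v w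
      using that M_uniq[of u v w] by (auto simp: M_def split: if_splits)
  qed (rule that)
  interpret F': F_copy V N' "card V" "card L" f by (rule F)
  have xsum0: "0 \<le> (\<Sum>u\<in>A. x u)" for A by (intro sum_nonneg x0)
  have xmono: "(\<Sum>u\<in>A. x u) \<le> (\<Sum>u\<in>B. x u)" if "A \<subseteq> B" "finite B" for A B
    by (rule sum_mono2) (use that x0 in auto)
  have xun: "(\<Sum>u\<in>A \<union> B. x u) = (\<Sum>u\<in>A. x u) + (\<Sum>u\<in>B. x u)"
    if "finite A" "finite B" "A \<inter> B = {}" for A B using that by (rule sum.union_disjoint)
  have aL: "(\<Sum>u\<in>N v. x u) + (\<Sum>u\<in>W - N v. x u) \<le> (\<Sum>u\<in>N' v. x u)" if v: "v \<in> L" for v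
  proof -
    have "N v \<union> (W - N v) \<subseteq> N' v"
      unfolding core[OF v] using N_subset N_irrefl RV v by auto
    then have "(\<Sum>u\<in>N v \<union> (W - N v). x u) \<le> (\<Sum>u\<in>N' v. x u)" by (rule xmono) simp
    then show ?thesis using xun[of "N v" "W - N v"] fin by auto
  qed
  have aR: "(\<Sum>u\<in>N v. x u) - (\<Sum>u\<in>N v \<inter> W. x u) \<le> (\<Sum>u\<in>N' v. x u)" if v: "v \<in> R" for v
  proof -
    have "N v - W \<subseteq> N' v"
    proof
      fix u assume u: "u \<in> N v - W"
      show "u \<in> N' v"
      proof (cases "u \<in> L")
        case True
        then show ?thesis using other[of v] v by (auto simp: R_def)
      next
        case False
        then have "u \<in> R" using u N_subset[of v] by (auto simp: R_def)
        then have "u \<in> M v" using v u by (simp add: M_def)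
        then show ?thesis using other[of v] v by (auto simp: R_def)
      qed
    qed
    then have "(\<Sum>u\<in>N v - W. x u) \<le> (\<Sum>u\<in>N' v. x u)" by (rule xmono) simp
    then show ?thesis using sum.Int_Diff[of "N v" x W] by simp
  qed
  have gain: "1 / 2 \<le> (\<Sum>u\<in>L - N v. x u)" if v: "v \<in> W" for v
  proof -
    obtain l where l: "l \<in> L" "l \<notin> N v" using WL[OF v] by blast
    have "1 / 2 \<le> (\<Sum>u\<in>{l}. x u)" using xL l by simp
    also have "\<dots> \<le> (\<Sum>u\<in>L - N v. x u)" by (rule xmono) (use l finL in auto)
    finally show ?thesis .
  qed
  have aW: "(\<Sum>u\<in>N v. x u) \<le> (\<Sum>u\<in>N' v. x u)" if v: "v \<in> W" for v
  proof -
    have vV: "v \<in> V - L" using v by (auto simp: W_def)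
    have "(\<Sum>u\<in>N v. x u) = (\<Sum>u\<in>N v \<inter> L. x u) + (\<Sum>u\<in>N v - L. x u)"
      using sum.Int_Diff[of "N v" x L] by simp
    also have "\<dots> \<le> (\<Sum>u\<in>L \<inter> N v. x u) + (\<Sum>u\<in>L - N v. x u)"
      using gain[OF v] small[OF vV] by (simp add: Int_commute)
    also have "\<dots> = (\<Sum>u\<in>L. x u)" using sum.Int_Diff[OF finL, of x "N v"] by simp
    also have "\<dots> \<le> (\<Sum>u\<in>N' v. x u)" by (rule xmono) (use other[OF vV] in auto)
    finally show ?thesis .
  qed
  \<comment> \<open>Regrouping by the vertex \<open>u\<close> of \<open>W\<close> makes gain and
    loss comparable: what the rows of \<open>L\<close> gain at \<open>u\<close> is set against what
    the rows of \<open>R\<close> lose at \<open>u\<close>.\<close>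
  have swapL: "(\<Sum>v\<in>L. x v * (\<Sum>u\<in>W - N v. x u)) = (\<Sum>u\<in>W. x u * (\<Sum>v\<in>L - N u. x v))"
  proof -
    have "(\<Sum>v\<in>L. x v * (\<Sum>u\<in>W - N v. x u)) = (\<Sum>v\<in>L. \<Sum>u\<in>W. if u \<in> N v then 0 else x v * x u)"
      by (intro sum.cong refl) (simp add: sum_distrib_left sum.If_cases fin Diff_eq Compl_eq)
    also have "\<dots> = (\<Sum>u\<in>W. \<Sum>v\<in>L. if u \<in> N v then 0 else x v * x u)" by (rule sum.swap)
    also have "\<dots> = (\<Sum>u\<in>W. \<Sum>v\<in>L. if v \<in> N u then 0 else x u * x v)"
      by (intro sum.cong refl) (auto simp: N_sym_iff mult.commute)
    also have "\<dots> = (\<Sum>u\<in>W. x u * (\<Sum>v\<in>L - N u. x v))"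
      by (intro sum.cong refl) (simp add: sum_distrib_left sum.If_cases finL Diff_eq Compl_eq)
    finally show ?thesis .
  qed
  have swapR: "(\<Sum>v\<in>R. x v * (\<Sum>u\<in>N v \<inter> W. x u)) = (\<Sum>u\<in>W. x u * (\<Sum>v\<in>N u \<inter> R. x v))"
    using sum_N_swap[of R W "\<lambda>v u. x v * x u"] RV by (simp add: sum_distrib_left mult.commute)
  have smallR: "(\<Sum>v\<in>N u \<inter> R. x v) \<le> 1 / 2" if u: "u \<in> W" for u
  proof -
    have "(\<Sum>v\<in>N u \<inter> R. x v) \<le> (\<Sum>v\<in>N u - L. x v)" by (rule xmono) (auto simp: R_def)
    then show ?thesis using small[of u] u by (auto simp: W_def)
  qed
  have split: "(\<Sum>v\<in>V. g v) = (\<Sum>v\<in>L. g v) + ((\<Sum>v\<in>R. g v) + (\<Sum>v\<in>W. g v))" for g :: "'a \<Rightarrow> real"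
  proof -
    have "(\<Sum>v\<in>L \<union> (R \<union> W). g v) = (\<Sum>v\<in>L. g v) + ((\<Sum>v\<in>R. g v) + (\<Sum>v\<in>W. g v))"
      by (subst sum.union_disjoint, use finL fin RV in auto)+
    then show ?thesis using V_eq by simp
  qed
  have "(\<Sum>v\<in>V. x v * (\<Sum>u\<in>N v. x u)) \<le> (\<Sum>v\<in>V. x v * (\<Sum>u\<in>N' v. x u))"
  proof -
    have "(\<Sum>u\<in>W. x u * (\<Sum>v\<in>N u \<inter> R. x v)) \<le> (\<Sum>u\<in>W. x u * (\<Sum>v\<in>L - N u. x v))"
      by (intro sum_mono mult_left_mono x0) (use gain smallR order_trans in blast)
    then have 0: "(\<Sum>v\<in>R. x v * (\<Sum>u\<in>N v \<inter> W. x u)) \<le> (\<Sum>v\<in>L. x v * (\<Sum>u\<in>W - N v. x u))"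
      unfolding swapL swapR .
    have 1: "(\<Sum>v\<in>L. x v * (\<Sum>u\<in>N v. x u)) + (\<Sum>v\<in>L. x v * (\<Sum>u\<in>W - N v. x u)) \<le> (\<Sum>v\<in>L. x v * (\<Sum>u\<in>N' v. x u))"
      unfolding sum.distrib[symmetric] distrib_left[symmetric]
      by (intro sum_mono mult_left_mono x0 aL)
    have 2: "(\<Sum>v\<in>R. x v * (\<Sum>u\<in>N v. x u)) - (\<Sum>v\<in>R. x v * (\<Sum>u\<in>N v \<inter> W. x u)) \<le> (\<Sum>v\<in>R. x v * (\<Sum>u\<in>N' v. x u))"
      unfolding sum_subtractf[symmetric] right_diff_distrib[symmetric]
      by (intro sum_mono mult_left_mono x0 aR)
    have 3: "(\<Sum>v\<in>W. x v * (\<Sum>u\<in>N v. x u)) \<le> (\<Sum>v\<in>W. x v * (\<Sum>u\<in>N' v. x u))"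
      by (intro sum_mono mult_left_mono x0 aW)
    show ?thesis unfolding split using 0 1 2 3 by linarith
  qed
  then have ge: "quad x \<le> F'.quad x"
    by (simp add: quad_def F'.quad_def sum_distrib_left)
  have "quad x = lam * (\<Sum>v\<in>V. (x v)\<^sup>2)" by (rule quad_eigenvector[OF eig])
  then have eq: "F'.quad x \<ge> lam * (\<Sum>v\<in>V. (x v)\<^sup>2)" using ge by simp
  have ub: "F'.quad y \<le> lam * (\<Sum>v\<in>V. (y v)\<^sup>2)" for y
  proof -
    have "F'.quad y \<le> adjacency_spectral_radius (F_graph (card V) (card L)) * (\<Sum>v\<in>V. (y v)\<^sup>2)"
      by (rule F'.rayleigh_F) (use L in auto)
    also have "\<dots> \<le> lam * (\<Sum>v\<in>V. (y v)\<^sup>2)" by (intro mult_right_mono lam sum_nonneg) auto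
    finally show ?thesis .
  qed
  have eig': "(\<Sum>u\<in>N' v. x u) = lam * x v" if "v \<in> V" for v
    by (rule F'.rayleigh_equality[OF ub eq that])
  \<comment> \<open>Positivity comes from the eigenvalue equation of the copy, where every vertex
    outside \<open>L\<close> is adjacent to \<open>l0\<close>.\<close>
  have xpos: "0 < x v" if v: "v \<in> V" for v
  proof (cases "v \<in> L")
    case True
    then show ?thesis using xL[of v] by linarith
  next
    case False
    have "1 / 2 \<le> (\<Sum>u\<in>{l0}. x u)" using xL l0 by simp
    also have "\<dots> \<le> (\<Sum>u\<in>N' v. x u)" by (rule xmono) (use other[of v] v False l0 in auto)
    finally have "0 < lam * x v" using eig'[OF v] by simp
    then show ?thesis using lam(2) by (simp add: zero_less_mult_iff)
  qed
  \<comment> \<open>Equal row sums of a positive vector turn inclusion of neighbourhoods into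
    equality. This is applied first to core vertices, which shows that \<open>W\<close> is empty,
    and only then to the rest.\<close>
  have eqset: "N v = N' v" if v: "v \<in> V" and sub: "N v \<subseteq> N' v" for v
  proof (rule ccontr)
    assume "N v \<noteq> N' v"
    then obtain w where w: "w \<in> N' v - N v" using sub by blast
    have "(\<Sum>u\<in>N v. x u) < (\<Sum>u\<in>N' v. x u)"
      by (rule sum_strict_mono2[OF _ sub w]) (use xpos w F'.N_subset x0 in auto)
    then show False using eig eig' v by simp
  qed
  have NL: "N l = V - {l}" if l: "l \<in> L" for l
    using eqset[of l] core[OF l] l L N_subset N_irrefl by blast
  have W0: "W = {}"
    using NL N_sym by (fastforce simp: W_def)
  have "N v = N' v" if v: "v \<in> V" for v
  proof (cases "v \<in> L")
    case True
    then show ?thesis using NL core by simp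
  next
    case False
    then have vR: "v \<in> R" using v W0 by (simp add: R_def)
    have "N v \<subseteq> L \<union> M v" using N_subset[of v] W0 vR by (auto simp: M_def R_def)
    then show ?thesis using eqset[OF v] other[of v] v False by blast
  qed
  then show ?thesis using F by blast
qed

end

text \<open>The test vector is the Perron vector of the complete bipartite graph between the core
  and the rest, whose eigenvalue is \<open>sqrt (t * (n - t))\<close>; the other edges only increase
  the form.\<close>

lemma F_graph_spectral_radius_lower:
  assumes t: "0 < t" "t < n"
  shows "real t * (real n - real t) \<le> (adjacency_spectral_radius (F_graph n t))\<^sup>2"
    "0 < adjacency_spectral_radius (F_graph n t)"
proof -
  let ?F = "F_graph n t" and ?NF = "\<lambda>v. {u. (v, u) \<in> parcs (F_graph n t)}"
  let ?m = "n - t"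
  have F: "pair_graph ?F" by (rule pair_graph_F_graph)
  interpret F: simple_graph "pverts ?F" ?NF by (rule simple_graph_of_pair_graph[OF F])
  have ne: "pverts ?F \<noteq> {}" using t by (auto simp: F_graph_verts)
  define a b where "a = sqrt (real ?m)" and "b = sqrt (real t)"
  have ab: "a\<^sup>2 = ?m" "b\<^sup>2 = t" "a > 0" "b > 0" using t by (auto simp: a_def b_def)
  define y where "y = (\<lambda>v::nat + nat. case v of Inl _ \<Rightarrow> a | Inr _ \<Rightarrow> b)"
  have y: "y (Inl i) = a" "y (Inr j) = b" for i j by (simp_all add: y_def)
  have y0: "0 \<le> y v" for v using ab by (cases v) (auto simp: y)
  have sumF: "(\<Sum>v\<in>pverts ?F. g v) = (\<Sum>i<t. g (Inl i)) + (\<Sum>j<?m. g (Inr j))" for g :: "nat + nat \<Rightarrow> real"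
    unfolding F_graph_verts by (subst sum.union_disjoint) (auto simp: sum.reindex)
  have 1: "?m * b \<le> (\<Sum>u\<in>?NF (Inl i). y u)" if "i < t" for i
  proof -
    have "?m * b = (\<Sum>u\<in>Inr ` {..<?m}. y u)" by (simp add: sum.reindex y)
    also have "\<dots> \<le> (\<Sum>u\<in>?NF (Inl i). y u)"
      by (rule sum_mono2) (use that y0 in \<open>auto simp: F_graph_arcs\<close>)
    finally show ?thesis .
  qed
  have 2: "t * a \<le> (\<Sum>u\<in>?NF (Inr j). y u)" if "j < ?m" for j
  proof -
    have "t * a = (\<Sum>u\<in>Inl ` {..<t}. y u)" by (simp add: sum.reindex y)
    also have "\<dots> \<le> (\<Sum>u\<in>?NF (Inr j). y u)"
      by (rule sum_mono2) (use that y0 in \<open>auto simp: F_graph_arcs\<close>)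
    finally show ?thesis .
  qed
  have "(a * b) * (2 * (real t * real ?m)) = (\<Sum>i<t. a * (?m * b)) + (\<Sum>j<?m. b * (t * a))"
    by simp
  also have "\<dots> \<le> (\<Sum>i<t. a * (\<Sum>u\<in>?NF (Inl i). y u)) + (\<Sum>j<?m. b * (\<Sum>u\<in>?NF (Inr j). y u))"
    using ab 1 2 by (intro add_mono sum_mono mult_left_mono) auto
  also have "\<dots> = F.quad y"
    unfolding F.quad_def sumF by (simp add: y sum_distrib_left)
  also have "\<dots> \<le> adjacency_spectral_radius ?F * (\<Sum>v\<in>pverts ?F. (y v)\<^sup>2)"
    by (rule spectral_radius_perron[OF F ne])
  also have "(\<Sum>v\<in>pverts ?F. (y v)\<^sup>2) = 2 * (real t * real ?m)"
    unfolding sumF by (simp add: y ab)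
  finally have le: "a * b \<le> adjacency_spectral_radius ?F"
    using t by (simp add: mult_le_cancel_right)
  then show "0 < adjacency_spectral_radius ?F" using ab by (smt (verit) mult_pos_pos)
  have "real t * (real n - real t) = (a * b)\<^sup>2" using t by (simp add: power_mult_distrib ab of_nat_diff)
  also have "\<dots> \<le> (adjacency_spectral_radius ?F)\<^sup>2"
    using le ab by (intro power_mono) auto
  finally show "real t * (real n - real t) \<le> (adjacency_spectral_radius ?F)\<^sup>2" .
qed

section \<open>Graphs without \<open>t\<close> four-cycles at a vertex, for \<open>t \<ge> 2\<close>\<close>

text \<open>The coefficient of \<open>r\<close> in the inequality for \<open>lam\<^sup>2\<close> at
  the maximal entry. The first summand bounds the sum of all entries; \<open>34 = 24 + 9 + 1\<close>
  collects the walks through \<open>S\<close>, the ends in \<open>S\<close>, and the loss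
  \<open>t\<^sup>2\<close> in the lower bound for \<open>lam\<^sup>2\<close>.\<close>

definition defect_const :: "nat \<Rightarrow> real" where
  "defect_const t = 294912 * real t ^ 4 + 34 * real t ^ 2"

text \<open>In \<open>far_bound\<close>, two-walks that leave \<open>far\<close> at the second step
  contribute \<open>t * defect_const t\<close>, those that leave it at the first step
  \<open>8 * t * t\<close>.\<close>

definition far_const :: "nat \<Rightarrow> real" where
  "far_const t = real t * (defect_const t + 8 * real t)"

definition outside_const :: "nat \<Rightarrow> real" where
  "outside_const t = real t + defect_const t * far_const t"

text \<open>The vector is scaled to have maximum \<open>1\<close>, attained at \<open>z\<close>, and
  \<open>r\<close> is the unit in which errors are measured.\<close>

locale dense_packing_free = simple_graph V N for V :: "'a set" and N +
  fixes t :: nat and lam :: real and x :: "'a \<Rightarrow> real" and z :: 'a and n r :: real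
  assumes t2: "2 \<le> t"
    and no_packing: "\<And>v S. v \<in> V \<Longrightarrow> \<not> packing v t S"
    and x0: "\<And>v. 0 \<le> x v" and x1: "\<And>v. v \<in> V \<Longrightarrow> x v \<le> 1"
    and z: "z \<in> V" "x z = 1"
    and eig: "\<And>v. v \<in> V \<Longrightarrow> (\<Sum>u\<in>N v. x u) = lam * x v"
    and lam0: "0 \<le> lam" and lam_ge: "real t * (real (card V) - real t) \<le> lam\<^sup>2"
    and n_def: "n = real (card V)" and r_def: "r = sqrt n" and r_ge: "12 * real t \<le> r"
begin

lemma r1: "1 \<le> r" and n_eq: "n = r * r" and n_ge: "144 * real t ^ 2 \<le> n"
proof -
  show "1 \<le> r" using r_ge t2 by linarith
  show n: "n = r * r" unfolding r_def using n_def by simp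
  have "(12 * real t) * (12 * real t) \<le> r * r" by (intro mult_mono r_ge) (use t2 r_ge in auto)
  then show "144 * real t ^ 2 \<le> n" unfolding n by (simp add: power2_eq_square)
qed

lemma NV: "u \<in> N v \<Longrightarrow> u \<in> V" using N_subset by blast

lemma eig2: "v \<in> V \<Longrightarrow> (\<Sum>u\<in>N v. \<Sum>w\<in>N u. x w) = lam\<^sup>2 * x v"
proof -
  assume v: "v \<in> V"
  have "(\<Sum>u\<in>N v. \<Sum>w\<in>N u. x w) = (\<Sum>u\<in>N v. lam * x u)"
    by (intro sum.cong refl eig) (rule NV)
  also have "\<dots> = lam\<^sup>2 * x v"
    by (simp add: sum_distrib_left[symmetric] eig[OF v] power2_eq_square)
  finally show ?thesis .
qed

lemma two_walks: "v \<in> V \<Longrightarrow> X \<subseteq> V \<Longrightarrow> (\<Sum>u\<in>N v \<inter> X. real (card (N u \<inter> X))) \<le> 8 * real t * real (card X)"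
proof -
  assume v: "v \<in> V" and X: "X \<subseteq> V"
  have "(\<Sum>u\<in>N v \<inter> X. card (N u \<inter> X)) \<le> 8 * t * card X"
    by (rule two_walks_card_bound) (use no_packing[OF v] t2 X in auto)
  then have "real (\<Sum>u\<in>N v \<inter> X. card (N u \<inter> X)) \<le> real (8 * t * card X)"
    by (rule of_nat_mono)
  then show ?thesis by simp
qed

lemma two_walks_V: "v \<in> V \<Longrightarrow> (\<Sum>u\<in>N v. real (card (N u))) \<le> 8 * real t * n"
  using two_walks[of v V] N_subset by (simp add: Int_absorb2 n_def)

lemma lam_upper: "lam \<le> 8 * real t * r"
proof -
  have "lam\<^sup>2 = (\<Sum>u\<in>N z. \<Sum>w\<in>N u. x w)" using eig2[OF z(1)] z(2) by simp
  also have "\<dots> \<le> (\<Sum>u\<in>N z. real (card (N u)))"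
  proof (rule sum_mono)
    fix u
    have "(\<Sum>w\<in>N u. x w) \<le> real (card (N u)) * 1"
      by (rule sum_bounded_above) (use x1 NV in auto)
    then show "(\<Sum>w\<in>N u. x w) \<le> real (card (N u))" by simp
  qed
  also have "\<dots> \<le> 8 * real t * n" by (rule two_walks_V[OF z(1)])
  also have "\<dots> \<le> (8 * real t) * (8 * real t) * (r * r)"
    unfolding n_eq by (intro mult_right_mono) (use t2 in auto)
  also have "\<dots> = (8 * real t * r)\<^sup>2" by (simp add: power2_eq_square)
  finally show ?thesis by (rule power2_le_imp_le) (use r1 in auto)
qed

lemma lam_lower2: "real t * n - real t ^ 2 \<le> lam\<^sup>2"
  using lam_ge by (simp add: n_def algebra_simps power2_eq_square)

text \<open>The constant \<open>3 / 2\<close> has to exceed the \<open>5 / 4\<close> of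
  \<open>row_sum_not_big\<close> and to absorb the \<open>n / 2\<close> in
  \<open>far_bound\<close>.\<close>

lemma lam_lower: "3 / 2 * n \<le> lam\<^sup>2" "r \<le> lam"
proof -
  have "2 * n \<le> real t * n" using t2 n_def by (intro mult_right_mono) auto
  moreover have "real t ^ 2 \<le> n / 2" using n_ge zero_le_power2[of "real t"] by linarith
  ultimately show 1: "3 / 2 * n \<le> lam\<^sup>2" using lam_lower2 by linarith
  have "r\<^sup>2 = n" by (simp add: n_eq power2_eq_square)
  also have "\<dots> \<le> lam\<^sup>2" using 1 n_def by linarith
  finally show "r \<le> lam" by (rule power2_le_imp_le) (rule lam0)
qed

section \<open>Vertices of large degree and the sum of the entries\<close>

definition big :: "'a set" where
  "big = {v \<in> V. n \<le> 24 * real t * real (card (N v))}"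

text \<open>The two-walks from \<open>v\<close> limit the number of big neighbours of
  \<open>v\<close>, and counting the edges at \<open>big\<close> from both ends then limits
  \<open>big\<close>. The threshold \<open>n / (24 * t)\<close> is high enough for a bound
  independent of \<open>n\<close>, and low enough to keep the errors in
  \<open>row_sum_not_big\<close> small.\<close>

lemma card_big: "real (card big) \<le> 4608 * real t ^ 3"
proof -
  have n0: "0 < n" using n_eq r1 by simp
  have nb: "real (card (N v \<inter> big)) \<le> 192 * real t ^ 2" if v: "v \<in> V" for v
  proof -
    have "real (card (N v \<inter> big)) * n = (\<Sum>u\<in>N v \<inter> big. n)" by simp
    also have "\<dots> \<le> (\<Sum>u\<in>N v \<inter> big. 24 * real t * real (card (N u)))"
      by (rule sum_mono) (auto simp: big_def)
    also have "\<dots> \<le> (\<Sum>u\<in>N v. 24 * real t * real (card (N u)))"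
      by (rule sum_mono2) auto
    also have "\<dots> = 24 * real t * (\<Sum>u\<in>N v. real (card (N u)))" by (simp add: sum_distrib_left)
    also have "\<dots> \<le> 24 * real t * (8 * real t * n)"
      by (intro mult_left_mono two_walks_V[OF v]) auto
    also have "\<dots> = (192 * real t ^ 2) * n" by (simp add: power2_eq_square)
    finally show ?thesis using n0 by simp
  qed
  have "real (card big) * n = (\<Sum>u\<in>big. n)" by simp
  also have "\<dots> \<le> (\<Sum>u\<in>big. 24 * real t * real (card (N u)))"
    by (rule sum_mono) (auto simp: big_def)
  also have "\<dots> = 24 * real t * (\<Sum>u\<in>big. \<Sum>v\<in>N u \<inter> V. 1)"
    using N_subset by (simp add: sum_distrib_left Int_absorb2)
  also have "(\<Sum>u\<in>big. \<Sum>v\<in>N u \<inter> V. 1) = (\<Sum>v\<in>V. \<Sum>u\<in>N v \<inter> big. 1::real)"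
    by (rule sum_N_swap) (auto simp: big_def)
  also have "\<dots> \<le> (\<Sum>v\<in>V. 192 * real t ^ 2)"
    by (rule sum_mono) (use nb in auto)
  also have "24 * real t * \<dots> = (4608 * real t ^ 3) * n"
    by (simp add: n_def power2_eq_square power3_eq_cube)
  finally show ?thesis using n0 t2 by (simp add: mult_left_mono)
qed

text \<open>The two-walk bound with unit weights. Its main term is \<open>n\<close>, one walk per
  end; the errors \<open>n / 48\<close>, \<open>n / 8\<close>, \<open>n / 24\<close> and
  \<open>n / 16\<close> add up to \<open>n / 4\<close>. Middle vertices in \<open>big\<close> can
  have any degree and are counted separately.\<close>

lemma row_sum_not_big:
  assumes v: "v \<in> V" "v \<notin> big"
  shows "(\<Sum>u\<in>N v. real (card (N u))) \<le> 5 / 4 * n + n * real (card (N v \<inter> big))"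
proof -
  obtain S where S: "finite S" "S \<subseteq> V" "card S \<le> 3 * t" "v \<notin> S"
    "\<And>b. b \<notin> S \<Longrightarrow> b \<noteq> v \<Longrightarrow> card (N b \<inter> N v - S) \<le> 1"
    by (rule hitting_set[OF no_packing[OF v(1)]]) (rule that)
  define B where "B = {w \<in> V - {v}. 3 * t \<le> card (N v \<inter> N w)}"
  have B: "card B < t" unfolding B_def by (rule card_high_codegree[OF no_packing[OF v(1)]])
  have t0: "0 < real t" using t2 by simp
  have d: "real (card (N u)) \<le> n / (24 * real t)" if "u \<in> V" "u \<notin> big" for u
    using that t0 by (auto simp: big_def field_simps)
  have dn: "real (card (N u)) \<le> n" for u
    unfolding n_def using card_mono[OF finite_V N_subset] by simp
  have "(\<Sum>u\<in>N v. real (card (N u))) = (\<Sum>u\<in>N v. \<Sum>w\<in>N u. 1)" by simp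
  also have "\<dots> \<le> real (card (N v)) * 1 + (\<Sum>u\<in>N v \<inter> S. \<Sum>w\<in>N u. 1)
    + (\<Sum>w\<in>B. real (card (N v \<inter> N w)) * 1) + real (3 * t) * (\<Sum>w\<in>S. 1) + (\<Sum>w\<in>V. 1)"
    unfolding B_def by (rule two_walks_bound[where y = "\<lambda>_. 1"]) (use v S in auto)
  also have "\<dots> = card (N v) + (\<Sum>u\<in>N v \<inter> S. real (card (N u)))
    + (\<Sum>w\<in>B. real (card (N v \<inter> N w))) + 3 * real t * real (card S) + n"
    by (simp add: n_def)
  finally have main: "(\<Sum>u\<in>N v. real (card (N u))) \<le> card (N v) + (\<Sum>u\<in>N v \<inter> S. real (card (N u)))
    + (\<Sum>w\<in>B. real (card (N v \<inter> N w))) + 3 * real t * real (card S) + n" .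
  have 1: "real (card (N v)) \<le> n / 48"
  proof -
    have "real (card (N v)) \<le> n / (24 * real t)" using d v by blast
    also have "\<dots> \<le> n / 48" using t2 n_def by (intro divide_left_mono) auto
    finally show ?thesis .
  qed
  have 2: "(\<Sum>u\<in>N v \<inter> S. real (card (N u))) \<le> n / 8 + n * real (card (N v \<inter> big))"
  proof -
    have "(\<Sum>u\<in>N v \<inter> S. real (card (N u))) = (\<Sum>u\<in>N v \<inter> S \<inter> big. real (card (N u))) + (\<Sum>u\<in>N v \<inter> S - big. real (card (N u)))"
      by (rule sum.Int_Diff) simp
    also have "(\<Sum>u\<in>N v \<inter> S - big. real (card (N u))) \<le> real (card (N v \<inter> S - big)) * (n / (24 * real t))"
      by (rule sum_bounded_above) (use d NV in auto)
    also have "\<dots> \<le> real (3 * t) * (n / (24 * real t))"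
    proof (rule mult_right_mono)
      have "card (N v \<inter> S - big) \<le> card S" by (rule card_mono) (use S in auto)
      then show "real (card (N v \<inter> S - big)) \<le> real (3 * t)" using S(3) by linarith
    qed (use n_def t0 in auto)
    also have "\<dots> = n / 8" using t0 by simp
    also have "(\<Sum>u\<in>N v \<inter> S \<inter> big. real (card (N u))) \<le> real (card (N v \<inter> S \<inter> big)) * n"
      by (rule sum_bounded_above) (rule dn)
    also have "\<dots> \<le> real (card (N v \<inter> big)) * n"
      by (intro mult_right_mono of_nat_mono card_mono) (auto simp: n_def)
    finally show ?thesis by (simp add: algebra_simps)
  qed
  have 3: "(\<Sum>w\<in>B. real (card (N v \<inter> N w))) \<le> n / 24"
  proof -
    have "(\<Sum>w\<in>B. real (card (N v \<inter> N w))) \<le> real (card B) * (n / (24 * real t))"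
    proof (rule sum_bounded_above)
      fix w
      have "card (N v \<inter> N w) \<le> card (N v)" by (rule card_mono) auto
      then show "real (card (N v \<inter> N w)) \<le> n / (24 * real t)" using d[OF v] by linarith
    qed
    also have "\<dots> \<le> real t * (n / (24 * real t))"
      using B n_def by (intro mult_right_mono) auto
    also have "\<dots> = n / 24" using t0 by simp
    finally show ?thesis .
  qed
  have 4: "3 * real t * real (card S) \<le> n / 16"
  proof -
    have "3 * real t * real (card S) \<le> 3 * real t * real (3 * t)"
      by (intro mult_left_mono of_nat_mono S(3)) auto
    then show ?thesis using n_ge by (simp add: power2_eq_square)
  qed
  show ?thesis using main 1 2 3 4 n_def by linarith
qed

text \<open>
  This is where \<open>t \<ge> 2\<close> is needed: rows outside \<open>big\<close> have about \<open>n\<close> two-walks, which is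
  smaller than $\lambda^2$ by a constant factor.
\<close>

lemma sum_x_bound: "(\<Sum>v\<in>V. x v) \<le> 294912 * real t ^ 4 * r"
proof -
  let ?s = "\<Sum>v\<in>V. x v" and ?D = "real (card big)"
  have n0: "0 < n" using n_eq r1 by simp
  have s0: "0 \<le> ?s" by (intro sum_nonneg x0)
  have bV: "big \<subseteq> V" by (auto simp: big_def)
  \<comment> \<open>Summing over all starting vertices shifts the weight to the other end: each
    \<open>x w\<close> is multiplied by the number of two-walks from \<open>w\<close>.\<close>
  have "lam\<^sup>2 * ?s = (\<Sum>v\<in>V. \<Sum>u\<in>N v. \<Sum>w\<in>N u. x w)"
    by (simp add: sum_distrib_left eig2)
  also have "\<dots> = (\<Sum>u\<in>V. \<Sum>v\<in>N u. \<Sum>w\<in>N u. x w)" by (rule sum_N_swap_V)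
  also have "\<dots> = (\<Sum>u\<in>V. \<Sum>w\<in>N u. real (card (N u)) * x w)" by (simp add: sum_distrib_left)
  also have "\<dots> = (\<Sum>w\<in>V. \<Sum>u\<in>N w. real (card (N u)) * x w)" by (rule sum_N_swap_V)
  also have "\<dots> = (\<Sum>w\<in>V. x w * (\<Sum>u\<in>N w. real (card (N u))))"
    by (simp add: sum_distrib_left mult.commute)
  also have "\<dots> \<le> (\<Sum>w\<in>V. x w * (5 / 4 * n + n * real (card (N w \<inter> big))) + (if w \<in> big then 8 * real t * n else 0))"
  proof (rule sum_mono)
    fix w assume w: "w \<in> V"
    show "x w * (\<Sum>u\<in>N w. real (card (N u)))
      \<le> x w * (5 / 4 * n + n * real (card (N w \<inter> big))) + (if w \<in> big then 8 * real t * n else 0)"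
    proof (cases "w \<in> big")
      case True
      have "x w * (\<Sum>u\<in>N w. real (card (N u))) \<le> 1 * (8 * real t * n)"
        by (intro mult_mono x1 two_walks_V w) (auto intro!: sum_nonneg)
      moreover have "0 \<le> x w * (5 / 4 * n + n * real (card (N w \<inter> big)))"
        using x0[of w] n0 by (intro mult_nonneg_nonneg) auto
      ultimately show ?thesis using True by simp
    next
      case False
      then show ?thesis using row_sum_not_big[OF w False] x0[of w] by (simp add: mult_left_mono)
    qed
  qed
  also have "\<dots> = 5 / 4 * n * ?s + n * (\<Sum>w\<in>V. x w * real (card (N w \<inter> big))) + ?D * (8 * real t * n)"
  proof -
    have "(\<Sum>w\<in>V. if w \<in> big then 8 * real t * n else 0) = ?D * (8 * real t * n)"
      by (subst sum.inter_restrict[OF finite_V, symmetric]) (simp add: Int_absorb1 bV)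
    moreover have "(\<Sum>w\<in>V. x w * (5 / 4 * n + n * real (card (N w \<inter> big))))
        = (\<Sum>w\<in>V. 5 / 4 * n * x w + n * (x w * real (card (N w \<inter> big))))"
      by (intro sum.cong refl) (simp add: algebra_simps)
    moreover have "\<dots> = 5 / 4 * n * ?s + n * (\<Sum>w\<in>V. x w * real (card (N w \<inter> big)))"
      by (simp only: sum.distrib sum_distrib_left)
    ultimately show ?thesis by (simp add: sum.distrib)
  qed
  also have "(\<Sum>w\<in>V. x w * real (card (N w \<inter> big))) \<le> ?D * lam"
  proof -
    have "(\<Sum>w\<in>V. x w * real (card (N w \<inter> big))) = (\<Sum>w\<in>V. \<Sum>u\<in>N w \<inter> big. x w)"
      by (simp add: mult.commute)
    also have "\<dots> = (\<Sum>u\<in>big. \<Sum>w\<in>N u \<inter> V. x w)" by (rule sum_N_swap) (use bV in auto)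
    also have "\<dots> = (\<Sum>u\<in>big. lam * x u)"
      using bV N_subset by (intro sum.cong refl) (auto simp: Int_absorb2 eig)
    also have "\<dots> \<le> (\<Sum>u\<in>big. lam * 1)"
      using bV lam0 by (intro sum_mono mult_left_mono x1) auto
    finally show ?thesis by simp
  qed
  finally have "lam\<^sup>2 * ?s \<le> 5 / 4 * n * ?s + n * (?D * lam) + ?D * (8 * real t * n)"
    using n0 by simp
  moreover have "3 / 2 * n * ?s \<le> lam\<^sup>2 * ?s" by (rule mult_right_mono[OF lam_lower(1) s0])
  \<comment> \<open>The difference \<open>3 / 2 - 5 / 4\<close> is the source of the factor
    \<open>4\<close>.\<close>
  ultimately have "n * ?s \<le> n * (4 * ?D * (lam + 8 * real t))" by (simp add: algebra_simps)
  then have "?s \<le> 4 * ?D * (lam + 8 * real t)" using n0 by simp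
  also have "\<dots> \<le> 4 * (4608 * real t ^ 3) * (8 * real t * r + 8 * real t * r)"
  proof (intro mult_mono[of "4 * ?D" "4 * (4608 * real t ^ 3)"] add_mono lam_upper)
    show "4 * ?D \<le> 4 * (4608 * real t ^ 3)" using card_big by simp
    show "8 * real t \<le> 8 * real t * r" using r1 by (simp add: mult_le_cancel_left1)
  qed (use lam0 r1 in auto)
  also have "\<dots> = 294912 * real t ^ 4 * r" by (simp add: power3_eq_cube power4_eq_xxxx)
  finally show ?thesis .
qed

section \<open>The core\<close>

abbreviation K where "K \<equiv> defect_const t"

definition core :: "'a set" where
  "core = insert z {w \<in> V - {z}. 3 * t \<le> card (N z \<inter> N w)}"

text \<open>The degree of \<open>z\<close> and the weighted codegrees of the at most
  \<open>t - 1\<close> vertices of \<open>B\<close> are each at most \<open>n\<close> but add up to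
  at least \<open>t * n - K * r\<close>. So there are exactly \<open>t\<close> terms, each at least
  \<open>n - K * r\<close>. For a vertex of \<open>B\<close> the term is a codegree times an entry,
  so neither factor can be small.\<close>

lemma core_props:
  assumes big_r: "16 * real t * K \<le> r"
  shows "core \<subseteq> V" "z \<in> core" "card core = t" "\<And>l. l \<in> core \<Longrightarrow> 1 / 2 \<le> x l"
    "\<And>l. l \<in> core \<Longrightarrow> n - K * r \<le> real (card (N l))"
proof -
  define B where "B = {w \<in> V - {z}. 3 * t \<le> card (N z \<inter> N w)}"
  have core: "core = insert z B" by (simp add: core_def B_def)
  have B: "card B < t" unfolding B_def by (rule card_high_codegree[OF no_packing[OF z(1)]])
  have fB: "finite B" "z \<notin> B" "B \<subseteq> V" using finite_V by (auto simp: B_def)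
  obtain S where S: "finite S" "S \<subseteq> V" "card S \<le> 3 * t" "z \<notin> S"
    "\<And>b. b \<notin> S \<Longrightarrow> b \<noteq> z \<Longrightarrow> card (N b \<inter> N z - S) \<le> 1"
    by (rule hitting_set[OF no_packing[OF z(1)]]) (rule that)
  have n0: "0 < n" using n_eq r1 by simp
  have t0: "2 \<le> real t" using t2 by simp
  have K0: "0 < K" unfolding defect_const_def using t0 by (intro add_pos_pos) auto
  have Kr: "2 * (K * r) \<le> n"
  proof -
    have "2 * K \<le> 16 * real t * K" using t0 K0 by (intro mult_right_mono) auto
    then have "2 * K \<le> r" using big_r by linarith
    then have "2 * K * r \<le> r * r" using r1 by (intro mult_right_mono) auto
    then show ?thesis by (simp add: n_eq)
  qed
  have "lam\<^sup>2 = (\<Sum>u\<in>N z. \<Sum>w\<in>N u. x w)" using eig2[OF z(1)] z(2) by simp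
  also have "\<dots> \<le> card (N z) * x z + (\<Sum>u\<in>N z \<inter> S. \<Sum>w\<in>N u. x w)
    + (\<Sum>w\<in>B. card (N z \<inter> N w) * x w) + 3 * t * (\<Sum>w\<in>S. x w) + (\<Sum>w\<in>V. x w)"
    unfolding B_def by (rule two_walks_bound[OF x0]) (use z S in auto)
  also have "(\<Sum>u\<in>N z \<inter> S. \<Sum>w\<in>N u. x w) \<le> 24 * real t ^ 2 * r"
  proof -
    have "(\<Sum>u\<in>N z \<inter> S. \<Sum>w\<in>N u. x w) \<le> real (card (N z \<inter> S)) * lam"
    proof (rule sum_bounded_above)
      fix u assume "u \<in> N z \<inter> S"
      then have u: "u \<in> V" using NV by blast
      show "(\<Sum>w\<in>N u. x w) \<le> lam"
        unfolding eig[OF u] using mult_left_mono[OF x1[OF u] lam0] by simp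
    qed
    also have "\<dots> \<le> real (3 * t) * (8 * real t * r)"
    proof (intro mult_mono lam_upper)
      have "card (N z \<inter> S) \<le> card S" by (rule card_mono) (use S in auto)
      then show "real (card (N z \<inter> S)) \<le> real (3 * t)" using S(3) by linarith
    qed (use lam0 in auto)
    finally show ?thesis by (simp add: power2_eq_square)
  qed
  also have "3 * t * (\<Sum>w\<in>S. x w) \<le> 9 * real t ^ 2"
  proof -
    have "(\<Sum>w\<in>S. x w) \<le> real (card S) * 1" by (rule sum_bounded_above) (use S x1 in auto)
    also have "\<dots> \<le> real (3 * t)" using S(3) by linarith
    finally have "3 * real t * (\<Sum>w\<in>S. x w) \<le> 3 * real t * real (3 * t)"
      by (intro mult_left_mono) auto
    then show ?thesis by (simp add: power2_eq_square)
  qed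
  finally have "lam\<^sup>2 \<le> card (N z) + 24 * real t ^ 2 * r + (\<Sum>w\<in>B. card (N z \<inter> N w) * x w)
      + 9 * real t ^ 2 + 294912 * real t ^ 4 * r"
    using sum_x_bound z(2) by simp
  moreover have "10 * real t ^ 2 \<le> 10 * real t ^ 2 * r" using r1 by (simp add: mult_le_cancel_left1)
  ultimately have main: "real t * n - K * r \<le> card (N z) + (\<Sum>w\<in>B. card (N z \<inter> N w) * x w)"
    using lam_lower2 by (simp add: defect_const_def algebra_simps)
  have dn: "real (card (N u)) \<le> n" for u
    unfolding n_def using card_mono[OF finite_V N_subset] by simp
  have cn: "real (card (N z \<inter> N w)) \<le> real (card (N w))" for w
    by (intro of_nat_mono card_mono) auto
  have term_le: "card (N z \<inter> N w) * x w \<le> n" if "w \<in> V" for w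
  proof -
    have "real (card (N z \<inter> N w)) * x w \<le> n * 1"
      by (intro mult_mono x1 that x0) (use cn[of w] dn[of w] n0 in auto)
    then show ?thesis by simp
  qed
  have sumB: "(\<Sum>w\<in>C. card (N z \<inter> N w) * x w) \<le> real (card C) * n" if "C \<subseteq> B" for C
    by (rule sum_bounded_above) (use that fB term_le in blast)
  have cB: "Suc (card B) = t"
  proof (rule ccontr)
    assume "Suc (card B) \<noteq> t"
    then have "card B + 2 \<le> t" using B by simp
    then have "real (card B) + 2 \<le> real t" by linarith
    then have "(real (card B) + 2) * n \<le> real t * n" using n0 by (intro mult_right_mono) auto
    then have "2 * n \<le> n + K * r" using main dn[of z] sumB[of B] by (simp add: algebra_simps)
    then show False using Kr n0 by linarith
  qed
  then have tB: "real t = real (card B) + 1" by linarith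
  have BL: "n - K * r \<le> card (N z \<inter> N w) * x w" if w: "w \<in> B" for w
  proof -
    have "(\<Sum>w\<in>B. card (N z \<inter> N w) * x w) = card (N z \<inter> N w) * x w + (\<Sum>w\<in>B - {w}. card (N z \<inter> N w) * x w)"
      by (rule sum.remove) (use fB w in auto)
    also have "(\<Sum>w\<in>B - {w}. card (N z \<inter> N w) * x w) \<le> real (card (B - {w})) * n"
      by (rule sumB) auto
    also have "real (card (B - {w})) = real (card B) - 1"
      using w fB card_Suc_Diff1[of B w] by (simp add: algebra_simps)
    finally have "real t * n - K * r \<le> n + (card (N z \<inter> N w) * x w + (real (card B) - 1) * n)"
      using main dn[of z] by linarith
    then show ?thesis by (simp add: tB algebra_simps)
  qed
  show "core \<subseteq> V" "z \<in> core" using core fB z by auto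
  show "card core = t" using core fB cB by simp
  fix l assume l: "l \<in> core"
  show "1 / 2 \<le> x l"
  proof (cases "l = z")
    case False
    then have "n - K * r \<le> card (N z \<inter> N l) * x l" using l core BL by auto
    also have "\<dots> \<le> n * x l" using cn[of l] dn[of l] x0 by (intro mult_right_mono) auto
    finally have "n * (1 / 2) \<le> n * x l" using Kr by linarith
    then show ?thesis using n0 by (simp only: mult_le_cancel_left_pos)
  qed (use z in simp)
  show "n - K * r \<le> real (card (N l))"
  proof (cases "l = z")
    case True
    show ?thesis using main sumB[of B] unfolding True by (simp add: tB algebra_simps)
  next
    case False
    then have lB: "l \<in> B" using l core by auto
    then have "n - K * r \<le> card (N z \<inter> N l) * x l" by (rule BL)
    also have "\<dots> \<le> real (card (N z \<inter> N l)) * 1" using lB fB x1 by (intro mult_left_mono) auto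
    finally show ?thesis using cn[of l] by linarith
  qed
qed

text \<open>By their degrees any two core vertices share at least \<open>n - 2 * (K * r)\<close>
  neighbours, so \<open>core_codegree\<close> applies around each core vertex \<open>l\<close> and
  not just around \<open>z\<close>.\<close>

lemma core_codeg:
  assumes big_r: "16 * real t * K \<le> r" and b: "b \<in> V - core" and l: "l \<in> core"
  shows "card (N b \<inter> N l - core) \<le> 1"
proof -
  note C = core_props[OF big_r]
  have t0: "2 \<le> real t" using t2 by simp
  have K1: "1 \<le> K"
  proof -
    have "1 \<le> real t ^ 2" using t0 by (simp add: one_le_power)
    moreover have "0 \<le> real t ^ 4" by simp
    ultimately show ?thesis unfolding defect_const_def by linarith
  qed
  have fin: "finite core" using C(1) finite_V finite_subset by blast
  have cod: "3 * t \<le> card (N l \<inter> N w)" if w: "w \<in> core" for w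
  proof -
    have "card (N l \<union> N w) \<le> card V" by (intro card_mono finite_V) (use N_subset in auto)
    moreover have "card (N l) + card (N w) = card (N l \<union> N w) + card (N l \<inter> N w)"
      by (rule card_Un_Int) auto
    ultimately have "real (card (N l)) + real (card (N w)) \<le> n + real (card (N l \<inter> N w))"
      unfolding n_def by linarith
    then have "n - 2 * (K * r) \<le> real (card (N l \<inter> N w))" using C(5)[OF l] C(5)[OF w] by linarith
    moreover have "3 * real t + 2 * (K * r) \<le> n"
    proof -
      have "3 * real t * 1 \<le> 3 * real t * (K * r)"
        using K1 r1 t0 mult_mono[of 1 K 1 r] by (intro mult_left_mono) auto
      moreover have "2 * (K * r) \<le> real t * (K * r)" using t0 K1 r1 by (intro mult_right_mono) auto
      moreover have "16 * real t * K * r \<le> r * r" using big_r r1 by (intro mult_right_mono) auto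
      moreover have "0 \<le> real t * (K * r)" using K1 r1 by auto
      ultimately show ?thesis by (simp add: n_eq algebra_simps)
    qed
    ultimately show ?thesis by linarith
  qed
  have "card (N b \<inter> N l - (core - {l})) \<le> 1"
  proof (rule core_codegree[of l t])
    show "\<not> packing l t S" for S using no_packing C(1) l by blast
    show "t = Suc (card (core - {l}))" using card_Suc_Diff1[OF fin l] C(3) by (simp only:)
  qed (use b l fin cod in auto)
  moreover have "card (N b \<inter> N l - core) \<le> card (N b \<inter> N l - (core - {l}))"
    by (intro card_mono) auto
  ultimately show ?thesis by linarith
qed

section \<open>Entries outside the core\<close>

definition far :: "'a set" where "far = {u \<in> V - core. N u \<inter> core = {}}"

abbreviation K4 where "K4 \<equiv> far_const t"
abbreviation K5 where "K5 \<equiv> outside_const t"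

lemma card_far:
  assumes big_r: "16 * real t * K \<le> r"
  shows "real (card far) \<le> K * r"
proof -
  note C = core_props[OF big_r]
  have "far \<subseteq> V - N z" using C(2) N_sym by (auto simp: far_def)
  then have "card far \<le> card (V - N z)" by (intro card_mono) (use finite_V in auto)
  also have "card (V - N z) = card V - card (N z)" by (intro card_Diff_subset N_subset) simp
  finally have "real (card far) \<le> n - real (card (N z))"
    unfolding n_def using card_mono[OF finite_V N_subset[of z]] by linarith
  then show ?thesis using C(5)[OF C(2)] by linarith
qed

text \<open>Each of these neighbours of \<open>b\<close> is adjacent to some core vertex, and every
  core vertex accounts for at most one of them.\<close>

lemma card_near:
  assumes big_r: "16 * real t * K \<le> r" and b: "b \<in> V - core"
  shows "card (N b - core - far) \<le> t"
proof -
  note C = core_props[OF big_r]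
  have fin: "finite core" using C(1) finite_V finite_subset by blast
  have "N b - core - far \<subseteq> (\<Union>l\<in>core. N b \<inter> N l - core)"
    using N_subset N_sym by (fastforce simp: far_def)
  then have "card (N b - core - far) \<le> card (\<Union>l\<in>core. N b \<inter> N l - core)"
    by (intro card_mono) (use fin in auto)
  also have "\<dots> \<le> (\<Sum>l\<in>core. card (N b \<inter> N l - core))" by (rule card_UN_le[OF fin])
  also have "\<dots> \<le> (\<Sum>l\<in>core. 1)" by (intro sum_mono core_codeg[OF big_r b])
  finally show ?thesis using C(3) by simp
qed

text \<open>At a largest entry in \<open>far\<close>, \<open>lam\<^sup>2 * x w0\<close> is expanded
  over two steps. Walks staying in \<open>far\<close> contribute at most
  \<open>x w0 * (n / 2)\<close>, which the left side absorbs; a step out of \<open>far\<close> leads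
  to at most \<open>t\<close> vertices, of entry at most \<open>mu\<close>. The parameter
  \<open>mu\<close> allows the estimate to be improved by repetition.\<close>

lemma far_bound:
  assumes big_r: "16 * real t * K \<le> r" and mu: "\<And>u. u \<in> V - core \<Longrightarrow> x u \<le> mu" and mu0: "0 \<le> mu"
    and w: "w \<in> far"
  shows "x w \<le> K4 * mu / r"
proof -
  let ?p = "real (card far)"
  have p: "?p \<le> K * r" by (rule card_far[OF big_r])
  have ff: "finite far" using finite_V by (simp add: far_def)
  have n0: "0 < n" using n_eq r1 by simp
  have "Max (x ` far) \<in> x ` far" by (rule Max_in) (use ff w in auto)
  then obtain w0 where w0': "w0 \<in> far" "Max (x ` far) = x w0" by (elim imageE) (rule that)
  have w0: "w0 \<in> far" "\<And>u. u \<in> far \<Longrightarrow> x u \<le> x w0"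
    using w0' ff by (auto simp: w0'(2)[symmetric])
  have farV: "far \<subseteq> V - core" "far \<subseteq> V" by (auto simp: far_def)
  have w0V: "w0 \<in> V - core" "w0 \<in> V" using w0 farV by auto
  have near: "(\<Sum>y\<in>N u - far. x y) \<le> real t * mu" if u: "u \<in> far" for u
  proof -
    have eq: "N u - far = N u - core - far" using u by (auto simp: far_def)
    have "(\<Sum>y\<in>N u - core - far. x y) \<le> real (card (N u - core - far)) * mu"
      by (rule sum_bounded_above) (use mu NV in auto)
    also have "\<dots> \<le> real t * mu"
      using card_near[OF big_r, of u] u farV mu0 by (intro mult_right_mono) auto
    finally show ?thesis unfolding eq .
  qed
  have "lam\<^sup>2 * x w0 = lam * (\<Sum>u\<in>N w0. x u)" using eig[OF w0V(2)] by (simp add: power2_eq_square)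
  also have "(\<Sum>u\<in>N w0. x u) = (\<Sum>u\<in>N w0 \<inter> far. x u) + (\<Sum>u\<in>N w0 - far. x u)"
    by (rule sum.Int_Diff) simp
  also have "lam * \<dots> \<le> lam * (\<Sum>u\<in>N w0 \<inter> far. x u) + 8 * real t * r * (real t * mu)"
  proof -
    have "lam * (\<Sum>u\<in>N w0 - far. x u) \<le> 8 * real t * r * (real t * mu)"
      by (intro mult_mono near w0 lam_upper) (use r1 in \<open>auto intro!: sum_nonneg x0\<close>)
    then show ?thesis by (simp add: distrib_left)
  qed
  also have "lam * (\<Sum>u\<in>N w0 \<inter> far. x u) = (\<Sum>u\<in>N w0 \<inter> far. \<Sum>y\<in>N u. x y)"
    unfolding sum_distrib_left using farV by (intro sum.cong refl) (auto simp: eig)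
  also have "\<dots> \<le> (\<Sum>u\<in>N w0 \<inter> far. x w0 * real (card (N u \<inter> far)) + real t * mu)"
  proof (rule sum_mono)
    fix u assume u: "u \<in> N w0 \<inter> far"
    have "(\<Sum>y\<in>N u. x y) = (\<Sum>y\<in>N u \<inter> far. x y) + (\<Sum>y\<in>N u - far. x y)"
      by (rule sum.Int_Diff) simp
    also have "(\<Sum>y\<in>N u \<inter> far. x y) \<le> real (card (N u \<inter> far)) * x w0"
      by (rule sum_bounded_above) (use w0 in auto)
    also have "(\<Sum>y\<in>N u - far. x y) \<le> real t * mu" using near u by blast
    finally show "(\<Sum>y\<in>N u. x y) \<le> x w0 * real (card (N u \<inter> far)) + real t * mu"
      by (simp add: mult.commute)
  qed
  also have "\<dots> = x w0 * (\<Sum>u\<in>N w0 \<inter> far. real (card (N u \<inter> far))) + real (card (N w0 \<inter> far)) * (real t * mu)"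
    by (simp add: sum.distrib sum_distrib_left)
  also have "\<dots> \<le> x w0 * (8 * real t * ?p) + ?p * (real t * mu)"
    by (intro add_mono mult_left_mono mult_right_mono two_walks w0V farV x0 of_nat_mono card_mono ff)
      (use mu0 in auto)
  also have "\<dots> \<le> x w0 * (n / 2) + K * r * (real t * mu)"
  proof (intro add_mono mult_left_mono mult_right_mono p x0)
    have "8 * real t * ?p \<le> 8 * real t * (K * r)" by (intro mult_left_mono p) auto
    moreover have "16 * real t * K * r \<le> r * r" using big_r r1 by (intro mult_right_mono) auto
    ultimately show "8 * real t * ?p \<le> n / 2" by (simp add: n_eq algebra_simps)
  qed (use mu0 in auto)
  finally have "lam\<^sup>2 * x w0 \<le> x w0 * (n / 2) + K4 * mu * r"
    by (simp add: far_const_def algebra_simps)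
  moreover have "3 / 2 * n * x w0 \<le> lam\<^sup>2 * x w0" by (intro mult_right_mono lam_lower x0)
  ultimately have "r * (r * x w0) \<le> r * (K4 * mu)" by (simp add: n_eq algebra_simps)
  then have "r * x w0 \<le> K4 * mu" using r1 by (simp only: mult_le_cancel_left_pos)
  then have "x w0 \<le> K4 * mu / r" using r1 by (simp add: field_simps)
  then show ?thesis using w0(2)[OF w] by linarith
qed

text \<open>There may be of order \<open>r\<close> neighbours in \<open>far\<close>, but their
  entries are of order \<open>mu / r\<close>. Together they cost a constant multiple of
  \<open>mu\<close>, as do the at most \<open>t\<close> other neighbours outside the core.\<close>

lemma outside_core_sum:
  assumes big_r: "16 * real t * K \<le> r" and mu: "\<And>u. u \<in> V - core \<Longrightarrow> x u \<le> mu" and mu0: "0 \<le> mu"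
    and u: "u \<in> V - core"
  shows "(\<Sum>v\<in>N u - core. x v) \<le> K5 * mu"
proof -
  have t0: "2 \<le> real t" using t2 by simp
  have K0: "0 \<le> K" "0 \<le> K4" unfolding defect_const_def far_const_def by auto
  have eq: "(N u - core) \<inter> far = N u \<inter> far" by (auto simp: far_def)
  have "(\<Sum>v\<in>N u - core. x v) = (\<Sum>v\<in>N u \<inter> far. x v) + (\<Sum>v\<in>N u - core - far. x v)"
    using sum.Int_Diff[of "N u - core" x far] eq by simp
  also have "(\<Sum>v\<in>N u \<inter> far. x v) \<le> real (card (N u \<inter> far)) * (K4 * mu / r)"
    by (rule sum_bounded_above) (use far_bound[OF big_r mu mu0] in auto)
  also have "\<dots> \<le> (K * r) * (K4 * mu / r)"
  proof (rule mult_right_mono)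
    have "card (N u \<inter> far) \<le> card far" by (rule card_mono) (use finite_V in \<open>auto simp: far_def\<close>)
    then show "real (card (N u \<inter> far)) \<le> K * r" using card_far[OF big_r] by linarith
  qed (use K0 mu0 r1 in auto)
  also have "\<dots> = K * K4 * mu" using r1 by simp
  also have "(\<Sum>v\<in>N u - core - far. x v) \<le> real (card (N u - core - far)) * mu"
    by (rule sum_bounded_above) (use mu NV in auto)
  also have "\<dots> \<le> real t * mu"
    using card_near[OF big_r u] mu0 by (intro mult_right_mono) auto
  finally show ?thesis by (simp add: outside_const_def algebra_simps)
qed

text \<open>Two rounds: \<open>mu = 1\<close> gives the bound \<open>(t + K5) / r\<close> for every
  entry outside the core, and this bound as the new \<open>mu\<close> gives a sum of order
  \<open>1 / r\<close>.\<close>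

lemma outside_core_small:
  assumes big_r: "16 * real t * K \<le> r" "2 * K5 * (real t + K5) \<le> r"
    and u: "u \<in> V - core"
  shows "(\<Sum>v\<in>N u - core. x v) \<le> 1 / 2"
proof -
  note C = core_props[OF big_r(1)]
  have K0: "0 \<le> K5" unfolding outside_const_def far_const_def defect_const_def by auto
  have fin: "finite core" using C(1) finite_V finite_subset by blast
  have "x u \<le> (real t + K5) / r" if u: "u \<in> V - core" for u
  proof -
    have "r * x u \<le> lam * x u" by (intro mult_right_mono lam_lower x0)
    also have "\<dots> = (\<Sum>v\<in>N u. x v)" using eig u by auto
    also have "\<dots> = (\<Sum>v\<in>N u \<inter> core. x v) + (\<Sum>v\<in>N u - core. x v)"
      by (rule sum.Int_Diff) simp
    also have "(\<Sum>v\<in>N u \<inter> core. x v) \<le> real (card (N u \<inter> core)) * 1"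
      by (rule sum_bounded_above) (use x1 NV in auto)
    also have "\<dots> \<le> real t" using card_mono[OF fin, of "N u \<inter> core"] C(3) by simp
    also have "(\<Sum>v\<in>N u - core. x v) \<le> K5 * 1"
      by (rule outside_core_sum[OF big_r(1) _ _ u]) (use x1 in auto)
    finally show ?thesis using r1 by (simp add: field_simps)
  qed
  then have "(\<Sum>v\<in>N u - core. x v) \<le> K5 * ((real t + K5) / r)"
    by (rule outside_core_sum[OF big_r(1) _ _ u]) (use K0 r1 in auto)
  also have "\<dots> \<le> 1 / 2" using big_r(2) r1 by (simp add: field_simps)
  finally show ?thesis .
qed

end

section \<open>The friendship theorem\<close>

text \<open>Under a fixed-point-free action of a cyclic group of prime order every orbit has
  \<open>p\<close> elements; the induction removes one orbit at a time.\<close>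

lemma prime_dvd_card_free_action:
  fixes p :: nat
  assumes p: "prime p" and fin: "finite X"
    and inv: "\<And>a. a \<in> X \<Longrightarrow> f a \<in> X" and per: "\<And>a. a \<in> X \<Longrightarrow> (f ^^ p) a = a"
    and free: "\<And>a. a \<in> X \<Longrightarrow> f a \<noteq> a"
  shows "p dvd card X"
  using fin inv per free
proof (induction X rule: finite_psubset_induct)
  case (psubset X)
  show ?case
  proof (cases "X = {}")
    case False
    then obtain a where a: "a \<in> X" by blast
    have iter: "(f ^^ i) b \<in> X" if "b \<in> X" for i b
      using that by (induction i) (auto intro: psubset.prems)
    have periter: "(f ^^ (p * m)) b = b" if "b \<in> X" for m b
      using that by (induction m) (simp_all add: funpow_add psubset.prems)
    have fixed: "(f ^^ (d * m)) b = b" if "b \<in> X" "(f ^^ d) b = b" for d m b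
      using that by (induction m) (simp_all add: funpow_add)
    let ?O = "(\<lambda>i. (f ^^ i) a) ` {..<p}"
    have p0: "0 < p" using p prime_gt_0_nat by blast
    \<comment> \<open>If \<open>f ^^ d\<close> fixes a point for some \<open>d\<close> strictly
      between \<open>0\<close> and \<open>p\<close>, then so does \<open>f\<close>, because a
      multiple of \<open>d\<close> is \<open>1\<close> modulo \<open>p\<close>.\<close>
    have aux: False if ij: "i < j" "j < p" "(f ^^ i) a = (f ^^ j) a" for i j
    proof -
      define d where "d = j - i"
      have d: "0 < d" "d < p" "j = d + i" using ij by (auto simp: d_def)
      let ?b = "(f ^^ i) a"
      have b: "?b \<in> X" by (rule iter[OF a])
      have fd: "(f ^^ d) ?b = ?b" using ij(3) d(3) by (simp add: funpow_add)
      have "\<not> p dvd d" using d by (auto dest: dvd_imp_le)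
      then have "coprime d p" using prime_imp_coprime[OF p, of d] by (simp add: coprime_commute)
      then obtain m where "[d * m = 1] (mod p)" using cong_solve_coprime_nat by auto
      then have m1: "d * m mod p = 1" using p prime_gt_1_nat[of p] by (simp add: cong_def)
      have "?b = (f ^^ (d * m)) ?b" using fixed[OF b fd] by simp
      also have "d * m = 1 + p * (d * m div p)" using m1 mod_mult_div_eq[of "d * m" p] by simp
      also have "(f ^^ (1 + p * (d * m div p))) ?b = f ?b"
        using periter[OF b] by (simp add: funpow_add)
      finally show False using psubset.prems(3)[OF b] by simp
    qed
    have inj: "inj_on (\<lambda>i. (f ^^ i) a) {..<p}"
    proof (rule inj_onI)
      fix i j assume "i \<in> {..<p}" "j \<in> {..<p}" "(f ^^ i) a = (f ^^ j) a"
      then show "i = j" using aux[of i j] aux[of j i] by (cases i j rule: linorder_cases) auto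
    qed
    have cO: "card ?O = p" using card_image[OF inj] by simp
    have OX: "?O \<subseteq> X" using iter[OF a] by auto
    \<comment> \<open>Going forward around the orbit returns to \<open>b\<close>, so the orbit
      contains preimages of its elements and its complement is invariant under
      \<open>f\<close>.\<close>
    have shift: "b \<in> ?O" if b: "b \<in> X" and fb: "f b \<in> ?O" for b
    proof -
      obtain i where i: "f b = (f ^^ i) a" using fb by auto
      have "b = (f ^^ p) b" using psubset.prems(2)[OF b] by simp
      also have "\<dots> = (f ^^ (p - 1)) (f b)" using p0 by (metis Suc_diff_1 funpow_swap1 funpow.simps(2) comp_apply)
      also have "\<dots> = (f ^^ (p - 1 + i)) a" using i by (simp add: funpow_add)
      also have "\<dots> = (f ^^ ((p - 1 + i) mod p)) a"
      proof -
        have "(f ^^ (p - 1 + i)) a = (f ^^ ((p - 1 + i) mod p + p * ((p - 1 + i) div p))) a" by simp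
        also have "\<dots> = (f ^^ ((p - 1 + i) mod p)) a"
          unfolding funpow_add comp_apply periter[OF a] ..
        finally show ?thesis .
      qed
      finally show ?thesis using p0 by simp
    qed
    have "a \<in> ?O" using p0 by (intro image_eqI[of _ _ 0]) simp_all
    then have "X - ?O \<subset> X" using a by blast
    moreover have "f b \<in> X - ?O" if "b \<in> X - ?O" for b
      using that shift[of b] psubset.prems(1)[of b] by blast
    ultimately have "p dvd card (X - ?O)"
      using psubset.IH[of "X - ?O"] psubset.prems by simp
    moreover have "card X = card (X - ?O) + p"
      using card_Diff_subset[OF _ OX] card_mono[OF psubset.hyps OX] cO by simp
    ultimately show ?thesis by simp
  qed simp
qed

section \<open>Closed walks and friendship graphs\<close>

context simple_graph
begin

text \<open>The lists in \<open>walks m u v\<close> omit the starting vertex \<open>u\<close> and end with \<open>v\<close>.\<close>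

fun walks :: "nat \<Rightarrow> 'a \<Rightarrow> 'a \<Rightarrow> 'a list set" where
  "walks 0 u v = (if u = v then {[]} else {})"
| "walks (Suc m) u v = (\<Union>w\<in>N u. (#) w ` walks m w v)"

lemma walks_props: "finite (walks m u v) \<and> (\<forall>xs\<in>walks m u v. length xs = m \<and> last (u # xs) = v)"
  by (induction m arbitrary: u) auto

lemma card_walks_Suc: "card (walks (Suc m) u v) = (\<Sum>w\<in>N u. card (walks m w v))"
proof -
  have "card (\<Union>w\<in>N u. (#) w ` walks m w v) = (\<Sum>w\<in>N u. card ((#) w ` walks m w v))"
    by (rule card_UN_disjoint) (use walks_props in auto)
  also have "\<dots> = (\<Sum>w\<in>N u. card (walks m w v))" by (simp add: card_image)
  finally show ?thesis by simp
qed

lemma mem_walks_iff: "xs \<in> walks m u v \<longleftrightarrow>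
    length xs = m \<and> last (u # xs) = v \<and> (\<forall>i<m. xs ! i \<in> N ((u # xs) ! i))"
proof (induction m arbitrary: u xs)
  case (Suc m)
  show ?case
  proof (cases xs)
    case (Cons w ys)
    have "xs \<in> walks (Suc m) u v \<longleftrightarrow> w \<in> N u \<and> ys \<in> walks m w v"
      using Cons by auto
    then show ?thesis using Suc.IH[of ys w] Cons by (auto simp: All_less_Suc2)
  qed auto
qed auto

text \<open>Closed walks of length \<open>p\<close> are permuted freely by rotation, as there are no loops.\<close>

lemma prime_dvd_closed_walks:
  assumes p: "prime p"
  shows "p dvd (\<Sum>u\<in>V. card (walks p u u))"
proof -
  let ?X = "\<Union>u\<in>V. walks p u u"
  have p0: "0 < p" using p prime_gt_0_nat by blast
  have last: "last (u # xs) = xs ! (p - 1)" if "length xs = p" for u and xs :: "'a list"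
    using that p0 by (auto simp: last_conv_nth)
  \<comment> \<open>Cyclic indexing treats all positions alike, which makes invariance under
    rotation visible.\<close>
  have X: "xs \<in> ?X \<longleftrightarrow> length xs = p \<and> (\<forall>i<p. xs ! (Suc i mod p) \<in> N (xs ! i))" for xs
  proof
    assume "xs \<in> ?X"
    then obtain u where u: "length xs = p" "last (u # xs) = u" "\<forall>i<p. xs ! i \<in> N ((u # xs) ! i)"
      unfolding UN_iff mem_walks_iff by blast
    have ul: "u = xs ! (p - 1)" using u(2) last[OF u(1)] by simp
    have "xs ! (Suc i mod p) \<in> N (xs ! i)" if i: "i < p" for i
    proof (cases "Suc i = p")
      case True
      then have "xs ! i = u" using ul by auto
      then show ?thesis using u(3) p0 True by auto
    next
      case False
      then show ?thesis using u(3)[rule_format, of "Suc i"] i by simp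
    qed
    then show "length xs = p \<and> (\<forall>i<p. xs ! (Suc i mod p) \<in> N (xs ! i))" using u by simp
  next
    assume h: "length xs = p \<and> (\<forall>i<p. xs ! (Suc i mod p) \<in> N (xs ! i))"
    let ?u = "xs ! (p - 1)"
    have 0: "xs ! 0 \<in> N ?u" using h[THEN conjunct2, rule_format, of "p - 1"] p0 by simp
    then have "?u \<in> V" using N_sym N_subset by blast
    moreover have "xs ! i \<in> N ((?u # xs) ! i)" if "i < p" for i
    proof (cases i)
      case (Suc j)
      then show ?thesis using h that by (auto dest!: spec[of _ j])
    qed (use 0 in simp)
    ultimately show "xs \<in> ?X" unfolding UN_iff mem_walks_iff using h last by auto
  qed
  have "p dvd card ?X"
  proof (rule prime_dvd_card_free_action[OF p, of _ rotate1])
    show "finite ?X" using walks_props finite_V by blast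
    show "rotate1 xs \<in> ?X" if "xs \<in> ?X" for xs
    proof -
      have h: "length xs = p" "\<And>i. i < p \<Longrightarrow> xs ! (Suc i mod p) \<in> N (xs ! i)" using that unfolding X by auto
      have "rotate1 xs ! (Suc i mod p) \<in> N (rotate1 xs ! i)" if "i < p" for i
        using h(2)[of "Suc i mod p"] that p0 h(1) by (simp add: nth_rotate1 mod_Suc_eq)
      then show ?thesis unfolding X using h(1) by simp
    qed
    show "(rotate1 ^^ p) xs = xs" if "xs \<in> ?X" for xs
      using that unfolding X rotate_def[symmetric] by (metis rotate_length01 rotate_id mod_self)
    show "rotate1 xs \<noteq> xs" if "xs \<in> ?X" for xs
    proof
      assume eq: "rotate1 xs = xs"
      have h: "length xs = p" "xs ! (Suc 0 mod p) \<in> N (xs ! 0)" using that p0 unfolding X by auto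
      have "xs ! (Suc 0 mod p) = xs ! 0" using nth_rotate1[of 0 xs] eq h(1) p0 by simp
      then show False using h(2) N_irrefl by simp
    qed
  qed
  also have "card ?X = (\<Sum>u\<in>V. card (walks p u u))"
  proof (rule card_UN_disjoint[OF finite_V])
    show "\<forall>i\<in>V. finite (walks p i i)" using walks_props by blast
    show "\<forall>i\<in>V. \<forall>j\<in>V. i \<noteq> j \<longrightarrow> walks p i i \<inter> walks p j j = {}"
    proof (intro ballI impI equals0I)
      fix i j xs assume "i \<noteq> j" "xs \<in> walks p i i \<inter> walks p j j"
      then show False using last unfolding Int_iff mem_walks_iff by metis
    qed
  qed
  finally show ?thesis .
qed

text \<open>Non-adjacent \<open>u\<close> and \<open>v\<close> have equal degree: sending a
  neighbour \<open>w\<close> of \<open>u\<close> to the common neighbour of \<open>w\<close> and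
  \<open>v\<close> is injective. If adjacent \<open>a\<close> and \<open>b\<close> had different
  degrees, a non-neighbour \<open>c\<close> of \<open>a\<close> would be adjacent to
  \<open>b\<close>, hence not to the common neighbour \<open>y\<close> of \<open>a\<close> and
  \<open>b\<close>; so \<open>y\<close> would have the degree of \<open>a\<close> and, by symmetry,
  that of \<open>b\<close>.\<close>

lemma friendship_regular:
  assumes friend: "\<And>u v. u \<in> V \<Longrightarrow> v \<in> V \<Longrightarrow> u \<noteq> v \<Longrightarrow> card (N u \<inter> N v) = 1"
    and no_univ: "\<And>v. v \<in> V \<Longrightarrow> N v \<noteq> V - {v}" and a: "a \<in> V" and b: "b \<in> V"
  shows "card (N a) = card (N b)"
proof -
  have uniq: "y = y'" if "u \<in> V" "v \<in> V" "u \<noteq> v" "y \<in> N u" "y \<in> N v" "y' \<in> N u" "y' \<in> N v" for u v y y'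
  proof -
    have "card (N u \<inter> N v) = 1" by (rule friend[OF that(1-3)])
    then obtain c where "N u \<inter> N v = {c}" by (metis card_1_singletonE)
    then show ?thesis using that by (metis IntI singletonD)
  qed
  have common: "\<exists>y. y \<in> N u \<and> y \<in> N v" if "u \<in> V" "v \<in> V" "u \<noteq> v" for u v
    using friend[OF that] by (metis IntD1 IntD2 card_1_singletonE insertI1)
  have NV: "y \<in> V" if "y \<in> N u" for y u using that N_subset by blast
  have le: "card (N u) \<le> card (N v)" if uv: "u \<in> V" "v \<in> V" "u \<noteq> v" "u \<notin> N v" for u v
  proof -
    have "\<forall>w\<in>N u. \<exists>y. y \<in> N w \<and> y \<in> N v"
    proof
      fix w assume w: "w \<in> N u"
      then have "w \<noteq> v" using uv(4) N_sym by blast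
      then show "\<exists>y. y \<in> N w \<and> y \<in> N v" using common[OF NV[OF w] uv(2)] by simp
    qed
    then obtain g where g: "\<forall>w\<in>N u. g w \<in> N w \<and> g w \<in> N v" by (rule bchoice[THEN exE])
    have "inj_on g (N u)"
    proof (rule inj_onI, rule ccontr)
      fix w w' assume w: "w \<in> N u" "w' \<in> N u" "g w = g w'" "w \<noteq> w'"
      have "u = g w"
        by (rule uniq[OF NV[OF w(1)] NV[OF w(2)] w(4)]) (use w g N_sym in auto)
      then show False using g w uv(4) by auto
    qed
    moreover have "g ` N u \<subseteq> N v" using g by auto
    ultimately show ?thesis by (rule card_inj_on_le) simp
  qed
  have deg: "card (N u) = card (N v)" if "u \<in> V" "v \<in> V" "u \<notin> N v" for u v
    using le[of u v] le[of v u] that N_sym_iff by (metis antisym)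
  show ?thesis
  proof (rule ccontr)
    assume ne: "card (N a) \<noteq> card (N b)"
    then have ab: "a \<noteq> b" "a \<in> N b" "b \<in> N a" using deg[OF a b] N_sym by auto
    obtain y where y: "y \<in> N a" "y \<in> N b" using common[OF a b ab(1)] by blast
    have yV: "y \<in> V" "y \<noteq> a" "y \<noteq> b" using y NV N_irrefl by auto
    have half: "card (N y) = card (N a)"
      if a: "a \<in> V" and b: "b \<in> V" and ab: "a \<in> N b" "b \<in> N a" and y: "y \<in> N a" "y \<in> N b"
        and ne: "card (N a) \<noteq> card (N b)" for a b
    proof -
      obtain c where c: "c \<in> V" "c \<noteq> a" "c \<notin> N a" using no_univ[OF a] N_subset[of a] N_irrefl[of a] by blast
      have dc: "card (N c) = card (N a)" by (rule deg[OF c(1) a c(3)])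
      then have cb: "c \<in> N b" using deg[OF c(1) b] ne by auto
      have "c \<notin> N y"
      proof
        assume "c \<in> N y"
        then have "a = c" by (intro uniq[OF b yV(1)]) (use cb ab y N_sym yV N_irrefl in auto)
        then show False using c by simp
      qed
      then show ?thesis using deg[OF c(1) yV(1)] dc by simp
    qed
    show False using half[OF a b ab(2,3)] half[OF b a ab(3,2)] y ne by simp
  qed
qed

text \<open>Instead of eigenvalue multiplicities, the trace of the \<open>p\<close>-th power of the
  adjacency matrix is computed in two ways modulo a prime divisor \<open>p\<close> of
  \<open>k - 1\<close>: it is \<open>1\<close> by regularity and \<open>0\<close> by rotation of
  closed walks. The degrees \<open>k \<le> 2\<close> are settled by the vertex count.\<close>

lemma friendship:
  assumes friend: "\<And>u v. u \<in> V \<Longrightarrow> v \<in> V \<Longrightarrow> u \<noteq> v \<Longrightarrow> card (N u \<inter> N v) = 1"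
    and n: "2 \<le> card V"
  shows "\<exists>p\<in>V. N p = V - {p}"
proof (rule ccontr)
  assume "\<not> ?thesis"
  then have no_univ: "N v \<noteq> V - {v}" if "v \<in> V" for v using that by blast
  obtain a where a: "a \<in> V" using n by fastforce
  define k where "k = card (N a)"
  have reg: "card (N v) = k" if "v \<in> V" for v
    unfolding k_def by (rule friendship_regular[OF friend no_univ that a])
  have NV: "y \<in> V" if "y \<in> N u" for y u using that N_subset by blast
  have two: "(\<Sum>w\<in>N u. card (walks 1 w v)) = (if u = v then k else 1)" if uv: "u \<in> V" "v \<in> V" for u v
  proof -
    have "card (walks 1 w v) = (if w \<in> N v then 1 else 0)" if "w \<in> N u" for w
    proof -
      have "card (walks (Suc 0) w v) = (\<Sum>y\<in>N w. if y = v then 1 else 0)"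
        unfolding card_walks_Suc by (rule sum.cong) auto
      also have "\<dots> = (if v \<in> N w then 1 else 0)" by simp
      finally show ?thesis using N_sym_iff by simp
    qed
    then have "(\<Sum>w\<in>N u. card (walks 1 w v)) = (\<Sum>w\<in>N u. if w \<in> N v then 1 else 0)" by simp
    also have "\<dots> = card (N u \<inter> N v)" by (simp add: sum.If_cases Int_def)
    finally show ?thesis using reg friend uv by auto
  qed
  have count: "k * k + 1 = k + card V"
  proof -
    have "k * k = (\<Sum>u\<in>N a. card (N u \<inter> V))" using reg NV N_subset by (simp add: k_def Int_absorb2)
    also have "\<dots> = (\<Sum>u\<in>N a. \<Sum>w\<in>N u \<inter> V. 1)" by simp
    also have "\<dots> = (\<Sum>w\<in>V. \<Sum>u\<in>N w \<inter> N a. 1)" by (rule sum_N_swap) (use N_subset in auto)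
    also have "\<dots> = (\<Sum>w\<in>V. card (N w \<inter> N a))" by simp
    also have "\<dots> = card (N a \<inter> N a) + (\<Sum>w\<in>V - {a}. card (N w \<inter> N a))"
      by (rule sum.remove[OF finite_V a])
    also have "(\<Sum>w\<in>V - {a}. card (N w \<inter> N a)) = (\<Sum>w\<in>V - {a}. 1)"
      by (intro sum.cong refl) (use friend a in auto)
    also have "\<dots> = card V - 1" using a finite_V by simp
    finally show ?thesis using n by (simp add: k_def)
  qed
  have "3 \<le> k"
  proof (rule ccontr)
    assume "\<not> 3 \<le> k"
    then consider "k = 0" | "k = 1" | "k = 2" by linarith
    then show False
    proof cases
      case 3
      then have "card (N a) = card (V - {a})" using count a finite_V by (simp add: k_def)
      moreover have "N a \<subseteq> V - {a}" using N_subset N_irrefl by blast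
      ultimately have "N a = V - {a}" using finite_V by (intro card_subset_eq) auto
      then show False using no_univ a by blast
    qed (use count n in auto)
  qed
  then have "k - 1 \<noteq> 1" by simp
  from prime_factor_nat[OF this] obtain p where p: "prime p" "p dvd k - 1" by blast
  \<comment> \<open>Modulo \<open>p\<close>, every two vertices are joined by exactly one walk of each length \<open>\<ge> 2\<close>, so the
    number of closed walks of length \<open>p\<close> is \<open>card V \<equiv> 1\<close>.\<close>
  have k1: "[k = 1] (mod p)"
    using p(2) \<open>3 \<le> k\<close> by (simp add: cong_altdef_nat)
  have walk1: "[card (walks (Suc (Suc m)) u v) = 1] (mod p)" if "u \<in> V" "v \<in> V" for m u v
    using that
  proof (induction m arbitrary: u)
    case 0
    then show ?case using two[of u v] k1 unfolding card_walks_Suc[of "Suc 0"] by simp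
  next
    case (Suc m)
    have "[(\<Sum>w\<in>N u. card (walks (Suc (Suc m)) w v)) = (\<Sum>w\<in>N u. 1)] (mod p)"
      by (rule cong_sum) (use Suc NV in blast)
    also have "(\<Sum>w\<in>N u. 1) = k" using reg Suc.prems by simp
    finally show ?case unfolding card_walks_Suc[of "Suc (Suc m)"] using k1 cong_trans by blast
  qed
  have "[(\<Sum>u\<in>V. card (walks p u u)) = (\<Sum>u\<in>V. 1)] (mod p)"
  proof (rule cong_sum)
    fix u assume u: "u \<in> V"
    have "p = Suc (Suc (p - 2))" using prime_ge_2_nat[OF p(1)] by simp
    then show "[card (walks p u u) = 1] (mod p)" using walk1[OF u u, of "p - 2"] by simp
  qed
  moreover have "p dvd (\<Sum>u\<in>V. card (walks p u u))" by (rule prime_dvd_closed_walks[OF p(1)])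
  ultimately have "p dvd card V" by (simp add: cong_dvd_iff)
  moreover have "card V = k * (k - 1) + 1" using count \<open>3 \<le> k\<close> by (cases k) auto
  ultimately have "p dvd 1" using p(2) by (metis dvd_add_right_iff dvd_mult)
  then show False using p(1) by (simp add: prime_nat_iff)
qed

end

section \<open>Graphs without four-cycles\<close>

locale c4_free = simple_graph V N for V :: "'a set" and N +
  assumes codeg: "b \<noteq> v \<Longrightarrow> card (N b \<inter> N v) \<le> 1"
begin

lemma common_unique: "b \<noteq> v \<Longrightarrow> y \<in> N b \<Longrightarrow> y \<in> N v \<Longrightarrow> w \<in> N b \<Longrightarrow> w \<in> N v \<Longrightarrow> y = w"
  using codeg[of b v] by (auto simp: card_le_Suc0_iff_eq)

text \<open>The vertices sharing no neighbour with \<open>v\<close> are separated by adjacency to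
  \<open>v\<close>: those in \<open>lone1\<close> determine the parity of the degree, those in
  \<open>lone2\<close> are at distance more than two.\<close>

definition lone1 :: "'a \<Rightarrow> 'a set" where "lone1 v = {w \<in> N v. N v \<inter> N w = {}}"
definition lone2 :: "'a \<Rightarrow> 'a set" where "lone2 v = {w \<in> V - {v} - N v. N v \<inter> N w = {}}"

lemma finite_lone: "finite (lone1 v)" "finite (lone2 v)"
  using finite_V by (auto simp: lone1_def lone2_def)

text \<open>Count two-walks from \<open>v\<close> by their end: \<open>card (N v)\<close> of them
  return to \<open>v\<close>, and each other vertex is reached exactly once unless it is
  lone.\<close>

lemma degree_identity:
  assumes v: "v \<in> V"
  shows "(\<Sum>u\<in>N v. card (N u)) + card (lone1 v) + card (lone2 v) + 1 = card (N v) + card V"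
proof -
  have NV: "N u \<inter> V = N u" for u using N_subset by blast
  have "(\<Sum>u\<in>N v. card (N u)) = (\<Sum>u\<in>N v. \<Sum>w\<in>N u \<inter> V. 1)" by (simp add: NV)
  also have "\<dots> = (\<Sum>w\<in>V. \<Sum>u\<in>N w \<inter> N v. 1)" by (rule sum_N_swap) (use N_subset in auto)
  also have "\<dots> = (\<Sum>w\<in>V. card (N w \<inter> N v))" by simp
  also have "\<dots> = card (N v \<inter> N v) + (\<Sum>w\<in>V - {v}. card (N w \<inter> N v))"
    by (rule sum.remove[OF finite_V v])
  finally have 1: "(\<Sum>u\<in>N v. card (N u)) = card (N v) + (\<Sum>w\<in>V - {v}. card (N w \<inter> N v))" by simp
  have un: "lone1 v \<union> lone2 v = {w \<in> V - {v}. N v \<inter> N w = {}}"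
    using N_subset N_irrefl by (auto simp: lone1_def lone2_def)
  have "card (lone1 v) + card (lone2 v) = card (lone1 v \<union> lone2 v)"
    by (rule card_Un_disjoint[symmetric]) (use finite_lone in \<open>auto simp: lone1_def lone2_def\<close>)
  also have "\<dots> = (\<Sum>w\<in>V - {v}. if N v \<inter> N w = {} then 1 else 0)"
    unfolding un using finite_V by (simp add: sum.If_cases Int_def)
  finally have 2: "card (lone1 v) + card (lone2 v) = (\<Sum>w\<in>V - {v}. if N v \<inter> N w = {} then 1 else 0)" .
  have "(\<Sum>w\<in>V - {v}. card (N w \<inter> N v)) + (\<Sum>w\<in>V - {v}. if N v \<inter> N w = {} then 1 else 0) = (\<Sum>w\<in>V - {v}. 1)"
    unfolding sum.distrib[symmetric]
  proof (rule sum.cong[OF refl])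
    fix w assume w: "w \<in> V - {v}"
    have le: "card (N w \<inter> N v) \<le> 1" using codeg w by auto
    show "card (N w \<inter> N v) + (if N v \<inter> N w = {} then 1 else 0) = 1"
    proof (cases "N v \<inter> N w = {}")
      case True
      then show ?thesis by (simp add: Int_commute)
    next
      case False
      then have "card (N w \<inter> N v) \<noteq> 0" by (simp add: Int_commute)
      then have "card (N w \<inter> N v) = 1" using le by linarith
      then show ?thesis using False by simp
    qed
  qed
  also have "\<dots> + 1 = card V" using card_Suc_Diff1[OF finite_V v] by simp
  finally show ?thesis using 1 2 by linarith
qed

text \<open>The edges at \<open>v\<close> that lie in a triangle come in pairs.\<close>

lemma even_degree_minus_lone: "even (card (N v - lone1 v))"
proof -
  define g where "g w = (THE y. y \<in> N v \<and> y \<in> N w)" for w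
  have g: "g w \<in> N v \<and> g w \<in> N w" if w: "w \<in> N v - lone1 v" for w
  proof -
    have ne: "w \<noteq> v" using w N_irrefl by blast
    obtain y where y: "y \<in> N v" "y \<in> N w" using w by (auto simp: lone1_def)
    show ?thesis unfolding g_def
      by (rule theI[of "\<lambda>y. y \<in> N v \<and> y \<in> N w" y]) (use y common_unique[OF ne] in auto)
  qed
  have guniq: "g w = y" if "w \<in> N v - lone1 v" "y \<in> N v" "y \<in> N w" for w y
    by (rule common_unique[of w v]) (use that g[OF that(1)] N_irrefl in auto)
  have inv: "g w \<in> N v - lone1 v" if w: "w \<in> N v - lone1 v" for w
    using g[OF w] w N_sym by (auto simp: lone1_def)
  have "2 dvd card (N v - lone1 v)"
  proof (rule prime_dvd_card_free_action[of 2 _ g])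
    show "g w \<in> N v - lone1 v" if "w \<in> N v - lone1 v" for w by (rule inv[OF that])
    show "(g ^^ 2) w = w" if w: "w \<in> N v - lone1 v" for w
      using guniq[OF inv[OF w], of w] g[OF w] w N_sym by (auto simp: numeral_2_eq_2)
    show "g w \<noteq> w" if w: "w \<in> N v - lone1 v" for w using g[OF w] N_irrefl by metis
  qed (auto simp: two_is_prime_nat)
  then show ?thesis by simp
qed

lemma parity: "even (card (N v) + card (lone1 v))"
proof -
  have "lone1 v \<subseteq> N v" by (auto simp: lone1_def)
  then have "card (N v) = card (N v - lone1 v) + card (lone1 v)"
    by (metis card_Diff_subset card_mono finite_N finite_lone(1) le_add_diff_inverse2)
  then show ?thesis using even_degree_minus_lone[of v] by simp
qed

text \<open>Modulo two every degree may be replaced by the corresponding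
  \<open>card (lone1 u)\<close>; in \<open>degree_identity\<close> the terms for \<open>v\<close>
  then cancel and only the number \<open>1\<close> remains on the other side.\<close>

lemma odd_lone:
  assumes v: "v \<in> V" and n: "even (card V)"
  shows "odd (card (lone2 v) + (\<Sum>u\<in>N v. card (lone1 u)))"
proof -
  have "even ((\<Sum>u\<in>N v. card (N u)) + (\<Sum>u\<in>N v. card (lone1 u)))"
    unfolding sum.distrib[symmetric] using parity by (intro dvd_sum) auto
  moreover have "odd (d + b)" if "even (a + b)" "a + c + d + 1 = e + f" "even (e + c)" "even f"
    for a b c d e f :: nat
    using that by presburger
  ultimately show ?thesis using degree_identity[OF v] parity[of v] n by blast
qed

text \<open>\<open>degree_identity\<close> averaged over an eigenvector: degrees contribute a factor
  \<open>lam\<close>, sums of neighbouring degrees a factor \<open>lam\<^sup>2\<close>.\<close>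

lemma weighted_lone_sum:
  fixes x :: "'a \<Rightarrow> real"
  assumes eig: "\<And>v. v \<in> V \<Longrightarrow> (\<Sum>u\<in>N v. x u) = lam * x v"
  shows "(\<Sum>v\<in>V. x v * (real (card (lone1 v)) + real (card (lone2 v))))
    = (real (card V) - 1 - (lam\<^sup>2 - lam)) * (\<Sum>v\<in>V. x v)"
proof -
  have NV: "u \<in> V" if "u \<in> N v" for u v using that N_subset by blast
  have 1: "(\<Sum>v\<in>V. x v * real (card (N v))) = lam * (\<Sum>v\<in>V. x v)"
  proof -
    have "(\<Sum>v\<in>V. x v * real (card (N v))) = (\<Sum>v\<in>V. \<Sum>u\<in>N v. x v)" by (simp add: mult.commute)
    also have "\<dots> = (\<Sum>u\<in>V. \<Sum>v\<in>N u. x v)" by (rule sum_N_swap_V)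
    finally show ?thesis by (simp add: eig sum_distrib_left)
  qed
  have 2: "(\<Sum>v\<in>V. x v * (\<Sum>u\<in>N v. real (card (N u)))) = lam\<^sup>2 * (\<Sum>v\<in>V. x v)"
  proof -
    have "(\<Sum>v\<in>V. x v * (\<Sum>u\<in>N v. real (card (N u)))) = (\<Sum>v\<in>V. \<Sum>u\<in>N v. x v * real (card (N u)))"
      by (simp add: sum_distrib_left)
    also have "\<dots> = (\<Sum>u\<in>V. \<Sum>v\<in>N u. x v * real (card (N u)))" by (rule sum_N_swap_V)
    also have "\<dots> = (\<Sum>u\<in>V. lam * (x u * real (card (N u))))"
      by (intro sum.cong refl) (simp add: sum_distrib_right[symmetric] eig)
    also have "\<dots> = lam\<^sup>2 * (\<Sum>v\<in>V. x v)"
      unfolding sum_distrib_left[symmetric] 1 by (simp add: power2_eq_square)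
    finally show ?thesis .
  qed
  have "(\<Sum>v\<in>V. x v * (real (card (lone1 v)) + real (card (lone2 v))))
    = (\<Sum>v\<in>V. x v * real (card (N v)) + x v * (real (card V) - 1) - x v * (\<Sum>u\<in>N v. real (card (N u))))"
  proof (rule sum.cong[OF refl])
    fix v assume v: "v \<in> V"
    have "real ((\<Sum>u\<in>N v. card (N u)) + card (lone1 v) + card (lone2 v) + 1) = real (card (N v) + card V)"
      using degree_identity[OF v] by presburger
    then have "real (card (lone1 v)) + real (card (lone2 v))
        = real (card (N v)) + (real (card V) - 1) - (\<Sum>u\<in>N v. real (card (N u)))" by simp
    then show "x v * (real (card (lone1 v)) + real (card (lone2 v)))
        = x v * real (card (N v)) + x v * (real (card V) - 1) - x v * (\<Sum>u\<in>N v. real (card (N u)))"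
      by (simp only: right_diff_distrib distrib_left)
  qed
  also have "\<dots> = lam * (\<Sum>v\<in>V. x v) + (\<Sum>v\<in>V. x v) * (real (card V) - 1) - lam\<^sup>2 * (\<Sum>v\<in>V. x v)"
    by (simp only: sum.distrib sum_subtractf 1 2 sum_distrib_right)
  finally show ?thesis by (simp add: algebra_simps)
qed

text \<open>Positivity spreads along edges, and an empty \<open>lone2 v\<close> puts every vertex
  within distance two of \<open>v\<close>.\<close>

lemma positive_everywhere:
  fixes x :: "'a \<Rightarrow> real"
  assumes x0: "\<And>v. 0 \<le> x v" and eig: "\<And>v. v \<in> V \<Longrightarrow> (\<Sum>u\<in>N v. x u) = lam * x v"
    and lam: "0 < lam" and v: "v \<in> V" "0 < x v" "lone2 v = {}" and w: "w \<in> V"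
  shows "0 < x w"
proof -
  have nb: "0 < x b" if a: "0 < x a" "a \<in> N b" for a b
  proof -
    have b: "b \<in> V" using a N_sym N_subset by blast
    have "x a \<le> (\<Sum>u\<in>N b. x u)" by (rule member_le_sum) (use a x0 in auto)
    then have "0 < lam * x b" using a eig[OF b] by simp
    then show ?thesis using lam by (simp add: zero_less_mult_iff)
  qed
  consider "w = v" | "w \<in> N v" | "w \<noteq> v" "w \<notin> N v" by blast
  then show ?thesis
  proof cases
    case 2
    then show ?thesis using nb[OF v(2)] N_sym by blast
  next
    case 3
    then have "N v \<inter> N w \<noteq> {}" using v(3) w by (auto simp: lone2_def)
    then obtain u where "u \<in> N v" "u \<in> N w" by blast
    then show ?thesis using nb v(2) N_sym by blast
  qed (use v in simp)
qed

text \<open>Without four-cycles the edges that avoid \<open>p\<close> form a matching. At most one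
  vertex is left unmatched, so pairing the leftover vertices adds no edge to the copy.\<close>

lemma windmill_F_copy:
  assumes p: "p \<in> V" "N p = V - {p}"
    and pendant: "\<And>u w. u \<in> V \<Longrightarrow> w \<in> V \<Longrightarrow> N u = {p} \<Longrightarrow> N w = {p} \<Longrightarrow> u = w"
  shows "\<exists>f N'. F_copy V N' (card V) 1 f \<and> (\<forall>v\<in>V. N v = N' v)"
proof -
  have pN: "p \<in> N u" if "u \<in> V - {p}" for u using that p N_sym by blast
  define M where "M u = N u - {p}" for u
  have M1: "v = w" if "u \<in> V - {p}" "v \<in> M u" "w \<in> M u" for u v w
  proof (rule common_unique[of u p])
    show "v \<in> N p" "w \<in> N p" using that p N_subset by (auto simp: M_def)
  qed (use that in \<open>auto simp: M_def\<close>)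
  obtain f N' where F: "F_copy V N' (card V) (card {p}) f"
    and core: "\<And>l. l \<in> {p} \<Longrightarrow> N' l = V - {l}"
    and other: "\<And>u. u \<in> V - {p} \<Longrightarrow> {p} \<subseteq> N' u \<and> M u \<subseteq> N' u \<and> card (N' u - {p}) \<le> 1"
  proof (rule F_copy_exists[OF finite_V, of "{p}" M])
    show "v \<in> V - {p} \<and> u \<in> M v \<and> u \<noteq> v" if "u \<in> V - {p}" "v \<in> M u" for u v
      using that N_subset N_sym N_irrefl by (auto simp: M_def)
    show "v = w" if "u \<in> V - {p}" "v \<in> M u" "w \<in> M u" for u v w by (rule M1[OF that])
  qed (use p in auto)
  interpret F': F_copy V N' "card V" "card {p}" f by (rule F)
  have mate: "v = w" if "u \<in> V - {p}" "v \<in> N' u - {p}" "w \<in> N' u - {p}" for u v w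
    using other[OF that(1)] that by (auto simp: card_le_Suc0_iff_eq)
  have "N u = N' u" if u: "u \<in> V" for u
  proof (cases "u = p")
    case True
    then show ?thesis using p core by simp
  next
    case False
    then have u': "u \<in> V - {p}" using u by blast
    have sub: "N u \<subseteq> N' u" using other[OF u'] by (auto simp: M_def)
    have "v \<in> N u" if v: "v \<in> N' u" for v
    proof (rule ccontr)
      assume nv: "v \<notin> N u"
      then have vp: "v \<noteq> p" using pN[OF u'] by blast
      have v': "v \<in> V - {p}" using v vp F'.N_subset by blast
      have Mu: "M u = {}"
      proof (rule equals0I)
        fix w assume w: "w \<in> M u"
        then have "w \<in> N' u - {p}" using other[OF u'] by (auto simp: M_def)
        then have "w = v" using mate[OF u', of w v] v vp by blast
        then show False using w nv by (simp add: M_def)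
      qed
      have uv: "u \<in> N' v - {p}" using v F'.N_sym False by blast
      have Mv: "M v = {}"
      proof (rule equals0I)
        fix w assume w: "w \<in> M v"
        then have "w \<in> N' v - {p}" using other[OF v'] by (auto simp: M_def)
        then have "w = u" using mate[OF v' _ uv] by blast
        then show False using w nv N_sym by (auto simp: M_def)
      qed
      have "u = v"
        by (rule pendant) (use u v' pN[OF u'] pN[OF v'] Mu Mv in \<open>auto simp: M_def\<close>)
      then show False using v F'.N_irrefl by blast
    qed
    then show ?thesis using sub by blast
  qed
  then show ?thesis using F by (intro exI[of _ f] exI[of _ N']) simp
qed

lemma odd_case:
  fixes x :: "'a \<Rightarrow> real"
  assumes x0: "\<And>v. 0 \<le> x v" and xpos: "v0 \<in> V" "0 < x v0"
    and eig: "\<And>v. v \<in> V \<Longrightarrow> (\<Sum>u\<in>N v. x u) = lam * x v" and lam: "0 < lam"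
    and n: "2 \<le> card V" and ge: "real (card V) - 1 \<le> lam\<^sup>2 - lam"
  shows "\<exists>f N'. F_copy V N' (card V) 1 f \<and> (\<forall>v\<in>V. N v = N' v)"
proof -
  have "(real (card V) - 1 - (lam\<^sup>2 - lam)) * (\<Sum>v\<in>V. x v) \<le> 0"
    using ge by (intro mult_nonpos_nonneg sum_nonneg x0) auto
  then have "(\<Sum>v\<in>V. x v * (real (card (lone1 v)) + real (card (lone2 v)))) \<le> 0"
    using weighted_lone_sum[OF eig] by simp
  then have "(\<Sum>v\<in>V. x v * (real (card (lone1 v)) + real (card (lone2 v)))) = 0"
    by (intro antisym sum_nonneg mult_nonneg_nonneg x0) auto
  then have zero: "x v * (real (card (lone1 v)) + real (card (lone2 v))) = 0" if "v \<in> V" for v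
    using that finite_V x0 by (subst (asm) sum_nonneg_eq_0_iff) auto
  have lone0: "lone1 v = {} \<and> lone2 v = {}" if "v \<in> V" "0 < x v" for v
    using zero[OF that(1)] that(2) finite_lone[of v] by (auto simp: add_nonneg_eq_0_iff)
  have pos: "0 < x w" if "w \<in> V" for w
    by (rule positive_everywhere[OF x0 eig lam xpos _ that]) (use lone0[OF xpos] in auto)
  have lone: "lone1 v = {}" "lone2 v = {}" if "v \<in> V" for v using lone0 pos that by auto
  have "card (N u \<inter> N v) = 1" if uv: "u \<in> V" "v \<in> V" "u \<noteq> v" for u v
  proof -
    have "N u \<inter> N v \<noteq> {}" using lone[OF uv(1)] uv by (auto simp: lone1_def lone2_def)
    then have "card (N u \<inter> N v) \<noteq> 0" by simp
    then show ?thesis using codeg[OF uv(3)] by linarith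
  qed
  then obtain p where p: "p \<in> V" "N p = V - {p}" using friendship[OF _ n] by blast
  show ?thesis
  proof (rule windmill_F_copy[OF p])
    fix u w assume "u \<in> V" "N u = {p}"
    then have "u \<in> lone1 p" using N_sym N_irrefl by (auto simp: lone1_def)
    then show "u = w" using lone(1)[OF p(1)] by blast
  qed
qed

text \<open>Every vertex has exactly one neighbour in \<open>P\<close>. This leaves two adjacent
  vertices \<open>p\<close> and \<open>p'\<close> whose neighbourhoods partition \<open>V\<close>.
  If both had further neighbours, \<open>u\<close> and \<open>w\<close>, then an edge or a common
  neighbour joining \<open>u\<close> and \<open>w\<close> would produce a four-cycle. So one of the
  two is pendant and the other is adjacent to all vertices.\<close>

lemma even_structure:
  assumes V: "V \<noteq> {}" and lone2: "\<And>v. v \<in> V \<Longrightarrow> lone2 v = {}"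
    and one: "\<And>v. v \<in> V \<Longrightarrow> (\<Sum>u\<in>N v. card (lone1 u)) = 1"
  shows "\<exists>f N'. F_copy V N' (card V) 1 f \<and> (\<forall>v\<in>V. N v = N' v)"
proof -
  define P where "P = {v. lone1 v \<noteq> {}}"
  have NV: "u \<in> V" if "u \<in> N v" for u v using that N_subset by blast
  have ex: "\<exists>p. p \<in> N v \<and> p \<in> P" if "v \<in> V" for v
  proof (rule ccontr)
    assume "\<not> ?thesis"
    then have "(\<Sum>u\<in>N v. card (lone1 u)) = 0" by (auto simp: P_def)
    then show False using one[OF that] by simp
  qed
  have uniq: "p = q" if v: "v \<in> V" and p: "p \<in> N v" "p \<in> P" and q: "q \<in> N v" "q \<in> P" for v p q
  proof (rule ccontr)
    assume ne: "p \<noteq> q"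
    have "(\<Sum>u\<in>{p, q}. card (lone1 u)) \<le> (\<Sum>u\<in>N v. card (lone1 u))"
      by (rule sum_mono2) (use p q in auto)
    moreover have "card (lone1 p) \<noteq> 0" "card (lone1 q) \<noteq> 0"
      using p q finite_lone by (auto simp: P_def)
    ultimately show False using one[OF v] ne by simp
  qed
  have card1: "card (lone1 p) \<le> 1" if p: "p \<in> P" "p \<in> N v" for p v
  proof -
    have "card (lone1 p) \<le> (\<Sum>u\<in>N v. card (lone1 u))" by (rule member_le_sum) (use p in auto)
    then show ?thesis using one[of v] NV[of v p] N_sym[OF p(2)] by simp
  qed
  obtain v0 where "v0 \<in> V" using V by blast
  then obtain p where p: "p \<in> P" "p \<in> V" using ex NV by blast
  obtain p' where p': "p' \<in> P" "p' \<in> N p" using ex[OF p(2)] by blast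
  have p'V: "p' \<in> V" "p \<in> N p'" "p \<noteq> p'" using p' NV N_sym N_irrefl by auto
  have Peq: "q = p \<or> q = p'" if q: "q \<in> P" "q \<in> V" for q
  proof (rule ccontr)
    assume ne: "\<not> ?thesis"
    have "q \<notin> N p" using uniq[OF p(2) _ q(1) p'(2,1)] ne by blast
    then have "N p \<inter> N q \<noteq> {}" using lone2[OF p(2)] q ne by (auto simp: lone2_def)
    then obtain y where y: "y \<in> N p" "y \<in> N q" by blast
    then have "p = q" using uniq[of y p q] p q NV N_sym by blast
    then show False using ne by blast
  qed
  have cover: "w \<in> N p \<or> w \<in> N p'" if w: "w \<in> V" for w
    using ex[OF w] Peq NV N_sym by blast
  have excl: "\<not> (w \<in> N p \<and> w \<in> N p')" for w
    using uniq[of w p p'] p p' p'V NV N_sym by blast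
  have finish: "\<exists>f N'. F_copy V N' (card V) 1 f \<and> (\<forall>v\<in>V. N v = N' v)"
    if a: "a \<in> V" "a \<in> P" "b \<in> V" "a \<in> N b" and cov: "\<And>w. w \<in> V \<Longrightarrow> w \<in> N a \<or> w \<in> N b" and Nb: "N b = {a}" for a b
  proof (rule windmill_F_copy)
    show "a \<in> V" by fact
    show "N a = V - {a}" using cov Nb N_subset N_irrefl by blast
    fix u w assume uw: "u \<in> V" "w \<in> V" "N u = {a}" "N w = {a}"
    then have "u \<in> lone1 a" "w \<in> lone1 a" using N_sym N_irrefl by (auto simp: lone1_def)
    moreover have "card (lone1 a) \<le> Suc 0" using card1[OF a(2,4)] by simp
    ultimately show "u = w" using finite_lone(1)[of a] by (simp add: card_le_Suc0_iff_eq)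
  qed
  show ?thesis
  proof (cases "N p' = {p}")
    case True
    then show ?thesis using finish[of p p'] p p'V cover by blast
  next
    case False
    have "N p = {p'}"
    proof (rule ccontr)
      assume "N p \<noteq> {p'}"
      then obtain u where u: "u \<in> N p" "u \<noteq> p'" using p'(2) by blast
      obtain w where w: "w \<in> N p'" "w \<noteq> p" using False p'V by blast
      have uw: "u \<noteq> w" using u w excl by blast
      have u': "u \<notin> N p'" and w': "w \<notin> N p" using u w excl by auto
      have "u \<notin> N w"
        using common_unique[of p w u p'] u w p' N_sym by blast
      then have "w \<notin> N u" using N_sym by blast
      then have "N u \<inter> N w \<noteq> {}" using lone2[OF NV[OF u(1)]] NV[OF w(1)] uw by (auto simp: lone2_def)
      then obtain y where y: "y \<in> N u" "y \<in> N w" by blast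
      have "y \<noteq> p'" using y u' N_sym by blast
      moreover have "y \<noteq> p" using y w' N_sym by blast
      moreover have "y \<in> N p \<or> y \<in> N p'" using cover NV[OF y(1)] by blast
      ultimately show False
        using common_unique[of p w y p'] common_unique[of p' u y p] y u w p' p'V N_sym by metis
    qed
    then show ?thesis using finish[of p' p] p p' p'V cover by blast
  qed
qed

text \<open>
  Every vertex has \<open>1 \<le> card (lone2 v) + (\<Sum>u\<in>N v. card (lone1 u))\<close> by parity. Averaged over the
  eigenvector, this is the reverse of the inequality that \<open>ge\<close> gives for \<open>lone1\<close> and \<open>lone2\<close>, up to a
  factor \<open>lam\<close> in front of the \<open>lone2\<close> term, which therefore vanishes.
\<close>

lemma even_case:
  fixes x :: "'a \<Rightarrow> real"
  assumes x0: "\<And>v. 0 \<le> x v" and xpos: "v0 \<in> V" "0 < x v0"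
    and eig: "\<And>v. v \<in> V \<Longrightarrow> (\<Sum>u\<in>N v. x u) = lam * x v" and lam: "1 < lam"
    and n: "even (card V)" and ge: "real (card V) - 1 - 1 / lam \<le> lam\<^sup>2 - lam"
  shows "\<exists>f N'. F_copy V N' (card V) 1 f \<and> (\<forall>v\<in>V. N v = N' v)"
proof -
  let ?a = "\<lambda>v. real (card (lone1 v))" and ?b = "\<lambda>v. real (card (lone2 v))"
  let ?s = "\<Sum>v\<in>V. x v" and ?A = "\<Sum>v\<in>V. x v * ?a v" and ?B = "\<Sum>v\<in>V. x v * ?b v"
  let ?c = "\<lambda>v. ?b v + (\<Sum>u\<in>N v. ?a u)"
  have s0: "0 \<le> ?s" and B0: "0 \<le> ?B" by (auto intro!: sum_nonneg mult_nonneg_nonneg x0)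
  have "?A + ?B = (real (card V) - 1 - (lam\<^sup>2 - lam)) * ?s"
    using weighted_lone_sum[OF eig] by (simp add: distrib_left sum.distrib)
  also have "\<dots> \<le> (1 / lam) * ?s" using ge by (intro mult_right_mono s0) auto
  finally have "lam * (?A + ?B) \<le> lam * ((1 / lam) * ?s)" using lam by (intro mult_left_mono) auto
  then have up: "lam * ?A + lam * ?B \<le> ?s" using lam by (simp add: distrib_left)
  have c1: "1 \<le> ?c v" if v: "v \<in> V" for v
  proof -
    have "card (lone2 v) + (\<Sum>u\<in>N v. card (lone1 u)) \<noteq> 0" using odd_lone[OF v n] by (metis even_zero)
    then have "1 \<le> real (card (lone2 v) + (\<Sum>u\<in>N v. card (lone1 u)))" by linarith
    then show ?thesis by simp
  qed
  have "(\<Sum>v\<in>V. x v * (\<Sum>u\<in>N v. ?a u)) = (\<Sum>v\<in>V. \<Sum>u\<in>N v. x v * ?a u)" by (simp add: sum_distrib_left)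
  also have "\<dots> = (\<Sum>u\<in>V. \<Sum>v\<in>N u. x v * ?a u)" by (rule sum_N_swap_V)
  also have "\<dots> = (\<Sum>u\<in>V. lam * (x u * ?a u))"
    by (intro sum.cong refl) (simp add: sum_distrib_right[symmetric] eig)
  also have "\<dots> = lam * ?A" by (rule sum_distrib_left[symmetric])
  finally have C: "(\<Sum>v\<in>V. x v * ?c v) = ?B + lam * ?A" by (simp add: distrib_left sum.distrib)
  have lo: "?s \<le> ?B + lam * ?A"
    unfolding C[symmetric]
  proof (rule sum_mono)
    fix v assume "v \<in> V"
    then show "x v \<le> x v * ?c v" using mult_left_mono[OF c1 x0, of v v] by simp
  qed
  have "(lam - 1) * ?B \<le> 0" using up lo by (simp add: algebra_simps)
  then have "?B \<le> 0" using lam by (simp add: mult_le_0_iff)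
  then have B: "?B = 0" using B0 by simp
  then have "x v * ?b v = 0" if "v \<in> V" for v
    using that finite_V x0 by (subst (asm) sum_nonneg_eq_0_iff) auto
  then have lone0: "lone2 v = {}" if "v \<in> V" "0 < x v" for v
    using that finite_lone[of v] by fastforce
  have pos: "0 < x w" if "w \<in> V" for w
    by (rule positive_everywhere[OF x0 eig _ xpos _ that]) (use lone0[OF xpos] lam in auto)
  have l2: "lone2 v = {}" if "v \<in> V" for v using lone0 pos that by auto
  \<comment> \<open>Once \<open>?B = 0\<close>, the upper estimate \<open>up\<close> leaves no slack
    in the parity bound \<open>c1\<close>, which is therefore an equality at every vertex of
    positive entry.\<close>
  have "(\<Sum>v\<in>V. x v * (?c v - 1)) = 0"
  proof (rule antisym)
    show "(\<Sum>v\<in>V. x v * (?c v - 1)) \<le> 0"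
      using C up B by (simp add: right_diff_distrib sum_subtractf)
    show "0 \<le> (\<Sum>v\<in>V. x v * (?c v - 1))" by (intro sum_nonneg mult_nonneg_nonneg x0) (use c1 in auto)
  qed
  then have z: "x v * (?c v - 1) = 0" if "v \<in> V" for v
    using that finite_V x0 c1 by (subst (asm) sum_nonneg_eq_0_iff) auto
  have "(\<Sum>u\<in>N v. card (lone1 u)) = 1" if v: "v \<in> V" for v
  proof -
    have "?c v = 1" using z[OF v] pos[OF v] by simp
    then have "real (\<Sum>u\<in>N v. card (lone1 u)) = 1" using l2[OF v] by simp
    then show ?thesis by linarith
  qed
  then show ?thesis using even_structure l2 xpos(1) by blast
qed

end

text \<open>\<open>\<gamma>\<close> counts the vertex left unmatched, which exists exactly for even
  \<open>n\<close>. The equation is written with \<open>r\<^sup>2 - r\<close> because that is the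
  quantity in \<open>weighted_lone_sum\<close>.\<close>

lemma F_graph_1_spectral_radius_lower:
  assumes n: "3 \<le> n"
  defines "\<gamma> \<equiv> (if even n then 1 else 0 :: real)"
  shows "\<exists>r>1. r \<le> adjacency_spectral_radius (F_graph n 1) \<and> r\<^sup>2 - r + \<gamma> / r = real n - 1"
proof -
  let ?F = "F_graph n 1" and ?NF = "\<lambda>v. {u. (v, u) \<in> parcs (F_graph n 1)}"
  \<comment> \<open>The characteristic equation of the quotient of \<open>F_graph n 1\<close> by centre, matched and
    unmatched vertices, with eigenvector \<open>1\<close>, \<open>1 / (r - 1)\<close>, \<open>1 / r\<close>.\<close>
  let ?g = "\<lambda>r::real. r ^ 3 - r ^ 2 - (real n - 1) * r + \<gamma>"
  have \<gamma>: "0 \<le> \<gamma>" "\<gamma> \<le> 1" by (auto simp: \<gamma>_def)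
  have "\<exists>r\<ge>1. r \<le> real n \<and> ?g r = 0"
  proof (rule IVT')
    show "?g 1 \<le> 0" using n \<gamma> by simp
    have "2 * (real n * real n) \<le> real n * (real n * real n)"
      by (rule mult_right_mono) (use n in auto)
    moreover have "?g (real n) = real n * (real n * real n) - 2 * (real n * real n) + real n + \<gamma>"
      by (simp add: power2_eq_square power3_eq_cube algebra_simps)
    ultimately show "0 \<le> ?g (real n)" using \<gamma> by linarith
  qed (use n in \<open>auto intro!: continuous_intros\<close>)
  then obtain r where r: "1 \<le> r" "?g r = 0" by (elim exE conjE) (rule that)
  have "r \<noteq> 1" using r(2) n \<gamma> by auto
  then have r1: "1 < r" using r by simp
  have cubic: "r ^ 3 - r ^ 2 = (real n - 1) * r - \<gamma>" using r(2) by simp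
  have F: "pair_graph ?F" by (rule pair_graph_F_graph)
  interpret F: simple_graph "pverts ?F" ?NF by (rule simple_graph_of_pair_graph[OF F])
  have ne: "pverts ?F \<noteq> {}" by (auto simp: F_graph_verts)
  define q where "q = (n - 1) div 2"
  have q: "2 * q \<le> n - 1" "n - 1 \<le> 2 * q + 1" by (simp_all add: q_def)
  define y where "y = (\<lambda>v::nat + nat. case v of Inl _ \<Rightarrow> 1 | Inr j \<Rightarrow> if j < 2 * q then 1 / (r - 1) else 1 / r)"
  have y: "y (Inl i) = 1" "y (Inr j) = (if j < 2 * q then 1 / (r - 1) else 1 / r)" for i j by (simp_all add: y_def)
  have eig: "(\<Sum>u\<in>?NF v. y u) = r * y v" if v: "v \<in> pverts ?F" for v
  proof (cases v)
    case (Inl i)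
    then have i: "i = 0" using v by (auto simp: F_graph_verts)
    have NF: "?NF v = Inr ` {..<n - 1}"
    proof (rule Set.set_eqI)
      fix u show "u \<in> ?NF v \<longleftrightarrow> u \<in> Inr ` {..<n - 1}"
        by (cases u) (auto simp: Inl i F_graph_arcs)
    qed
    have "(\<Sum>u\<in>?NF v. y u) = (\<Sum>j<n - 1. y (Inr j))" unfolding NF by (simp add: sum.reindex)
    also have "\<dots> = (real n - 1 - \<gamma>) / (r - 1) + \<gamma> / r"
    proof (cases "even n")
      case True
      then have "n - 1 = Suc (2 * q)" using n by (simp add: q_def)
      moreover from this have "real n - 1 - \<gamma> = 2 * real q" using True n by (simp add: \<gamma>_def)
      ultimately show ?thesis using True by (simp add: y \<gamma>_def)
    next
      case False
      then have "n - 1 = 2 * q" using n by (simp add: q_def) 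
      moreover from this have "real n - 1 - \<gamma> = 2 * real q" using False n by (simp add: \<gamma>_def)
      ultimately show ?thesis using False by (simp add: y \<gamma>_def)
    qed
    also have "\<dots> = ((real n - 1) * r - \<gamma>) / ((r - 1) * r)" using r1 by (simp add: field_simps)
    also have "\<dots> = r" unfolding cubic[symmetric] using r1 by (simp add: field_simps power2_eq_square power3_eq_cube)
    finally show ?thesis using Inl y by simp
  next
    case (Inr j)
    then have j: "j < n - 1" using v by (auto simp: F_graph_verts)
    show ?thesis
    proof (cases "j < 2 * q")
      case True
      define j' where "j' = (if even j then j + 1 else j - 1)"
      have j': "j' < 2 * q" using True by (auto simp: j'_def)
      have NF: "?NF v = {Inl 0, Inr j'}"
      proof (rule Set.set_eqI)
        fix u
        have *: "(\<exists>k. 2 * k + 1 < n - 1 \<and> (j = 2 * k \<and> b = 2 * k + 1 \<or> b = 2 * k \<and> j = 2 * k + 1)) \<longleftrightarrow> b = j'" for b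
        proof
          assume "\<exists>k. 2 * k + 1 < n - 1 \<and> (j = 2 * k \<and> b = 2 * k + 1 \<or> b = 2 * k \<and> j = 2 * k + 1)"
          then show "b = j'" by (auto simp: j'_def)
        next
          assume b: "b = j'"
          show "\<exists>k. 2 * k + 1 < n - 1 \<and> (j = 2 * k \<and> b = 2 * k + 1 \<or> b = 2 * k \<and> j = 2 * k + 1)"
          proof (cases "even j")
            case even: True
            then obtain k where "j = 2 * k" by (rule evenE)
            then show ?thesis using b True q by (intro exI[of _ k]) (simp add: j'_def)
          next
            case odd: False
            then obtain k where "j = 2 * k + 1" by (rule oddE)
            then show ?thesis using b True q by (intro exI[of _ k]) (simp add: j'_def)
          qed
        qed
        show "u \<in> ?NF v \<longleftrightarrow> u \<in> {Inl 0, Inr j'}"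
          using j by (cases u) (simp_all add: Inr F_graph_arcs * del: One_nat_def)
      qed
      have "(\<Sum>u\<in>?NF v. y u) = 1 + 1 / (r - 1)" unfolding NF using j' by (simp add: y)
      also have "\<dots> = r * y v" using Inr True r1 by (simp add: y field_simps)
      finally show ?thesis .
    next
      case False
      have NF: "?NF v = {Inl 0}"
      proof (rule Set.set_eqI)
        fix u
        have *: "\<not> (\<exists>k. 2 * k + 1 < n - 1 \<and> (j = 2 * k \<and> b = 2 * k + 1 \<or> b = 2 * k \<and> j = 2 * k + 1))" for b
        proof
          assume "\<exists>k. 2 * k + 1 < n - 1 \<and> (j = 2 * k \<and> b = 2 * k + 1 \<or> b = 2 * k \<and> j = 2 * k + 1)"
          then obtain k where k: "2 * k + 1 < n - 1" "j = 2 * k \<or> j = 2 * k + 1" by auto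
          then have "k < q" using q(2) by linarith
          then show False using k(2) False by linarith
        qed
        show "u \<in> ?NF v \<longleftrightarrow> u \<in> {Inl 0}"
          using j * by (cases u) (simp_all add: Inr F_graph_arcs del: One_nat_def)
      qed
      show ?thesis unfolding NF using Inr False r1 by (simp add: y)
    qed
  qed
  have "F.quad y = r * (\<Sum>v\<in>pverts ?F. (y v)\<^sup>2)" by (rule F.quad_eigenvector[OF eig])
  moreover have "F.quad y \<le> adjacency_spectral_radius ?F * (\<Sum>v\<in>pverts ?F. (y v)\<^sup>2)"
    by (rule spectral_radius_perron[OF F ne])
  moreover have "0 < (\<Sum>v\<in>pverts ?F. (y v)\<^sup>2)"
  proof (rule sum_pos2[of _ "Inl 0"])
    show "Inl 0 \<in> pverts ?F" by (simp add: F_graph_verts)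
  qed (simp_all add: F_graph_verts y)
  ultimately have "r \<le> adjacency_spectral_radius ?F" by simp
  moreover have "r\<^sup>2 - r + \<gamma> / r = real n - 1"
  proof -
    have "r\<^sup>2 - r + \<gamma> / r = (r ^ 3 - r ^ 2 + \<gamma>) / r" using r1 by (simp add: field_simps power2_eq_square power3_eq_cube)
    also have "\<dots> = real n - 1" using r1 unfolding cubic by simp
    finally show ?thesis .
  qed
  ultimately show ?thesis using r1 by blast
qed

section \<open>The extremal graphs\<close>

lemma (in simple_graph) windmill_of_spectral_radius:
  fixes x :: "'a \<Rightarrow> real"
  assumes no: "\<And>v S. v \<in> V \<Longrightarrow> \<not> packing v 1 S"
    and x0: "\<And>v. 0 \<le> x v" and xpos: "\<exists>v\<in>V. 0 < x v"
    and eig: "\<And>v. v \<in> V \<Longrightarrow> (\<Sum>u\<in>N v. x u) = lam * x v"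
    and lam: "adjacency_spectral_radius (F_graph (card V) 1) \<le> lam" and n: "3 \<le> card V"
  shows "\<exists>f N'. F_copy V N' (card V) 1 f \<and> (\<forall>v\<in>V. N v = N' v)"
proof -
  interpret c4_free V N
  proof
    fix b v :: 'a assume bv: "b \<noteq> v"
    show "card (N b \<inter> N v) \<le> 1"
    proof (cases "v \<in> V")
      case True
      have "card (N b \<inter> N v - {}) \<le> 1"
        by (rule core_codegree[of v 1]) (use no[OF True] bv in auto)
      then show ?thesis by simp
    next
      case False
      then have "N v = {}" using N_sym N_subset by blast
      then show ?thesis by simp
    qed
  qed
  obtain v0 where v0: "v0 \<in> V" "0 < x v0" using xpos by blast
  define \<gamma> where "\<gamma> = (if even (card V) then 1 else 0 :: real)"
  obtain r where r: "1 < r" "r \<le> adjacency_spectral_radius (F_graph (card V) 1)"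
    "r\<^sup>2 - r + \<gamma> / r = real (card V) - 1"
    using F_graph_1_spectral_radius_lower[OF n, folded \<gamma>_def] by (elim exE conjE) (rule that)
  have rl: "r \<le> lam" and l1: "1 < lam" using r lam by auto
  \<comment> \<open>The function \<open>s\<^sup>2 - s + \<gamma> / s\<close> is increasing for
    \<open>s \<ge> 1\<close>, which turns the equation for \<open>r\<close> into an inequality for
    the larger \<open>lam\<close>.\<close>
  have key: "real (card V) - 1 \<le> lam\<^sup>2 - lam + \<gamma> / lam"
  proof -
    have g: "0 \<le> \<gamma>" "\<gamma> \<le> 1" by (auto simp: \<gamma>_def)
    have "\<gamma> / (lam * r) \<le> 1 / 1" by (intro frac_le) (use g r l1 mult_mono[of 1 lam 1 r] in auto)
    then have "0 \<le> lam + r - 1 - \<gamma> / (lam * r)" using r(1) l1 by linarith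
    then have "0 \<le> (lam - r) * (lam + r - 1 - \<gamma> / (lam * r))"
      using rl by (intro mult_nonneg_nonneg) auto
    also have "\<dots> = (lam\<^sup>2 - lam + \<gamma> / lam) - (r\<^sup>2 - r + \<gamma> / r)"
      using r l1 by (simp add: field_simps power2_eq_square)
    finally show ?thesis using r(3) by simp
  qed
  show ?thesis
  proof (cases "even (card V)")
    case True
    show ?thesis
      by (rule even_case[OF x0 v0 eig l1 True]) (use key True in \<open>simp_all add: \<gamma>_def\<close>)
  next
    case False
    show ?thesis
      by (rule odd_case[OF x0 v0 eig]) (use key False l1 n in \<open>simp_all add: \<gamma>_def\<close>)
  qed
qed

text \<open>The three largeness conditions are combined into one sum of nonnegative terms that
  depends on \<open>t\<close> alone.\<close>

lemma (in simple_graph) F_copy_of_spectral_radius: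
  fixes x :: "'a \<Rightarrow> real"
  assumes t: "2 \<le> t" and no: "\<And>v S. v \<in> V \<Longrightarrow> \<not> packing v t S"
    and x0: "\<And>v. 0 \<le> x v" and xpos: "\<exists>v\<in>V. 0 < x v"
    and eig: "\<And>v. v \<in> V \<Longrightarrow> (\<Sum>u\<in>N v. x u) = lam * x v"
    and lam: "adjacency_spectral_radius (F_graph (card V) t) \<le> lam"
    and n: "12 * real t + 16 * real t * defect_const t + 2 * outside_const t * (real t + outside_const t)
      \<le> sqrt (real (card V))"
  shows "\<exists>f N'. F_copy V N' (card V) t f \<and> (\<forall>v\<in>V. N v = N' v)"
proof -
  let ?r = "sqrt (real (card V))"
  have "0 \<le> defect_const t" "0 \<le> outside_const t"
    by (simp_all add: defect_const_def far_const_def outside_const_def)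
  then have "0 \<le> 16 * real t * defect_const t" "0 \<le> 2 * outside_const t * (real t + outside_const t)"
    by simp_all
  then have n1: "12 * real t \<le> ?r" and n2: "16 * real t * defect_const t \<le> ?r"
    and n3: "2 * outside_const t * (real t + outside_const t) \<le> ?r"
    using n by linarith+
  have tn: "t < card V"
  proof -
    have "1 \<le> ?r" using n1 t by linarith
    then have "?r * 1 \<le> ?r * ?r" by (intro mult_left_mono) auto
    then have "?r \<le> real (card V)" by simp
    then show ?thesis using n1 t by linarith
  qed
  have Max: "Max (x ` V) \<in> x ` V" by (rule Max_in) (use finite_V xpos in auto)
  then obtain z where z: "z \<in> V" "Max (x ` V) = x z" by (elim imageE) (rule that)
  have zmax: "x v \<le> x z" if "v \<in> V" for v using that finite_V by (simp flip: z(2))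
  have zpos: "0 < x z" using xpos zmax by fastforce
  define y where "y v = x v / x z" for v
  note F = F_graph_spectral_radius_lower[of t "card V"]
  have lam_pos: "0 < lam" using F(2) t tn lam by simp
  have lam2: "real t * (real (card V) - real t) \<le> lam\<^sup>2"
  proof -
    have "(adjacency_spectral_radius (F_graph (card V) t))\<^sup>2 \<le> lam\<^sup>2"
      using F(2) t tn lam by (intro power_mono) auto
    then show ?thesis using F(1) t tn by simp
  qed
  have y0: "0 \<le> y v" for v using x0 zpos by (simp add: y_def)
  have yeig: "(\<Sum>u\<in>N v. y u) = lam * y v" if "v \<in> V" for v
    using eig[OF that] by (simp add: y_def sum_divide_distrib[symmetric])
  interpret dense_packing_free V N t lam y z "real (card V)" ?r
  proof
    show "2 \<le> t" by (rule t)
    show "\<not> packing v t S" if "v \<in> V" for v S by (rule no[OF that])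
    show "0 \<le> y v" for v by (rule y0)
    show "y v \<le> 1" if "v \<in> V" for v using zmax[OF that] zpos by (simp add: y_def)
    show "z \<in> V" by (rule z)
    show "y z = 1" using zpos by (simp add: y_def)
    show "(\<Sum>u\<in>N v. y u) = lam * y v" if "v \<in> V" for v by (rule yeig[OF that])
    show "0 \<le> lam" using lam_pos by simp
    show "12 * real t \<le> ?r" by (rule n1)
  qed (rule lam2 refl)+
  note C = core_props[OF n2]
  have "\<exists>f N'. F_copy V N' (card V) (card core) f \<and> (\<forall>v\<in>V. N v = N' v)"
  proof (rule F_comparison[of y])
    show "adjacency_spectral_radius (F_graph (card V) (card core)) \<le> lam" unfolding C(3) by (rule lam)
    show "core \<noteq> {}" using C(2) by blast
    show "card (N b \<inter> N l - core) \<le> 1" if "b \<in> V - core" "l \<in> core" for b l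
      by (rule core_codeg[OF n2 that])
    show "(\<Sum>v\<in>N u - core. y v) \<le> 1 / 2" if "u \<in> V - core" for u
      by (rule outside_core_small[OF n2 n3 that])
  qed (use y0 yeig lam_pos C in auto)
  then show ?thesis unfolding C(3) .
qed

theorem theorem1p7:
  fixes t1 t2 t :: nat and ks ps :: "nat list"
  assumes "length ks = t1" and "\<forall>i<t1. ks ! i = 2"
    and "length ps = t2" and "\<forall>j<t2. ps ! j = 2"
    and "t = t1 + t2"
  shows "\<exists>n0::nat. \<forall>n\<ge>n0. \<forall>G :: 'a pair_pre_digraph.
    pair_graph G \<and> card (pverts G) = n
      \<and> adjacency_spectral_radius G \<ge> adjacency_spectral_radius (F_graph n t) \<longrightarrow>
    \<not> digraph_iso (with_proj G) (with_proj (F_graph n t)) \<longrightarrow>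
    contains_subgraph G (CP_graph (map (\<lambda>k. 2 * k) ks) (map (\<lambda>p. 2 * p) ps))"
proof -
  define R where "R = 12 * real t + 16 * real t * defect_const t
    + 2 * outside_const t * (real t + outside_const t)"
  obtain n1 :: nat where n1: "R\<^sup>2 \<le> real n1" using real_arch_simple by blast
  let ?cs = "map (\<lambda>k. 2 * k) ks" and ?qs = "map (\<lambda>p. 2 * p) ps"
  have len: "length ?cs + length ?qs = t" using assms by simp
  have cs: "\<forall>c\<in>set ?cs. c = 4" and qs: "\<forall>q\<in>set ?qs. q = 4"
    using assms by (auto simp: set_conv_nth)
  have "contains_subgraph G (CP_graph ?cs ?qs)"
    if n: "max 3 n1 \<le> n" and G: "pair_graph G" "card (pverts G) = n"
      and rad: "adjacency_spectral_radius (F_graph n t) \<le> adjacency_spectral_radius G"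
      and not_iso: "\<not> digraph_iso (with_proj G) (with_proj (F_graph n t))"
    for n and G :: "'a pair_pre_digraph"
  proof (rule ccontr)
    assume not_contains: "\<not> contains_subgraph G (CP_graph ?cs ?qs)"
    let ?V = "pverts G" and ?N = "\<lambda>v. {u. (v, u) \<in> parcs G}" and ?lam = "adjacency_spectral_radius G"
    interpret simple_graph ?V ?N by (rule simple_graph_of_pair_graph[OF G(1)])
    have no: "\<not> packing v t S" if v: "v \<in> ?V" for v S
      using packing_contains_CP_graph[OF G(1) v _ cs qs] not_contains unfolding len by blast
    have ne: "?V \<noteq> {}" using G(2) n by auto
    then obtain v where v: "v \<in> ?V" by blast
    \<comment> \<open>For \<open>t = 0\<close> the graph to be found is a single vertex, which the
      empty packing provides.\<close>
    have "t \<noteq> 0"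
    proof
      assume "t = 0"
      then have "packing v t {}" using packing_0 by simp
      then show False using no[OF v] by blast
    qed
    obtain x where x: "\<And>v. 0 \<le> x v" "\<exists>v\<in>?V. x v > 0"
      "\<And>v. v \<in> ?V \<Longrightarrow> (\<Sum>u\<in>?N v. x u) = ?lam * x v"
      by (rule spectral_radius_perron[OF G(1) ne]) (rule that)
    have "\<exists>f N'. F_copy ?V N' (card ?V) t f \<and> (\<forall>v\<in>?V. ?N v = N' v)"
    proof (cases "t = 1")
      case True
      show ?thesis
        unfolding True
        by (rule windmill_of_spectral_radius[of x ?lam])
          (use no x rad G(2) n in \<open>auto simp: True\<close>)
    next
      case False
      have "R \<le> sqrt (real (card ?V))"
        using n1 n G(2) by (intro real_le_rsqrt) simp
      then show ?thesis
        using \<open>t \<noteq> 0\<close> False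
        by (intro F_copy_of_spectral_radius[of t x ?lam] no x) (use rad G(2) in \<open>simp_all add: R_def\<close>)
    qed
    then obtain f N' where F: "F_copy ?V N' (card ?V) t f" "\<forall>v\<in>?V. ?N v = N' v"
      by (elim exE conjE) (rule that)
    have "digraph_iso (with_proj G) (with_proj (F_graph (card ?V) t))"
      by (rule F_copy.iso_F_graph[OF F(1) G(1)]) (use F(2) in auto)
    then show False using not_iso G(2) by simp
  qed
  then show ?thesis by (intro exI[of _ "max 3 n1"]) blast
qed

end
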